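(* There exist absolute constants $c_1,c_2>0$ such that for every $\epsilon>0$ there exists $n_1=n_1(\epsilon)$ with the following properties. If $n\ge n_1$ and $1<k<n^{\frac12-\epsilon}$, then $$\theta_k(G(n,1/2))\ \ge\ \frac{c_1 n^2}{k^3\log^2 n}$$ with high probability; and if $n\ge n_1$ and $(\log\log n)^{1/\epsilon}\le k\le \log n$, then $$\theta_k(G(n,1/2))\ \le\ \frac{c_2 n^2}{k^{1-4\epsilon}\log^2 n}$$ with high probability.
   Context: $G(n,1/2)$ denotes the Erdős–Rényi random graph on $n$ vertices in which each pair is an edge independently with probability $1/2$; "with high probability" means with probability tending to $1$ as $n\to\infty$. For a positive integer $k$, a $k$-representation of a graph $G$ is a set $S$ together with subsets $S_v\subseteq S$ ($v\in V(G)$) such that $|S_u\cap S_v|\ge k$ if and only if $uv$ is an edge of $G$. The $k$-representation number $\theta_k(G)$ is the minimum cardinality of a set $S$ admitting a $k$-representation of $G$. *)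

theory Defs
  imports "HOL-Probability.Probability"
begin

text \<open>A simple graph is given by a vertex set \<open>V\<close> and a set \<open>E\<close> of two-element subsets of \<open>V\<close>.\<close>

definition vertex_pairs :: "'a set \<Rightarrow> 'a set set" where
  "vertex_pairs V = {e. e \<subseteq> V \<and> card e = 2}"

text \<open>The condition \<open>finite S\<close> keeps \<open>card\<close> meaningful (it is 0 on infinite sets).\<close>

definition k_representation ::
  "nat \<Rightarrow> 'a set \<Rightarrow> 'a set set \<Rightarrow> 'b set \<Rightarrow> ('a \<Rightarrow> 'b set) \<Rightarrow> bool" where
  "k_representation k V E S F \<longleftrightarrow>
     finite S \<and> (\<forall>v\<in>V. F v \<subseteq> S) \<and>
     (\<forall>u\<in>V. \<forall>v\<in>V. u \<noteq> v \<longrightarrow> (k \<le> card (F u \<inter> F v) \<longleftrightarrow> {u, v} \<in> E))"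

text \<open>The ground set \<open>S\<close> ranges over finite sets of naturals; \<open>theta_le\<close> below shows that ground
  sets of other types give nothing smaller, and \<open>theta_attained\<close> that the minimum is taken over a
  nonempty set for every finite graph and \<open>k > 0\<close>.\<close>

definition theta :: "nat \<Rightarrow> 'a set \<Rightarrow> 'a set set \<Rightarrow> nat" where
  "theta k V E =
     (LEAST m. \<exists>(S :: nat set) F. k_representation k V E S F \<and> card S = m)"

text \<open>The law of the edge set of the Erdos-Renyi graph \<open>G(n,p)\<close> on the vertex set \<open>{..<n}\<close>.\<close>

definition random_graph :: "nat \<Rightarrow> real \<Rightarrow> nat set set pmf" where
  "random_graph n p =
     map_pmf (\<lambda>x. {e \<in> vertex_pairs {..<n}. x e})
       (Pi_pmf (vertex_pairs {..<n}) False (\<lambda>_. bernoulli_pmf p))"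

lemma k_representation_nat:
  fixes S :: "'b set"
  assumes "k_representation k V E S F"
  shows "\<exists>(S' :: nat set) F'. k_representation k V E S' F' \<and> card S' = card S"
proof -
  have fin: "finite S" and sub: "\<And>v. v \<in> V \<Longrightarrow> F v \<subseteq> S"
    using assms by (auto simp: k_representation_def)
  obtain g :: "'b \<Rightarrow> nat" where g: "inj_on g S"
    using finite_imp_inj_to_nat_seg[OF fin] by blast
  have "card (g ` F u \<inter> g ` F v) = card (F u \<inter> F v)" if "u \<in> V" "v \<in> V" for u v
  proof -
    have "g ` F u \<inter> g ` F v = g ` (F u \<inter> F v)"
      using inj_on_image_Int[OF g sub sub] that by auto
    moreover have "inj_on g (F u \<inter> F v)"
      using g sub that by (meson inf.coboundedI1 inj_on_subset)
    ultimately show ?thesis by (simp add: card_image)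
  qed
  then have "k_representation k V E (g ` S) (\<lambda>v. g ` F v)"
    using assms unfolding k_representation_def by (auto intro!: imageI)
  moreover have "card (g ` S) = card S" by (rule card_image[OF g])
  ultimately show ?thesis by blast
qed

lemma theta_le:
  assumes "k_representation k V E S F"
  shows "theta k V E \<le> card S"
  unfolding theta_def using k_representation_nat[OF assms] by (intro Least_le)

lemma theta_attained:
  assumes "finite V" and "0 < k"
  shows "\<exists>(S :: nat set) F. k_representation k V E S F \<and> card S = theta k V E"
proof -
  define F where "F = (\<lambda>v. {e \<in> E \<inter> vertex_pairs V. v \<in> e} \<times> {..<k})"
  have "k \<le> card (F u \<inter> F v) \<longleftrightarrow> {u, v} \<in> E" if uv: "u \<in> V" "v \<in> V" "u \<noteq> v" for u v
  proof -
    have "e = {u, v}" if "card e = 2" "u \<in> e" "v \<in> e" for e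
      using that uv by (auto simp: card_2_iff)
    then have "F u \<inter> F v = (if {u, v} \<in> E then {{u, v}} \<times> {..<k} else {})"
      using uv by (auto simp: F_def vertex_pairs_def)
    then show ?thesis using \<open>0 < k\<close> by (simp add: card_cartesian_product)
  qed
  moreover have "F v \<subseteq> Pow V \<times> {..<k}" for v by (auto simp: F_def vertex_pairs_def)
  ultimately have "k_representation k V E (Pow V \<times> {..<k}) F"
    using \<open>finite V\<close> by (simp add: k_representation_def)
  then have "\<exists>m. \<exists>(S :: nat set) F. k_representation k V E S F \<and> card S = m"
    using k_representation_nat by blast
  then show ?thesis unfolding theta_def by (rule LeastI_ex)
qed

end

theory Submission
  imports Defs "HOL-Real_Asymp.Real_Asymp"
begin

text \<open>
  Lower bound. A representation is a family of vertex sets \<open>A\<^sub>s = {v. s \<in> F v}\<close>. Every non-edge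
  lies in fewer than \<open>k\<close> of them, while in a random graph every set of size at least a constant
  times \<open>ln n\<close> spans a positive proportion of non-edges. Hence \<open>\<Sum>|A\<^sub>s|\<^sup>2\<close> is \<open>O(k n\<^sup>2)\<close>, and by
  Cauchy-Schwarz a small ground set forces \<open>\<Sum>|A\<^sub>s|\<close> to be a small multiple of \<open>n\<^sup>2 / ln n\<close>. There are
  too few families of that total size to represent more than a vanishing proportion of all graphs.

  Upper bound for \<open>k\<close> large compared with \<open>(ln ln n)\<^sup>2\<close>. Put \<open>\<delta> = ln ln n / \<surd>k\<close>, sample a list \<open>X\<close> of
  \<open>a \<approx> k ln n / (ln ln n)\<^sup>2\<close> vertices, let \<open>W\<close> be the set of vertices with at least \<open>(1/2 + \<delta>) a\<close>
  neighbours in \<open>X\<close>, and take a random subset of \<open>X\<close> together with a random subset of \<open>W\<close> of similar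
  size. Because of the pairs between \<open>X\<close> and \<open>W\<close>, edges lie in this random set with a probability
  larger by a factor \<open>1 + \<Omega>(\<delta>)\<close> than non-edges. Among \<open>\<Theta>(k n\<^sup>2 / a\<^sup>2)\<close> independent copies, all
  edges lie in at least \<open>k\<close> sets and all non-edges in fewer, up to a proportion of
  \<open>exp (- \<Omega>(k \<delta>\<^sup>2))\<close> exceptions, which is smaller than any power of \<open>ln n\<close>; the exceptions are repaired
  by hand.

  Upper bound for smaller \<open>k\<close>. Greedily chosen cliques of size \<open>ln n / 4\<close> cover all but few edges, and
  \<open>k - 1\<close> copies of the whole vertex set raise the threshold from \<open>1\<close> to \<open>k\<close>.
\<close>

text \<open>Where the parameters come from. If edges and non-edges have mean coverage k (1 +
  \<delta>/2) and k (1 - \<delta>/2), the threshold k fails for a proportion exp (- Omega(k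
  \<delta>^2)) of the pairs, and k \<delta>^2 = (ln ln n)^2 makes this small enough. The number of
  sets is of order k n^2/a^2, so a should be large. It is limited by the high-degree vertices:
  exceeding half of the sample by \<delta> a has probability exp (- O(\<delta>^2 a)), which must
  stay well above the negative power of n with which a random graph imitates fair coins. Hence a is
  a small multiple of ln n/\<delta>^2, and the number of sets is of order (ln ln n)^4 n^2/(k (ln
  n)^2). The assumption (ln ln n)^(1/\<epsilon>) <= k turns (ln ln n)^4 into at most k^(4
  \<epsilon>). For k < 64 (ln ln n)^2 the clique cover costs a factor (ln ln n)^2 over n^2/(ln n)^2,
  which is at most 64 (ln ln n)^4/k, so both regimes end in the same bound.\<close>

lemma sum_Pow_insert:
  fixes f :: "'a set \<Rightarrow> 'b::comm_monoid_add"
  assumes "finite V" "x \<notin> V"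
  shows "sum f (Pow (insert x V)) = sum f (Pow V) + (\<Sum>A\<in>Pow V. f (insert x A))"
proof -
  have "sum f (Pow (insert x V)) = sum f (Pow V) + sum f (insert x ` Pow V)"
    unfolding Pow_insert using assms by (intro sum.union_disjoint) auto
  moreover have "inj_on (insert x) (Pow V)"
    using assms(2) by (auto intro!: inj_onI)
  ultimately show ?thesis by (simp add: sum.reindex)
qed

text \<open>Distributivity. It takes the place of independence: \<open>G(n,1/2)\<close> is a
  uniformly random subset of the pairs, so averages of products over pairs factor.\<close>

lemma sum_Pow_prod:
  fixes h :: "'a \<Rightarrow> bool \<Rightarrow> 'b::comm_semiring_1"
  assumes "finite V"
  shows "(\<Sum>A\<in>Pow V. \<Prod>v\<in>V. h v (v \<in> A)) = (\<Prod>v\<in>V. h v True + h v False)"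
  using assms
proof (induction V rule: finite_induct)
  case (insert x V)
  have e1: "(\<Prod>v\<in>insert x V. h v (v \<in> A)) = h x False * (\<Prod>v\<in>V. h v (v \<in> A))"
    if "A \<in> Pow V" for A
  proof -
    have "x \<notin> A" using that insert.hyps by auto
    then show ?thesis using insert.hyps by simp
  qed
  have e2: "(\<Prod>v\<in>insert x V. h v (v \<in> insert x A)) = h x True * (\<Prod>v\<in>V. h v (v \<in> A))"
    if "A \<in> Pow V" for A
  proof -
    have "(\<Prod>v\<in>V. h v (v \<in> insert x A)) = (\<Prod>v\<in>V. h v (v \<in> A))"
    proof (rule prod.cong)
      fix v assume "v \<in> V"
      then have "v \<noteq> x" using insert.hyps by auto
      then show "h v (v \<in> insert x A) = h v (v \<in> A)" by simp
    qed simp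
    then show ?thesis using insert.hyps by (simp add: prod.insert)
  qed
  show ?case
    unfolding sum_Pow_insert[OF insert.hyps]
    by (subst sum.cong[OF refl e1], simp, subst sum.cong[OF refl e2], simp)
       (simp add: sum_distrib_left[symmetric] insert.IH insert.hyps algebra_simps)
qed simp

lemma sum_Pow_power_card:
  fixes x :: "'b::comm_semiring_1"
  assumes "finite V"
  shows "(\<Sum>A\<in>Pow V. x ^ card A) = (x + 1) ^ card V"
proof -
  have "x ^ card A = (\<Prod>v\<in>V. if v \<in> A then x else 1)" if "A \<in> Pow V" for A
    using that assms by (simp add: prod.If_cases Int_absorb1)
  then have "(\<Sum>A\<in>Pow V. x ^ card A) = (\<Sum>A\<in>Pow V. \<Prod>v\<in>V. if v \<in> A then x else 1)"
    by (intro sum.cong) auto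
  also have "\<dots> = (x + 1) ^ card V"
    by (subst sum_Pow_prod[OF assms, of "\<lambda>v b. if b then x else 1"]) simp
  finally show ?thesis .
qed

section \<open>Probabilities as proportions of edge sets\<close>

lemma finite_vertex_pairs [simp]: "finite V \<Longrightarrow> finite (vertex_pairs V)"
  by (rule finite_subset[of _ "Pow V"]) (auto simp: vertex_pairs_def)

lemma card_vertex_pairs: "finite V \<Longrightarrow> card (vertex_pairs V) = card V choose 2"
  unfolding vertex_pairs_def by (rule n_subsets)

lemma vertex_pairs_mono: "A \<subseteq> B \<Longrightarrow> vertex_pairs A \<subseteq> vertex_pairs B"
  by (auto simp: vertex_pairs_def)

lemma doubleton_in_vertex_pairs [simp]:
  "{u, v} \<in> vertex_pairs V \<longleftrightarrow> u \<in> V \<and> v \<in> V \<and> u \<noteq> v"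
  by (auto simp: vertex_pairs_def card_2_iff)

lemma vertex_pairsE:
  assumes "e \<in> vertex_pairs V"
  obtains u v where "e = {u, v}" "u \<in> V" "v \<in> V" "u \<noteq> v"
  using assms by (auto simp: vertex_pairs_def card_2_iff)

lemma prob_random_graph_half:
  "measure_pmf.prob (random_graph n (1/2)) X =
     real (card {E. E \<subseteq> vertex_pairs {..<n} \<and> E \<in> X}) / 2 ^ card (vertex_pairs {..<n})"
proof -
  have "random_graph n (1/2) = pmf_of_set (Pow (vertex_pairs {..<n}))"
    unfolding random_graph_def by (rule pmf_of_set_Pow_conv_bernoulli) simp
  moreover have "Pow (vertex_pairs {..<n}) \<inter> X = {E. E \<subseteq> vertex_pairs {..<n} \<and> E \<in> X}"
    by auto
  ultimately show ?thesis
    by (simp add: measure_pmf_of_set Pow_not_empty card_Pow)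
qed

text \<open>Each half of the theorem thus splits into a deterministic bound outside an exceptional
  family \<open>Y\<close> and a count of \<open>Y\<close>.\<close>

lemma prob_random_graph_ge:
  assumes "\<And>E. E \<subseteq> vertex_pairs {..<n} \<Longrightarrow> E \<notin> X \<Longrightarrow> E \<in> Y"
  and "real (card {E. E \<subseteq> vertex_pairs {..<n} \<and> E \<in> Y}) \<le> d * 2 ^ card (vertex_pairs {..<n})"
  shows "1 - d \<le> measure_pmf.prob (random_graph n (1/2)) X"
proof -
  let ?P = "vertex_pairs {..<n}"
  have "Pow ?P \<subseteq> {E. E \<subseteq> ?P \<and> E \<in> X} \<union> {E. E \<subseteq> ?P \<and> E \<in> Y}"
    using assms(1) by auto
  then have "card (Pow ?P) \<le> card ({E. E \<subseteq> ?P \<and> E \<in> X} \<union> {E. E \<subseteq> ?P \<and> E \<in> Y})"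
    by (intro card_mono) (auto intro: finite_subset[of _ "Pow ?P"])
  also have "\<dots> \<le> card {E. E \<subseteq> ?P \<and> E \<in> X} + card {E. E \<subseteq> ?P \<and> E \<in> Y}"
    by (rule card_Un_le)
  finally have "2 ^ card ?P \<le> card {E. E \<subseteq> ?P \<and> E \<in> X} + card {E. E \<subseteq> ?P \<and> E \<in> Y}"
    by (simp add: card_Pow)
  then have "real (2 ^ card ?P) \<le> real (card {E. E \<subseteq> ?P \<and> E \<in> X} + card {E. E \<subseteq> ?P \<and> E \<in> Y})"
    by (rule of_nat_mono)
  then show ?thesis
    unfolding prob_random_graph_half using assms(2) by (simp add: field_simps)
qed

lemma card_markov:
  fixes f :: "'a \<Rightarrow> real"
  assumes "finite X" "\<And>x. x \<in> X \<Longrightarrow> 0 \<le> f x" "0 < c"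
  shows "real (card {x \<in> X. c \<le> f x}) \<le> sum f X / c"
proof -
  have "c * card {x \<in> X. c \<le> f x} = (\<Sum>x\<in>{x \<in> X. c \<le> f x}. c)" by simp
  also have "\<dots> \<le> (\<Sum>x\<in>{x \<in> X. c \<le> f x}. f x)" by (rule sum_mono) auto
  also have "\<dots> \<le> sum f X" using assms by (intro sum_mono2) auto
  finally show ?thesis using assms(3) by (simp add: field_simps)
qed

lemma card_bounded_subsets_le:
  assumes "finite \<Omega>"
  shows "card {I. I \<subseteq> \<Omega> \<and> card I \<le> t} \<le> (card \<Omega> + 1) ^ t"
proof -
  let ?L = "{xs. set xs \<subseteq> insert None (Some ` \<Omega>) \<and> length xs = t}"
  have fin: "finite ?L" using assms by (intro finite_lists_length_eq) auto
  have "I \<in> (\<lambda>xs. {x. Some x \<in> set xs}) ` ?L" if "I \<subseteq> \<Omega>" "card I \<le> t" for I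
  proof -
    have "finite I" using that assms finite_subset by blast
    then obtain ys where ys: "set ys = I" "distinct ys"
      using finite_distinct_list by blast
    let ?xs = "map Some ys @ replicate (t - length ys) None"
    have "length ys \<le> t" using ys that distinct_card by metis
    then have "?xs \<in> ?L" "{x. Some x \<in> set ?xs} = I"
      using ys that by auto
    then show ?thesis by blast
  qed
  then have "card {I. I \<subseteq> \<Omega> \<and> card I \<le> t} \<le> card ?L"
    by (intro surj_card_le[OF fin]) blast
  also have "\<dots> = card (insert None (Some ` \<Omega>)) ^ t"
    using assms by (intro card_lists_length_eq) auto
  also have "card (insert None (Some ` \<Omega>)) = card \<Omega> + 1"
    using assms by (simp add: card_image)
  finally show ?thesis .
qed

section \<open>The lower bound\<close>

text \<open>The proportion 1/5 is far enough below the expected 1/2 for a failure rate exp (- N/8)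
  on N pairs, and from size 40 ln n on this rate beats the number of candidate sets.\<close>

definition few_nonedges :: "nat \<Rightarrow> nat set set \<Rightarrow> bool" where
  "few_nonedges n E \<longleftrightarrow> (\<exists>A \<subseteq> {..<n}. 40 * ln (real n) \<le> real (card A) \<and>
     5 * real (card (vertex_pairs A - E)) \<le> real (card (vertex_pairs A)))"

text \<open>The moment generating function of the number of missing pairs: each pair of
  \<open>B\<close> contributes (1 + 1/2)/2 = 3/4 on average.\<close>

lemma sum_Pow_half_power_missing:
  assumes "finite P" "B \<subseteq> P"
  shows "(\<Sum>E\<in>Pow P. (1/2::real) ^ card (B - E)) = (3/4) ^ card B * 2 ^ card P"
proof -
  have fB: "finite B" using assms finite_subset by auto
  have "(1/2::real) ^ card (B - E) = (\<Prod>e\<in>P. if e \<in> B \<and> \<not> e \<in> E then 1/2 else 1)"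
    if "E \<in> Pow P" for E
  proof -
    have "P \<inter> {e. e \<in> B \<and> \<not> e \<in> E} = B - E" using assms(2) by auto
    then show ?thesis using assms(1) by (simp add: prod.If_cases)
  qed
  then have "(\<Sum>E\<in>Pow P. (1/2::real) ^ card (B - E))
      = (\<Sum>E\<in>Pow P. \<Prod>e\<in>P. if e \<in> B \<and> \<not> e \<in> E then 1/2 else 1)"
    by (intro sum.cong) auto
  also have "\<dots> = (\<Prod>e\<in>P. if e \<in> B then 3/2 else 2)"
    by (subst sum_Pow_prod[OF assms(1), of "\<lambda>e b. if e \<in> B \<and> \<not> b then 1/2 else 1"])
       (auto intro!: prod.cong)
  also have "\<dots> = (3/2) ^ card B * 2 ^ card (P - B)"
    using assms by (simp add: prod.If_cases Int_absorb1 Diff_eq)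
  also have "card (P - B) = card P - card B" using assms fB by (simp add: card_Diff_subset)
  also have "(3/2::real) ^ card B * 2 ^ (card P - card B) = (3/4) ^ card B * 2 ^ card P"
    using card_mono[OF assms]
    by (simp add: power_diff power_divide field_simps flip: power_mult_distrib)
  finally show ?thesis .
qed

lemma real_choose_two: "2 * real (a choose 2) = real a * (real a - 1)"
proof -
  have "even (a * (a - 1))" by (cases a) auto
  then have "2 * (a choose 2) = a * (a - 1)" by (simp add: choose_two)
  then have "2 * real (a choose 2) = real a * real (a - 1)"
    by (metis of_nat_mult of_nat_numeral)
  then show ?thesis by (cases a) auto
qed

text \<open>The Chernoff rate for at most a fifth of \<open>x\<close> pairs being missing; its
  exponent is about -0.149 per pair. Taking fifth and eighth powers reduces the comparison with -1/8
  to rational arithmetic and e < 2.72.\<close>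

lemma two_powr_times_three_quarters_powr_le: "(2::real) powr (x/5) * (3/4) powr x \<le> exp (- x / 8)" if "0 \<le> x"
proof -
  have e: "(ln (2::real) / 5 + ln (3/4)) \<le> - 1/8"
  proof -
    have "ln (2::real) / 5 + ln (3/4) = ln (2 * (3/4)^5) / 5"
      by (simp add: ln_mult ln_realpow)
    also have "2 * (3/4::real)^5 = 486/1024" by (simp add: power_divide)
    also have "ln (486/1024::real) \<le> -5/8"
    proof -
      have "(486/1024::real) \<le> exp (-5/8)"
      proof -
        have "(exp (5/8))^8 \<le> (1024/486::real)^8"
        proof -
          have "exp (5/8)^8 = exp (5::real)" by (simp flip: exp_of_nat_mult)
          also have "\<dots> = exp 1 ^ 5" by (simp flip: exp_of_nat_mult)
          also have "\<dots> \<le> (272/100)^5" using e_less_272 by (intro power_mono) auto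
          also have "\<dots> \<le> (1024/486::real)^8" by (simp add: power_divide)
          finally show ?thesis .
        qed
        then have "exp (5/8) \<le> (1024/486::real)" by (rule power_le_imp_le_base[of _ 7, simplified]) auto
        then show ?thesis by (simp add: exp_minus field_simps)
      qed
      then show ?thesis using ln_le_cancel_iff[of "486/1024" "exp (-5/8)"] by simp
    qed
    finally show ?thesis by simp
  qed
  have "(2::real) powr (x/5) * (3/4) powr x = exp (x * (ln 2 / 5 + ln (3/4)))"
    by (simp add: powr_def exp_add[symmetric] algebra_simps)
  also have "\<dots> \<le> exp (x * (-1/8))" using e that by (intro iffD2[OF exp_le_cancel_iff] mult_left_mono) auto
  finally show ?thesis by simp
qed

text \<open>With N = |A| (|A| - 1)/2 pairs, N/8 is at least 2 |A| ln n because |A| - 1 is at least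
  32 ln n. So each \<open>A\<close> fails for a proportion n^(-2|A|) of the graphs, and the union
  bound over all nonempty \<open>A\<close> is the binomial sum (1 + 1/n^2)^n - 1.\<close>

lemma few_nonedges_unlikely:
  assumes "3 \<le> n"
  shows "real (card {E. E \<subseteq> vertex_pairs {..<n} \<and> few_nonedges n E})
           \<le> (2 / real n) * 2 ^ card (vertex_pairs {..<n})"
proof -
  let ?P = "vertex_pairs {..<n}"
  define l where "l = ln (real n)"
  have l1: "1 \<le> l"
    using assms e_less_272 ln_mono[of "exp 1" "real n"] by (simp add: l_def)
  define \<A> where "\<A> = {A. A \<subseteq> {..<n} \<and> 40 * l \<le> real (card A)}"
  have fA: "finite \<A>" unfolding \<A>_def by (rule finite_subset[of _ "Pow {..<n}"]) auto
  have each: "real (card {E \<in> Pow ?P. 5 * real (card (vertex_pairs A - E)) \<le> real (card (vertex_pairs A))})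
       \<le> (1 / real n ^ 2) ^ card A * 2 ^ card ?P" if "A \<in> \<A>" for A
  proof -
    let ?B = "vertex_pairs A" and ?N = "real (card (vertex_pairs A))"
    have A: "A \<subseteq> {..<n}" "40 * l \<le> real (card A)" "finite A" using that by (auto simp: \<A>_def finite_subset)
    have "{E \<in> Pow ?P. 5 * real (card (?B - E)) \<le> ?N} \<subseteq> {E \<in> Pow ?P. (1/2) powr (?N/5) \<le> (1/2::real) ^ card (?B - E)}"
      by (auto simp: powr_mono' simp flip: powr_realpow)
    then have "real (card {E \<in> Pow ?P. 5 * real (card (?B - E)) \<le> ?N})
        \<le> real (card {E \<in> Pow ?P. (1/2) powr (?N/5) \<le> (1/2::real) ^ card (?B - E)})"
      by (intro of_nat_mono card_mono) auto
    also have "\<dots> \<le> ((3/4) ^ card ?B * 2 ^ card ?P) / (1/2) powr (?N/5)"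
      using card_markov[of "Pow ?P" "\<lambda>E. (1/2::real) ^ card (?B - E)" "(1/2) powr (?N/5)"]
      by (simp add: sum_Pow_half_power_missing vertex_pairs_mono A)
    also have "\<dots> = (2 powr (?N/5) * (3/4) powr ?N) * 2 ^ card ?P"
      by (simp add: powr_realpow powr_divide field_simps)
    also have "\<dots> \<le> exp (- ?N / 8) * 2 ^ card ?P"
      by (intro mult_right_mono two_powr_times_three_quarters_powr_le) auto
    also have "exp (- ?N / 8) \<le> exp (- 2 * l * card A)"
    proof -
      have "32 * l * card A \<le> (real (card A) - 1) * card A"
        using A(2) l1 by (intro mult_right_mono) auto
      then show ?thesis
        using real_choose_two[of "card A"] A(3) by (simp add: card_vertex_pairs algebra_simps)
    qed
    also have "exp (- 2 * l * card A) = (1 / real n ^ 2) ^ card A"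
    proof -
      have "exp (- 2 * l * card A) = (exp (- (l + l))) ^ card A" by (simp add: algebra_simps flip: exp_of_nat_mult)
      also have "exp (- (l + l)) = 1 / real n ^ 2"
        using assms unfolding exp_minus exp_add by (simp add: l_def power2_eq_square field_simps)
      finally show ?thesis .
    qed
    finally show ?thesis by simp
  qed
  let ?bad = "\<lambda>A. {E \<in> Pow ?P. 5 * real (card (vertex_pairs A - E)) \<le> real (card (vertex_pairs A))}"
  have "card {E. E \<subseteq> ?P \<and> few_nonedges n E} \<le> card (\<Union>A\<in>\<A>. ?bad A)"
    by (intro card_mono finite_UN_I fA) (auto simp: few_nonedges_def \<A>_def l_def)
  also have "\<dots> \<le> (\<Sum>A\<in>\<A>. card (?bad A))"
    by (rule card_UN_le[OF fA])
  finally have "real (card {E. E \<subseteq> ?P \<and> few_nonedges n E}) \<le> (\<Sum>A\<in>\<A>. real (card (?bad A)))"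
    by (simp flip: of_nat_sum)
  also have "\<dots> \<le> (\<Sum>A\<in>\<A>. (1 / real n ^ 2) ^ card A * 2 ^ card ?P)"
    by (intro sum_mono each)
  also have "\<dots> \<le> (\<Sum>A\<in>Pow {..<n} - {{}}. (1 / real n ^ 2) ^ card A * 2 ^ card ?P)"
    using l1 by (intro sum_mono2) (auto simp: \<A>_def)
  also have "\<dots> = ((\<Sum>A\<in>Pow {..<n}. (1 / real n ^ 2) ^ card A) - 1) * 2 ^ card ?P"
    by (simp add: sum_diff1 sum_distrib_right[symmetric])
  also have "\<dots> = ((1 / real n ^ 2 + 1) ^ n - 1) * 2 ^ card ?P"
    by (subst sum_Pow_power_card) auto
  also have "(1 / real n ^ 2 + 1) ^ n \<le> exp (1 / real n ^ 2) ^ n"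
    by (intro power_mono) (auto simp: add.commute)
  also have "exp (1 / real n ^ 2) ^ n = exp (1 / real n)"
    using assms by (simp add: power2_eq_square flip: exp_of_nat_mult)
  also have "exp (1 / real n) \<le> 1 + 2 * (1 / real n)"
    using assms by (intro real_exp_bound_lemma) auto
  finally show ?thesis by (simp add: mult_right_mono)
qed

text \<open>Numbering the ground set makes the graph a function of a set of cells in a grid.
  Counting such sets of cells will bound the number of graphs.\<close>

lemma representation_incidences:
  fixes n k :: nat and S :: "nat set"
  assumes rep: "k_representation k {..<n} E S F" and E: "E \<subseteq> vertex_pairs {..<n}"
  shows "\<exists>I \<subseteq> {..<n} \<times> {..<card S}. card I = (\<Sum>u<n. card (F u)) \<and>
     E = {e. \<exists>u v. e = {u, v} \<and> u < n \<and> v < n \<and> u \<noteq> v \<and> k \<le> card {s. (u, s) \<in> I \<and> (v, s) \<in> I}}"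
proof -
  have fS: "finite S" and FS: "\<And>v. v < n \<Longrightarrow> F v \<subseteq> S"
    and FE: "\<And>u v. u < n \<Longrightarrow> v < n \<Longrightarrow> u \<noteq> v \<Longrightarrow> k \<le> card (F u \<inter> F v) \<longleftrightarrow> {u, v} \<in> E"
    using rep by (auto simp: k_representation_def)
  obtain h where h: "bij_betw h S {0..<card S}" using ex_bij_betw_finite_nat[OF fS] by blast
  define I where "I = (SIGMA u:{..<n}. h ` F u)"
  have inj: "inj_on h B" if "B \<subseteq> S" for B
    using h that by (auto simp: bij_betw_def intro: inj_on_subset)
  have "I \<subseteq> {..<n} \<times> {..<card S}"
    using FS h by (fastforce simp: I_def bij_betw_def)
  moreover have "card I = (\<Sum>u<n. card (F u))"
    unfolding I_def using FS fS inj
    by (subst card_SigmaI) (auto intro!: sum.cong card_image intro: finite_subset)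
  moreover have "card {s. (u, s) \<in> I \<and> (v, s) \<in> I} = card (F u \<inter> F v)" if "u < n" "v < n" for u v
  proof -
    have "{s. (u, s) \<in> I \<and> (v, s) \<in> I} = h ` F u \<inter> h ` F v"
      using that by (auto simp: I_def)
    also have "\<dots> = h ` (F u \<inter> F v)"
      using inj_on_image_Int[OF inj[OF order_refl] FS FS] that by auto
    also have "card \<dots> = card (F u \<inter> F v)"
      using FS that by (intro card_image inj) auto
    finally show ?thesis .
  qed
  then have "E = {e. \<exists>u v. e = {u, v} \<and> u < n \<and> v < n \<and> u \<noteq> v \<and> k \<le> card {s. (u, s) \<in> I \<and> (v, s) \<in> I}}"
  proof -
    assume c: "\<And>u v. u < n \<Longrightarrow> v < n \<Longrightarrow> card {s. (u, s) \<in> I \<and> (v, s) \<in> I} = card (F u \<inter> F v)"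
    show ?thesis
    proof (rule set_eqI, rule iffI)
      fix e assume e: "e \<in> E"
      then have "e \<in> vertex_pairs {..<n}" using E by blast
      then obtain u v where uv: "e = {u, v}" "u < n" "v < n" "u \<noteq> v"
        by (auto elim: vertex_pairsE)
      moreover have "k \<le> card {s. (u, s) \<in> I \<and> (v, s) \<in> I}"
        using c[OF uv(2,3)] FE[OF uv(2-4)] e uv(1) by simp
      ultimately show "e \<in> {e. \<exists>u v. e = {u, v} \<and> u < n \<and> v < n \<and> u \<noteq> v \<and>
          k \<le> card {s. (u, s) \<in> I \<and> (v, s) \<in> I}}" by blast
    next
      fix e assume "e \<in> {e. \<exists>u v. e = {u, v} \<and> u < n \<and> v < n \<and> u \<noteq> v \<and>
          k \<le> card {s. (u, s) \<in> I \<and> (v, s) \<in> I}}"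
      then obtain u v where uv: "e = {u, v}" "u < n" "v < n" "u \<noteq> v"
        and "k \<le> card {s. (u, s) \<in> I \<and> (v, s) \<in> I}" by blast
      then show "e \<in> E" using c[OF uv(2,3)] FE[OF uv(2-4)] by simp
    qed
  qed
  ultimately show ?thesis by blast
qed

text \<open>A set with fewer than 40 ln n vertices is charged to the first term. For a larger one,
  |A|^2 is at most 4 times its number of pairs, hence at most 20 times its number of non-edges; a
  non-edge lies in at most k - 1 sets, which gives the second term.\<close>

lemma sum_square_set_sizes_le:
  fixes n k :: nat and S :: "nat set"
  assumes rep: "k_representation k {..<n} E S F" and "2 \<le> k" "\<not> few_nonedges n E" "1 \<le> ln (real n)"
  shows "(\<Sum>s\<in>S. (real (card {u\<in>{..<n}. s \<in> F u}))\<^sup>2)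
       \<le> 1600 * (ln (real n))\<^sup>2 * card S + 10 * k * (real n)\<^sup>2"
proof -
  let ?P = "vertex_pairs {..<n}"
  define A where "A = (\<lambda>s. {u\<in>{..<n}. s \<in> F u})"
  have fS: "finite S" and FS: "\<And>v. v < n \<Longrightarrow> F v \<subseteq> S"
    and FE: "\<And>u v. u < n \<Longrightarrow> v < n \<Longrightarrow> u \<noteq> v \<Longrightarrow> k \<le> card (F u \<inter> F v) \<longleftrightarrow> {u, v} \<in> E"
    using rep by (auto simp: k_representation_def)
  have A: "A s \<subseteq> {..<n}" "finite (A s)" for s by (auto simp: A_def)
  have one: "(real (card (A s)))\<^sup>2 \<le> 1600 * (ln (real n))\<^sup>2 + 20 * card (vertex_pairs (A s) - E)" for s
  proof (cases "40 * ln (real n) \<le> real (card (A s))")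
    case False
    then have "(real (card (A s)))\<^sup>2 \<le> (40 * ln (real n))\<^sup>2" by (intro power_mono) auto
    then show ?thesis by (simp add: power_mult_distrib)
  next
    case True
    then have "real (card (vertex_pairs (A s))) \<le> 5 * real (card (vertex_pairs (A s) - E))"
      using assms(3) A by (fastforce simp: few_nonedges_def)
    moreover have "2 * real (card (A s)) \<le> real (card (A s)) * real (card (A s))"
      using True assms(4) by (intro mult_right_mono) auto
    ultimately show ?thesis
      using real_choose_two[of "card (A s)"] A[of s]
      by (simp add: card_vertex_pairs power2_eq_square algebra_simps)
         (smt (verit) mult_nonneg_nonneg assms(4))
  qed
  have le: "card {s\<in>S. e \<subseteq> A s} \<le> k - 1" if e: "e \<in> ?P - E" for e
  proof -
    obtain u v where uv: "e = {u, v}" "u < n" "v < n" "u \<noteq> v"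
      using e by (auto elim!: vertex_pairsE)
    have "{s\<in>S. e \<subseteq> A s} = F u \<inter> F v" using uv FS by (auto simp: A_def)
    moreover have "\<not> k \<le> card (F u \<inter> F v)" using FE[of u v] uv e by auto
    ultimately show ?thesis by simp
  qed
  have "(\<Sum>s\<in>S. card (vertex_pairs (A s) - E)) = (\<Sum>s\<in>S. \<Sum>e\<in>?P - E. if e \<subseteq> A s then 1 else 0)"
  proof (rule sum.cong)
    fix s
    have "vertex_pairs (A s) - E = {e \<in> ?P - E. e \<subseteq> A s}"
      using A[of s] by (auto simp: vertex_pairs_def)
    then show "card (vertex_pairs (A s) - E) = (\<Sum>e\<in>?P - E. if e \<subseteq> A s then 1 else 0)"
      by (simp add: sum.If_cases Int_def)
  qed simp
  also have "\<dots> = (\<Sum>e\<in>?P - E. \<Sum>s\<in>S. if e \<subseteq> A s then 1 else 0)"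
    by (rule sum.swap)
  also have "\<dots> = (\<Sum>e\<in>?P - E. card {s\<in>S. e \<subseteq> A s})"
    using fS by (simp add: sum.If_cases Int_def)
  also have "\<dots> \<le> (\<Sum>e\<in>?P - E. k - 1)" by (intro sum_mono le)
  also have "\<dots> \<le> card ?P * k" 
    by (auto intro!: mult_mono card_mono)
  finally have "real (\<Sum>s\<in>S. card (vertex_pairs (A s) - E)) \<le> real (card ?P) * k"
    by (metis of_nat_le_iff of_nat_mult)
  also have "\<dots> \<le> (real n)\<^sup>2 / 2 * k"
    using real_choose_two[of n] by (intro mult_right_mono) (auto simp: card_vertex_pairs power2_eq_square algebra_simps)
  finally have nonedges: "(\<Sum>s\<in>S. real (card (vertex_pairs (A s) - E))) \<le> (real n)\<^sup>2 / 2 * k"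
    by simp
  have "(\<Sum>s\<in>S. (real (card (A s)))\<^sup>2) \<le> (\<Sum>s\<in>S. 1600 * (ln (real n))\<^sup>2 + 20 * card (vertex_pairs (A s) - E))"
    by (intro sum_mono one)
  also have "\<dots> = 1600 * (ln (real n))\<^sup>2 * card S + 20 * (\<Sum>s\<in>S. real (card (vertex_pairs (A s) - E)))"
    by (simp add: sum.distrib sum_distrib_left)
  finally show ?thesis using nonedges by (simp add: A_def algebra_simps)
qed

text \<open>The grid has to be fixed before the graph is known if the possible \<open>I\<close> are
  to be counted; this is why the ground set is placed inside \<open>{..<n\<^sup>2}\<close>.\<close>

lemma small_theta_small_incidences:
  fixes n k :: nat
  assumes small: "real (theta k {..<n} E) < (real n)\<^sup>2 / (1000000 * (real k ^ 3 * (ln (real n))\<^sup>2))"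
    and "2 \<le> k" "\<not> few_nonedges n E" "1 \<le> ln (real n)" and E: "E \<subseteq> vertex_pairs {..<n}"
  shows "\<exists>I \<subseteq> {..<n} \<times> {..<n\<^sup>2}. real (card I) \<le> (real n)\<^sup>2 / (500 * ln (real n)) \<and>
     E = {e. \<exists>u v. e = {u, v} \<and> u < n \<and> v < n \<and> u \<noteq> v \<and> k \<le> card {s. (u, s) \<in> I \<and> (v, s) \<in> I}}"
proof -
  define l where "l = ln (real n)"
  have l: "1 \<le> l" using assms(4) by (simp add: l_def)
  obtain S :: "nat set" and F where rep: "k_representation k {..<n} E S F" and cS: "card S = theta k {..<n} E"
    using theta_attained[of "{..<n}" k E] assms(2) by auto
  have fS: "finite S" and FS: "\<And>v. v < n \<Longrightarrow> F v \<subseteq> S"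
    using rep by (auto simp: k_representation_def)
  define a where "a = (\<lambda>s. real (card {u\<in>{..<n}. s \<in> F u}))"
  have m: "real (card S) < (real n)\<^sup>2 / (1000000 * (real k ^ 3 * l\<^sup>2))"
    using small by (simp add: cS l_def)
  have k1: "1 \<le> real k" "1 \<le> l ^ 2" using assms(2) l by auto
  have "(real n)\<^sup>2 / (1000000 * (real k ^ 3 * l\<^sup>2)) \<le> (real n)\<^sup>2 / 1"
  proof (intro divide_left_mono)
    have "1 * 1 \<le> real k ^ 3 * l\<^sup>2" using k1 by (intro mult_mono) auto
    then show "1 \<le> 1000000 * (real k ^ 3 * l\<^sup>2)" by simp
  qed (use k1 l in auto)
  with m have "real (card S) \<le> (real n)\<^sup>2" by linarith
  then have "real (card S) \<le> real (n\<^sup>2)" by (simp only: of_nat_power)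
  then have Sn: "card S \<le> n\<^sup>2" unfolding of_nat_le_iff .
  have "(\<Sum>u<n. card (F u)) = (\<Sum>u<n. \<Sum>s\<in>S. if s \<in> F u then 1 else 0)"
    using FS fS by (intro sum.cong) (auto simp: sum.If_cases Int_absorb1)
  also have "\<dots> = (\<Sum>s\<in>S. \<Sum>u<n. if s \<in> F u then 1 else 0)" by (rule sum.swap)
  also have "\<dots> = (\<Sum>s\<in>S. card {u\<in>{..<n}. s \<in> F u})"
    by (simp add: sum.If_cases Int_def)
  finally have T: "real (\<Sum>u<n. card (F u)) = (\<Sum>s\<in>S. a s)" by (simp add: a_def)
  have "(\<Sum>s\<in>S. a s)\<^sup>2 \<le> real (card S) * (\<Sum>s\<in>S. (a s)\<^sup>2)"
    using sum_squared_le_sum_of_squares[of a S] fS by (simp add: mult.commute)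
  also have "\<dots> \<le> real (card S) * (1600 * l\<^sup>2 * card S + 10 * k * (real n)\<^sup>2)"
    using sum_square_set_sizes_le[OF rep assms(2-4)] by (intro mult_left_mono) (auto simp: a_def l_def)
  also have "\<dots> \<le> real (card S) * (11 * k * (real n)\<^sup>2)"
  proof -
    have "l\<^sup>2 * card S \<le> l\<^sup>2 * ((real n)\<^sup>2 / (1000000 * (real k ^ 3 * l\<^sup>2)))"
      using m by (intro mult_left_mono) auto
    also have "\<dots> = (real n)\<^sup>2 / 1000000 / real k ^ 3" using l by (simp add: field_simps)
    also have "\<dots> \<le> (real n)\<^sup>2 / 1000000 / 1" using k1 by (intro divide_left_mono) auto
    also have "\<dots> \<le> (real k * (real n)\<^sup>2) / 1000000" using mult_right_mono[OF k1(1), of "(real n)\<^sup>2"] by simp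
    finally have "l\<^sup>2 * card S \<le> (real k * (real n)\<^sup>2) / 1000000" .
    moreover have "0 \<le> real k * (real n)\<^sup>2" by simp
    ultimately have "1600 * (l\<^sup>2 * card S) \<le> real k * (real n)\<^sup>2" by linarith
    then show ?thesis by (intro mult_left_mono) (auto simp: mult.assoc)
  qed
  also have "\<dots> \<le> (real n)\<^sup>2 / (1000000 * (real k ^ 3 * l\<^sup>2)) * (11 * k * (real n)\<^sup>2)"
    using m by (intro mult_right_mono) auto
  also have "\<dots> = 11 / 1000000 * ((real n)\<^sup>2 / l)\<^sup>2 / (real k)\<^sup>2"
    using k1 l by (simp add: field_simps power2_eq_square power3_eq_cube)
  \<comment> \<open>\<open>k\<close> is at least 2, and 11/4000000 is below 1/500^2. The constant
    1000000 of the lower bound is chosen for this.\<close>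
  also have "\<dots> \<le> 11 / 1000000 * ((real n)\<^sup>2 / l)\<^sup>2 / 2\<^sup>2"
    using assms(2) by (intro divide_left_mono power_mono) auto
  also have "\<dots> \<le> ((real n)\<^sup>2 / (500 * l))\<^sup>2"
    using l by (simp add: power_divide power_mult_distrib field_simps)
  finally have "(\<Sum>s\<in>S. a s) \<le> (real n)\<^sup>2 / (500 * l)"
    by (rule power2_le_imp_le) (use l in auto)
  moreover obtain I where "I \<subseteq> {..<n} \<times> {..<card S}" "card I = (\<Sum>u<n. card (F u))"
     "E = {e. \<exists>u v. e = {u, v} \<and> u < n \<and> v < n \<and> u \<noteq> v \<and> k \<le> card {s. (u, s) \<in> I \<and> (v, s) \<in> I}}"
    using representation_incidences[OF rep E] by blast
  moreover have "{..<n} \<times> {..<card S} \<subseteq> {..<n} \<times> {..<n\<^sup>2}" using Sn by auto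
  ultimately show ?thesis using T by (intro exI[of _ I]) (auto simp: l_def)
qed

text \<open>At most n^2/(500 ln n) cells of the grid can be chosen in at most exp (4 ln n * n^2/(500
  ln n)) = exp (n^2/125) ways, negligible against the 2^(n choose 2) graphs.\<close>

lemma theta_lower_bound:
  fixes n k :: nat
  assumes n6: "6 \<le> n" and k: "2 \<le> k"
  shows "1 - (2 / real n + exp (- real n)) \<le> measure_pmf.prob (random_graph n (1 / 2))
            {E. 1/1000000 * (real n)\<^sup>2 / (real k ^ 3 * (ln (real n))\<^sup>2) \<le> real (theta k {..<n} E)}"
proof (rule prob_random_graph_ge)
  let ?P = "vertex_pairs {..<n}"
  have n: "3 \<le> n" using n6 by simp
  define l where "l = ln (real n)"
  have l1: "1 \<le> l"
    using n e_less_272 ln_mono[of "exp 1" "real n"] by (simp add: l_def)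
  define t where "t = nat \<lfloor>(real n)\<^sup>2 / (500 * l)\<rfloor>"
  define dec where "dec = (\<lambda>I. {e. \<exists>u v. e = {u, v} \<and> u < n \<and> v < n \<and> u \<noteq> v \<and>
      k \<le> card {s :: nat. (u :: nat, s) \<in> I \<and> (v, s) \<in> I}})"
  define X where "X = {I. I \<subseteq> {..<n} \<times> {..<n\<^sup>2} \<and> card I \<le> t}"
  show "E \<in> {E. few_nonedges n E} \<union> dec ` X" if "E \<subseteq> ?P"
    "E \<notin> {E. 1/1000000 * (real n)\<^sup>2 / (real k ^ 3 * (ln (real n))\<^sup>2) \<le> real (theta k {..<n} E)}" for E
  proof (cases "few_nonedges n E")
    case False
    have "real (theta k {..<n} E) < (real n)\<^sup>2 / (1000000 * (real k ^ 3 * (ln (real n))\<^sup>2))"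
      using that(2) by simp
    from small_theta_small_incidences[OF this k False _ that(1)] l1
    obtain I where "I \<subseteq> {..<n} \<times> {..<n\<^sup>2}" "real (card I) \<le> (real n)\<^sup>2 / (500 * l)" "E = dec I"
      by (auto simp: l_def dec_def)
    then show ?thesis unfolding X_def t_def by (auto simp: le_nat_floor)
  qed auto
  have finX: "finite X" unfolding X_def by (rule finite_subset[of _ "Pow ({..<n} \<times> {..<n\<^sup>2})"]) auto
  have "card {E. E \<subseteq> ?P \<and> E \<in> {E. few_nonedges n E} \<union> dec ` X}
      \<le> card ({E. E \<subseteq> ?P \<and> few_nonedges n E} \<union> dec ` X)"
    using finX by (intro card_mono finite_UnI) (auto intro: finite_subset[of _ "Pow ?P"])
  also have "\<dots> \<le> card {E. E \<subseteq> ?P \<and> few_nonedges n E} + card X"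
    using card_Un_le card_image_le[OF finX] by (meson add_left_mono order_trans)
  finally have "real (card {E. E \<subseteq> ?P \<and> E \<in> {E. few_nonedges n E} \<union> dec ` X})
      \<le> (2 / real n) * 2 ^ card ?P + real (card X)"
    using few_nonedges_unlikely[OF n] by linarith
  moreover have "real (card X) \<le> exp (- real n) * 2 ^ card ?P"
  proof -
    have "card X \<le> (card ({..<n} \<times> {..<n\<^sup>2}) + 1) ^ t"
      unfolding X_def by (rule card_bounded_subsets_le) auto
    also have "\<dots> = (n * n\<^sup>2 + 1) ^ t" by (simp add: card_cartesian_product)
    also have "\<dots> \<le> (n ^ 4) ^ t"
    proof (rule power_mono)
      have "n * n\<^sup>2 + 1 \<le> n ^ 3 * 3" using n by (simp add: power3_eq_cube power2_eq_square)
      also have "\<dots> \<le> n ^ 3 * n" using n by simp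
      finally show "n * n\<^sup>2 + 1 \<le> n ^ 4" by (simp add: power3_eq_cube numeral_eq_Suc)
    qed auto
    finally have "real (card X) \<le> real ((n ^ 4) ^ t)" by (rule of_nat_mono)
    also have "\<dots> = exp (4 * l * t)"
      using n by (simp add: l_def exp_of_nat_mult[symmetric] power_mult[symmetric] powr_realpow[symmetric] powr_def algebra_simps)
    also have "\<dots> \<le> exp (4 * l * ((real n)\<^sup>2 / (500 * l)))"
      using l1 by (intro iffD2[OF exp_le_cancel_iff] mult_left_mono) (auto simp: t_def)
    also have "4 * l * ((real n)\<^sup>2 / (500 * l)) = (real n)\<^sup>2 / 125" using l1 by simp
    also have "(real n)\<^sup>2 / 125 \<le> - real n + 1/2 * real (card ?P)"
    proof -
      have "6 * real n \<le> real n * real n" using n6 by (intro mult_right_mono) auto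
      then show ?thesis
        using real_choose_two[of n] by (simp add: card_vertex_pairs power2_eq_square algebra_simps)
    qed
    also have "exp (- real n + 1/2 * real (card ?P)) = exp (- real n) * exp (1/2) ^ card ?P"
      by (simp add: exp_add[symmetric] exp_of_nat_mult[symmetric] mult.commute)
    also have "\<dots> \<le> exp (- real n) * 2 ^ card ?P"
      using exp_bound_half[of "1/2::real"] by (intro mult_left_mono power_mono) auto
    finally show ?thesis by simp
  qed
  ultimately show "real (card {E. E \<subseteq> ?P \<and> E \<in> {E. few_nonedges n E} \<union> dec ` X})
      \<le> (2 / real n + exp (- real n)) * 2 ^ card ?P"
    by (simp add: algebra_simps)
qed

section \<open>Representations given by lists of vertex sets\<close>

text \<open>Lists rather than sets, because the same vertex set may serve several elements of the
  ground set; an entry of the list stands for one element.\<close>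

definition coverage :: "'a set list \<Rightarrow> 'a set \<Rightarrow> nat" where
  "coverage Ws e = length (filter (\<lambda>A. e \<subseteq> A) Ws)"

lemma coverage_simps [simp]:
  "coverage [] e = 0"
  "coverage (A # Ws) e = (if e \<subseteq> A then 1 else 0) + coverage Ws e"
  "coverage (Ws @ Ws') e = coverage Ws e + coverage Ws' e"
  by (auto simp: coverage_def)

lemma coverage_replicate [simp]: "coverage (replicate m A) e = (if e \<subseteq> A then m else 0)"
  by (induction m) auto

lemma theta_le_length:
  assumes "\<And>e. e \<in> vertex_pairs V \<Longrightarrow> k \<le> coverage Ws e \<longleftrightarrow> e \<in> E"
  shows "theta k V E \<le> length Ws"
proof -
  define F where "F = (\<lambda>v. {i. i < length Ws \<and> v \<in> Ws ! i})"
  have "card (F u \<inter> F v) = coverage Ws {u, v}" for u v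
    unfolding coverage_def length_filter_conv_card F_def by (rule arg_cong[of _ _ card]) auto
  then have "k_representation k V E {..<length Ws} F"
    using assms by (auto simp: k_representation_def F_def)
  from theta_le[OF this] show ?thesis by simp
qed

section \<open>Clique covers\<close>

definition common_nbrs :: "nat \<Rightarrow> nat set set \<Rightarrow> nat set \<Rightarrow> nat set" where
  "common_nbrs n E S = {v. v < n \<and> (\<forall>x\<in>S. {x, v} \<in> E)}"

lemma finite_common_nbrs [simp]: "finite (common_nbrs n E S)"
  by (simp add: common_nbrs_def)

lemma common_nbrs_disjoint: "E \<subseteq> vertex_pairs V \<Longrightarrow> v \<in> common_nbrs n E S \<Longrightarrow> v \<notin> S"
  by (auto simp: common_nbrs_def vertex_pairs_def)

lemma card_supersets:
  assumes "finite P" "U \<subseteq> P"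
  shows "card {E \<in> Pow P. U \<subseteq> E} = 2 ^ (card P - card U)"
proof -
  have "bij_betw (\<lambda>E. E - U) {E \<in> Pow P. U \<subseteq> E} (Pow (P - U))"
    by (rule bij_betw_byWitness[where f' = "\<lambda>E. E \<union> U"]) (use assms(2) in auto)
  then have "card {E \<in> Pow P. U \<subseteq> E} = card (Pow (P - U))" by (rule bij_betw_same_card)
  also have "\<dots> = 2 ^ (card P - card U)"
    using assms by (simp add: card_Pow card_Diff_subset finite_subset)
  finally show ?thesis .
qed

text \<open>The generating function of a binomial variable: the blocks are disjoint, so the events
  \<open>B i \<subseteq> E\<close> are independent of probability 2^(-s). The power of
  \<open>z\<close> is expanded as a product of factors 1 + (z - 1)
  [\<open>B i \<subseteq> E\<close>] over the sets \<open>J\<close> of blocks required to be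
  present.\<close>

lemma sum_Pow_blocks:
  fixes z :: real
  assumes "finite P" "finite I" "\<And>i. i \<in> I \<Longrightarrow> B i \<subseteq> P" "\<And>i. i \<in> I \<Longrightarrow> card (B i) = s"
    and disj: "\<And>i j. i \<in> I \<Longrightarrow> j \<in> I \<Longrightarrow> i \<noteq> j \<Longrightarrow> B i \<inter> B j = {}"
  shows "(\<Sum>E\<in>Pow P. z ^ card {i\<in>I. B i \<subseteq> E}) = 2 ^ card P * (1 + (z - 1) / 2 ^ s) ^ card I"
proof -
  define c where "c = (\<lambda>E i b. if b then (if B i \<subseteq> E then z - 1 else 0) else (1::real))"
  have "z ^ card {i\<in>I. B i \<subseteq> E} = (\<Sum>J\<in>Pow I. \<Prod>i\<in>I. c E i (i \<in> J))" for E
  proof -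
    have "z ^ card {i\<in>I. B i \<subseteq> E} = (\<Prod>i\<in>I. if B i \<subseteq> E then z else 1)"
      using assms(2) by (simp add: prod.If_cases Int_def)
    also have "\<dots> = (\<Prod>i\<in>I. c E i True + c E i False)" by (intro prod.cong) (auto simp: c_def)
    finally show ?thesis using sum_Pow_prod[OF assms(2), of "c E"] by simp
  qed
  then have "(\<Sum>E\<in>Pow P. z ^ card {i\<in>I. B i \<subseteq> E}) = (\<Sum>J\<in>Pow I. \<Sum>E\<in>Pow P. \<Prod>i\<in>I. c E i (i \<in> J))"
    by (simp add: sum.swap[of _ "Pow P"])
  also have "\<dots> = (\<Sum>J\<in>Pow I. \<Prod>i\<in>I. if i \<in> J then (z - 1) / 2 ^ s else 1) * 2 ^ card P"
    unfolding sum_distrib_right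
  proof (rule sum.cong)
    fix J assume J: "J \<in> Pow I"
    then have fJ: "finite J" using assms(2) finite_subset by auto
    have UP: "(\<Union>i\<in>J. B i) \<subseteq> P" using J assms(3) by auto
    have cU: "card (\<Union>i\<in>J. B i) = s * card J"
    proof -
      have J': "i \<in> I" if "i \<in> J" for i using that J by auto
      have "card (\<Union>i\<in>J. B i) = (\<Sum>i\<in>J. card (B i))"
        using fJ J' assms(1,3) disj by (intro card_UN_disjoint) (blast intro: finite_subset)+
      also have "\<dots> = (\<Sum>i\<in>J. s)" using J' assms(4) by (intro sum.cong) auto
      finally show ?thesis by simp
    qed
    have eq: "(\<Prod>i\<in>I. c E i (i \<in> J)) = (if (\<Union>i\<in>J. B i) \<subseteq> E then (z - 1) ^ card J else 0)" for E
    proof -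
      have "(\<Prod>i\<in>I. c E i (i \<in> J)) = (\<Prod>i\<in>J. c E i True)"
        using J assms(2) by (intro prod.mono_neutral_cong_right) (auto simp: c_def)
      also have "\<dots> = (if (\<Union>i\<in>J. B i) \<subseteq> E then (z - 1) ^ card J else 0)"
      proof (cases "(\<Union>i\<in>J. B i) \<subseteq> E")
        case True
        then have "(\<Prod>i\<in>J. c E i True) = (\<Prod>i\<in>J. z - 1)" by (intro prod.cong) (auto simp: c_def)
        with True show ?thesis by simp
      next
        case False
        then show ?thesis using fJ by (auto simp: c_def intro!: prod_zero)
      qed
      finally show ?thesis .
    qed
    have "(\<Sum>E\<in>Pow P. \<Prod>i\<in>I. c E i (i \<in> J)) = (z - 1) ^ card J * card {E \<in> Pow P. (\<Union>i\<in>J. B i) \<subseteq> E}"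
      unfolding eq using assms(1) by (simp add: sum.If_cases Int_def)
    also have "\<dots> = (z - 1) ^ card J * 2 ^ (card P - s * card J)"
      by (subst card_supersets[OF assms(1) UP]) (simp add: cU)
    also have "\<dots> = ((z - 1) / 2 ^ s) ^ card J * 2 ^ card P"
      using card_mono[OF assms(1) UP] by (simp add: cU power_diff power_divide power_mult)
    also have "((z - 1) / 2 ^ s) ^ card J = (\<Prod>i\<in>I. if i \<in> J then (z - 1) / 2 ^ s else 1)"
      using J assms(2) by (simp add: prod.If_cases Int_absorb1)
    finally show "(\<Sum>E\<in>Pow P. \<Prod>i\<in>I. c E i (i \<in> J))
        = (\<Prod>i\<in>I. if i \<in> J then (z - 1) / 2 ^ s else 1) * 2 ^ card P" .
  qed simp
  also have "(\<Sum>J\<in>Pow I. \<Prod>i\<in>I. if i \<in> J then (z - 1) / 2 ^ s else 1) = (1 + (z - 1) / 2 ^ s) ^ card I"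
    by (subst sum_Pow_prod[OF assms(2), of "\<lambda>i b. if b then (z - 1) / 2 ^ s else 1"]) (simp add: add.commute)
  finally show ?thesis by simp
qed

text \<open>The stars joining a vertex outside \<open>S\<close> to \<open>S\<close> are disjoint
  blocks, and no vertex of \<open>S\<close> is a common neighbour, as there are no loops.\<close>

lemma sum_power_common_nbrs:
  fixes z :: real
  assumes "S \<subseteq> {..<n}"
  shows "(\<Sum>E\<in>Pow (vertex_pairs {..<n}). z ^ card (common_nbrs n E S))
     = 2 ^ card (vertex_pairs {..<n}) * (1 + (z - 1) / 2 ^ card S) ^ (n - card S)"
proof -
  let ?P = "vertex_pairs {..<n}" and ?I = "{..<n} - S"
  define B where "B = (\<lambda>v. (\<lambda>x. {x, v}) ` S)"
  have fS: "finite S" using assms finite_subset by auto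
  have "common_nbrs n E S = {v \<in> ?I. B v \<subseteq> E}" if "E \<in> Pow ?P" for E
    using common_nbrs_disjoint[of E "{..<n}" _ n S] that by (auto simp: common_nbrs_def B_def)
  then have "(\<Sum>E\<in>Pow ?P. z ^ card (common_nbrs n E S)) = (\<Sum>E\<in>Pow ?P. z ^ card {v\<in>?I. B v \<subseteq> E})"
    by simp
  also have "\<dots> = 2 ^ card ?P * (1 + (z - 1) / 2 ^ card S) ^ card ?I"
  proof (rule sum_Pow_blocks)
    show "B v \<subseteq> ?P" if "v \<in> ?I" for v using that assms by (auto simp: B_def)
    show "card (B v) = card S" if "v \<in> ?I" for v
      unfolding B_def using that by (intro card_image) (auto intro!: inj_onI simp: doubleton_eq_iff)
    show "B v \<inter> B w = {}" if "v \<in> ?I" "w \<in> ?I" "v \<noteq> w" for v w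
      using that by (auto simp: B_def doubleton_eq_iff)
  qed auto
  also have "card ?I = n - card S" using assms fS by (simp add: card_Diff_subset)
  finally show ?thesis .
qed

text \<open>Chernoff bounds with the bases 1 + \<eta> and 1 - \<eta>. In the lower tail the term
  \<open>card S\<close> pays for having only n - |S| trials instead of n.\<close>

lemma common_nbrs_tail:
  fixes \<eta> :: real
  assumes S: "S \<subseteq> {..<n}" and \<eta>: "0 < \<eta>" "\<eta> \<le> 1 / 8"
  defines "\<mu> \<equiv> real n / 2 ^ card S"
  shows "real (card {E \<in> Pow (vertex_pairs {..<n}).
       \<not> (real (card (common_nbrs n E S)) \<in> {(1 - 2 * \<eta>) * \<mu> <..< (1 + 2 * \<eta>) * \<mu>})})
    \<le> 2 * exp (card S - 4 * \<eta> ^ 3 * \<mu>) * 2 ^ card (vertex_pairs {..<n})"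
proof -
  let ?P = "vertex_pairs {..<n}" and ?N = "\<lambda>E. card (common_nbrs n E S)" and ?s = "card S"
  have sn: "?s \<le> n" using card_mono[OF _ S] by simp
  have \<mu>0: "0 \<le> \<mu>" by (simp add: \<mu>_def)
  have e3: "4 * \<eta> ^ 3 \<le> \<eta>\<^sup>2 / 2"
    using \<eta> mult_left_mono[of \<eta> "1/8" "\<eta>\<^sup>2"] by (simp add: power2_eq_square power3_eq_cube)
  have exponential_markov: "real (card {E \<in> Pow ?P. z powr x \<le> z ^ ?N E}) \<le> exp y * 2 ^ card ?P"
    if z: "0 < z" and y: "(1 + (z - 1) / 2 ^ ?s) ^ (n - ?s) \<le> exp (y + c)" and c: "c \<le> ln z * x" for z x y c :: real
  proof -
    have "real (card {E \<in> Pow ?P. z powr x \<le> z ^ ?N E}) \<le> 2 ^ card ?P * (1 + (z - 1) / 2 ^ ?s) ^ (n - ?s) / z powr x"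
      using card_markov[of "Pow ?P" "\<lambda>E. z ^ ?N E" "z powr x"] z by (simp add: sum_power_common_nbrs[OF S])
    also have "\<dots> \<le> 2 ^ card ?P * exp (y + c) / exp c"
      using y c z by (intro frac_le mult_left_mono) (auto simp: powr_def mult.commute)
    also have "\<dots> = exp y * 2 ^ card ?P" by (simp add: exp_add)
    finally show ?thesis .
  qed
  have up: "real (card {E \<in> Pow ?P. (1 + 2 * \<eta>) * \<mu> \<le> ?N E}) \<le> exp (?s - 4 * \<eta> ^ 3 * \<mu>) * 2 ^ card ?P"
  proof -
    let ?T = "(1 + 2 * \<eta>) * \<mu>"
    have "(1 + ((1 + \<eta>) - 1) / 2 ^ ?s) ^ (n - ?s) \<le> exp (\<eta> / 2 ^ ?s) ^ (n - ?s)"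
      using \<eta> by (intro power_mono) auto
    also have "\<dots> \<le> exp (\<eta> / 2 ^ ?s) ^ n" using \<eta> by (intro power_increasing) auto
    also have "\<dots> = exp (\<eta> * \<mu>)" by (simp add: \<mu>_def flip: exp_of_nat_mult)
    also have "\<dots> \<le> exp ((?s - 4 * \<eta> ^ 3 * \<mu>) + (\<eta> - \<eta>\<^sup>2) * ?T)"
    proof -
      have "4 * \<eta> ^ 3 * \<mu> \<le> (\<eta>\<^sup>2 - 2 * \<eta> ^ 3) * \<mu>"
      proof (intro mult_right_mono)
        have "8 * \<eta> ^ 3 \<le> \<eta>\<^sup>2" "0 \<le> \<eta> ^ 3" using e3 \<eta> by auto
        then show "4 * \<eta> ^ 3 \<le> \<eta>\<^sup>2 - 2 * \<eta> ^ 3" by linarith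
      qed (rule \<mu>0)
      then show ?thesis by (simp add: algebra_simps power2_eq_square power3_eq_cube)
    qed
    finally have "real (card {E \<in> Pow ?P. (1 + \<eta>) powr ?T \<le> (1 + \<eta>) ^ ?N E}) \<le> exp (?s - 4 * \<eta> ^ 3 * \<mu>) * 2 ^ card ?P"
      by (rule exponential_markov[rotated])
         (use \<eta> \<mu>0 ln_one_plus_pos_lower_bound[of \<eta>] in \<open>auto intro!: mult_right_mono\<close>)
    moreover have "card {E \<in> Pow ?P. ?T \<le> ?N E} \<le> card {E \<in> Pow ?P. (1 + \<eta>) powr ?T \<le> (1 + \<eta>) ^ ?N E}"
      using \<eta> by (intro card_mono) (auto simp: powr_mono simp flip: powr_realpow)
    ultimately show ?thesis by linarith
  qed
  have lo: "real (card {E \<in> Pow ?P. ?N E \<le> (1 - 2 * \<eta>) * \<mu>}) \<le> exp (?s - 4 * \<eta> ^ 3 * \<mu>) * 2 ^ card ?P"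
  proof -
    let ?T = "(1 - 2 * \<eta>) * \<mu>"
    have \<eta>s: "\<eta> / 2 ^ ?s \<le> 1 / 1" using \<eta> by (intro frac_le) auto
    then have "(1 + ((1 - \<eta>) - 1) / 2 ^ ?s) ^ (n - ?s) \<le> exp (- (\<eta> / 2 ^ ?s)) ^ (n - ?s)"
      using exp_ge_add_one_self[of "- (\<eta> / 2 ^ ?s)"] by (intro power_mono) auto
    also have "\<dots> = exp (- (\<eta> / 2 ^ ?s) * (real n - ?s))"
      using sn by (simp add: exp_of_nat_mult[symmetric] of_nat_diff algebra_simps)
    also have "\<dots> \<le> exp (- (\<eta> * \<mu>) + ?s)"
    proof -
      have "\<eta> / 2 ^ ?s * real ?s \<le> 1 * real ?s" using \<eta>s by (intro mult_right_mono) auto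
      then show ?thesis by (simp add: \<mu>_def algebra_simps diff_divide_distrib)
    qed
    \<comment> \<open>The quadratic terms cancel, (- \<eta> - 2 \<eta>^2) (1 - 2 \<eta>) = - \<eta>
      + 4 \<eta>^3, which is why the rate is cubic in \<eta>.\<close>
    also have "\<dots> = exp ((?s - 4 * \<eta> ^ 3 * \<mu>) + (- \<eta> - 2 * \<eta>\<^sup>2) * ?T)"
      by (simp add: algebra_simps power2_eq_square power3_eq_cube)
    finally have "real (card {E \<in> Pow ?P. (1 - \<eta>) powr ?T \<le> (1 - \<eta>) ^ ?N E}) \<le> exp (?s - 4 * \<eta> ^ 3 * \<mu>) * 2 ^ card ?P"
      by (rule exponential_markov[rotated])
         (use \<eta> \<mu>0 ln_one_minus_pos_lower_bound[of \<eta>] in \<open>auto intro!: mult_right_mono\<close>)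
    moreover have "card {E \<in> Pow ?P. ?N E \<le> ?T} \<le> card {E \<in> Pow ?P. (1 - \<eta>) powr ?T \<le> (1 - \<eta>) ^ ?N E}"
      using \<eta> by (intro card_mono) (auto simp: powr_mono' simp flip: powr_realpow)
    ultimately show ?thesis by linarith
  qed
  have "card {E \<in> Pow ?P. \<not> (real (?N E) \<in> {(1 - 2 * \<eta>) * \<mu> <..< (1 + 2 * \<eta>) * \<mu>})}
      \<le> card ({E \<in> Pow ?P. (1 + 2 * \<eta>) * \<mu> \<le> ?N E} \<union> {E \<in> Pow ?P. ?N E \<le> (1 - 2 * \<eta>) * \<mu>})"
    by (intro card_mono) auto
  also have "\<dots> \<le> card {E \<in> Pow ?P. (1 + 2 * \<eta>) * \<mu> \<le> ?N E} + card {E \<in> Pow ?P. ?N E \<le> (1 - 2 * \<eta>) * \<mu>}"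
    by (rule card_Un_le)
  finally show ?thesis using up lo by linarith
qed

text \<open>A relative error of 1/(4t) per step keeps a product of up to \<open>t\<close> such
  counts within a constant factor of its ideal value.\<close>

definition extensible :: "nat \<Rightarrow> nat \<Rightarrow> nat set set \<Rightarrow> bool" where
  "extensible n t E \<longleftrightarrow> (\<forall>S \<subseteq> {..<n}. card S \<le> t \<longrightarrow>
     real (card (common_nbrs n E S)) \<in>
       {(1 - 1 / (4 * t)) * (real n / 2 ^ card S) <..< (1 + 1 / (4 * t)) * (real n / 2 ^ card S)})"

text \<open>A union bound over at most (n + 1)^t sets. The deviation is 2 \<eta> with \<eta> =
  1/(8t), so 4 \<eta>^3 = 1/(128 t^3), and the largest sets \<open>S\<close> give the weakest
  estimate.\<close>

lemma not_extensible_unlikely: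
  assumes t: "1 \<le> t"
  shows "real (card {E. E \<subseteq> vertex_pairs {..<n} \<and> \<not> extensible n t E})
    \<le> 2 * (real n + 1) ^ t * exp (real t - (real n / 2 ^ t) / (128 * real t ^ 3)) * 2 ^ card (vertex_pairs {..<n})"
proof -
  let ?P = "vertex_pairs {..<n}"
  define \<S> where "\<S> = {S. S \<subseteq> {..<n} \<and> card S \<le> t}"
  define bad where "bad = (\<lambda>S. {E \<in> Pow ?P. \<not> real (card (common_nbrs n E S)) \<in>
       {(1 - 1 / (4 * t)) * (real n / 2 ^ card S) <..< (1 + 1 / (4 * t)) * (real n / 2 ^ card S)}})"
  have fS: "finite \<S>" unfolding \<S>_def by (rule finite_subset[of _ "Pow {..<n}"]) auto
  have cS: "card \<S> \<le> (n + 1) ^ t" using card_bounded_subsets_le[of "{..<n}" t] by (simp add: \<S>_def)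
  have each: "real (card (bad S)) \<le> 2 * exp (real t - (real n / 2 ^ t) / (128 * real t ^ 3)) * 2 ^ card ?P"
    if "S \<in> \<S>" for S
  proof -
    have S: "S \<subseteq> {..<n}" "card S \<le> t" using that by (auto simp: \<S>_def)
    have c: "4 * (1 / (8 * real t)) ^ 3 = 1 / (128 * real t ^ 3)" by (simp add: power_divide power_mult_distrib)
    have "real (card (bad S)) \<le> 2 * exp (card S - 4 * (1 / (8 * real t)) ^ 3 * (real n / 2 ^ card S)) * 2 ^ card ?P"
      using common_nbrs_tail[OF S(1), of "1 / (8 * t)"] t unfolding bad_def by (simp add: field_simps)
    also have "\<dots> = 2 * exp (card S - 1 / (128 * real t ^ 3) * (real n / 2 ^ card S)) * 2 ^ card ?P"
      by (simp only: c)
    also have "2 * exp (card S - 1 / (128 * real t ^ 3) * (real n / 2 ^ card S)) * 2 ^ card ?P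
        \<le> 2 * exp (real t - (real n / 2 ^ t) / (128 * real t ^ 3)) * 2 ^ card ?P"
    proof -
      have "(real n / 2 ^ t) / (128 * real t ^ 3) \<le> (real n / 2 ^ card S) / (128 * real t ^ 3)"
        using S by (intro divide_right_mono divide_left_mono power_increasing) auto
      then have "real (card S) - 1 / (128 * real t ^ 3) * (real n / 2 ^ card S)
          \<le> real t - (real n / 2 ^ t) / (128 * real t ^ 3)"
        using S(2) by (simp add: mult.commute)
      then show ?thesis by (intro mult_right_mono mult_left_mono) auto
    qed
    finally show ?thesis .
  qed
  have "card {E. E \<subseteq> ?P \<and> \<not> extensible n t E} \<le> card (\<Union>S\<in>\<S>. bad S)"
    by (intro card_mono finite_UN_I fS) (auto simp: extensible_def \<S>_def bad_def)
  also have "\<dots> \<le> (\<Sum>S\<in>\<S>. card (bad S))" by (rule card_UN_le[OF fS])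
  finally have "real (card {E. E \<subseteq> ?P \<and> \<not> extensible n t E}) \<le> (\<Sum>S\<in>\<S>. real (card (bad S)))"
    by (simp flip: of_nat_sum)
  also have "\<dots> \<le> real (card \<S>) * (2 * exp (real t - (real n / 2 ^ t) / (128 * real t ^ 3)) * 2 ^ card ?P)"
    using sum_bounded_above[of \<S>, OF each] by simp
  also have "real (card \<S>) \<le> (real n + 1) ^ t"
    using of_nat_mono[OF cS, where 'a = real] by (simp add: add.commute)
  finally show ?thesis by (simp add: mult_right_mono algebra_simps)
qed

section \<open>Counting the cliques that contain a given clique\<close>

definition cliques_over :: "nat \<Rightarrow> nat set set \<Rightarrow> nat \<Rightarrow> nat set \<Rightarrow> nat set set" where
  "cliques_over n E m S = {Q. S \<subseteq> Q \<and> Q \<subseteq> {..<n} \<and> card Q = m \<and> vertex_pairs Q \<subseteq> E}"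

lemma finite_cliques_over [simp]: "finite (cliques_over n E m S)"
  unfolding cliques_over_def by (rule finite_subset[of _ "Pow {..<n}"]) auto

lemma vertex_pairs_insert: "vertex_pairs (insert v S) \<subseteq> E \<longleftrightarrow> vertex_pairs S \<subseteq> E \<and> (\<forall>x\<in>S - {v}. {x, v} \<in> E)"
proof
  assume *: "vertex_pairs S \<subseteq> E \<and> (\<forall>x\<in>S - {v}. {x, v} \<in> E)"
  show "vertex_pairs (insert v S) \<subseteq> E"
  proof
    fix e assume "e \<in> vertex_pairs (insert v S)"
    then obtain x y where "e = {x, y}" "x \<in> insert v S" "y \<in> insert v S" "x \<noteq> y" by (elim vertex_pairsE)
    then show "e \<in> E" using * by (auto simp: insert_commute)
  qed
next
  assume "vertex_pairs (insert v S) \<subseteq> E"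
  moreover have "vertex_pairs S \<subseteq> vertex_pairs (insert v S)" by (rule vertex_pairs_mono) auto
  moreover have "{x, v} \<in> vertex_pairs (insert v S)" if "x \<in> S - {v}" for x using that by simp
  ultimately show "vertex_pairs S \<subseteq> E \<and> (\<forall>x\<in>S - {v}. {x, v} \<in> E)" by blast
qed

text \<open>Both sides count pairs of a clique \<open>Q\<close> and a vertex \<open>v\<close> in
  \<open>Q - S\<close>; such a \<open>v\<close> is a common neighbour of \<open>S\<close> because
  \<open>Q\<close> is a clique.\<close>

lemma cliques_over_double_count:
  assumes "E \<subseteq> vertex_pairs {..<n}" and S: "S \<subseteq> {..<n}"
  shows "(Suc j) * card (cliques_over n E (card S + Suc j) S)
     = (\<Sum>v\<in>common_nbrs n E S. card (cliques_over n E (card S + Suc j) (insert v S)))"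
proof -
  let ?K = "cliques_over n E (card S + Suc j) S"
  have fS: "finite S" using S finite_subset by auto
  have eq: "cliques_over n E (card S + Suc j) (insert v S) = {Q \<in> ?K. v \<in> Q}" for v
    by (auto simp: cliques_over_def)
  have "(\<Sum>v\<in>common_nbrs n E S. card {Q \<in> ?K. v \<in> Q})
      = (\<Sum>v\<in>common_nbrs n E S. \<Sum>Q\<in>?K. if v \<in> Q then 1 else 0)"
    by (simp add: sum.If_cases Int_def)
  also have "\<dots> = (\<Sum>Q\<in>?K. \<Sum>v\<in>common_nbrs n E S. if v \<in> Q then 1 else 0)" by (rule sum.swap)
  also have "\<dots> = (\<Sum>Q\<in>?K. Suc j)"
  proof (rule sum.cong)
    fix Q assume Q: "Q \<in> ?K"
    have "v \<in> common_nbrs n E S" if "v \<in> Q - S" for v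
    proof -
      have "{x, v} \<in> vertex_pairs Q" if "x \<in> S" for x
        using that \<open>v \<in> Q - S\<close> Q by (auto simp: cliques_over_def)
      then show ?thesis using that Q by (auto simp: cliques_over_def common_nbrs_def)
    qed
    then have "{v \<in> common_nbrs n E S. v \<in> Q} = Q - S"
      using common_nbrs_disjoint[OF assms(1), of _ n S] by blast
    then have "card {v \<in> common_nbrs n E S. v \<in> Q} = Suc j"
      using Q fS by (simp add: cliques_over_def card_Diff_subset)
    then show "(\<Sum>v\<in>common_nbrs n E S. if v \<in> Q then 1 else 0) = Suc j"
      by (simp add: sum.If_cases Int_def)
  qed simp
  finally show ?thesis unfolding eq by simp
qed

text \<open>The vertices are added one at a time, with between \<open>lo\<close> and
  \<open>hi\<close> choices at each step, and every clique arises in \<open>fact j\<close>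
  orders.\<close>

lemma card_cliques_over_bounds:
  assumes E: "E \<subseteq> vertex_pairs {..<n}" and ext: "extensible n t E" and t: "1 \<le> t"
  defines "lo \<equiv> \<lambda>i. (1 - 1 / (4 * real t)) * (real n / 2 ^ i)" and "hi \<equiv> \<lambda>i. (1 + 1 / (4 * real t)) * (real n / 2 ^ i)"
  assumes "S \<subseteq> {..<n}" "vertex_pairs S \<subseteq> E" "card S + j \<le> t"
  shows "(\<Prod>i<j. lo (card S + i)) \<le> fact j * real (card (cliques_over n E (card S + j) S)) \<and>
    fact j * real (card (cliques_over n E (card S + j) S)) \<le> (\<Prod>i<j. hi (card S + i))"
  using assms(6-8)
proof (induction j arbitrary: S)
  case 0
  have "Q = S" if "S \<subseteq> Q" "Q \<subseteq> {..<n}" "card Q = card S" for Q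
    using that card_subset_eq[of Q S] finite_subset[of Q "{..<n}"] by auto
  then have "cliques_over n E (card S) S = {S}"
    using 0 by (auto simp: cliques_over_def)
  then show ?case by simp
next
  case (Suc j)
  have fS: "finite S" using Suc.prems(1) by (rule finite_subset) simp
  have t4: "0 \<le> 1 - 1 / (4 * real t)" using t by (simp add: field_simps)
  have lo0: "0 \<le> lo i" and hi0: "0 \<le> hi i" for i using t4 by (auto simp: lo_def hi_def)
  have IH: "(\<Prod>i<j. lo (card S + Suc i)) \<le> fact j * real (card (cliques_over n E (card S + Suc j) (insert v S)))"
    "fact j * real (card (cliques_over n E (card S + Suc j) (insert v S))) \<le> (\<Prod>i<j. hi (card S + Suc i))"
    if "v \<in> common_nbrs n E S" for v
  proof -
    have v: "v \<notin> S" "v < n" using common_nbrs_disjoint[OF E that] that by (auto simp: common_nbrs_def)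
    have "vertex_pairs (insert v S) \<subseteq> E"
      using that Suc.prems(2) by (subst vertex_pairs_insert) (auto simp: common_nbrs_def)
    moreover have "card (insert v S) = Suc (card S)" using v fS by simp
    ultimately show "(\<Prod>i<j. lo (card S + Suc i)) \<le> fact j * real (card (cliques_over n E (card S + Suc j) (insert v S)))"
      "fact j * real (card (cliques_over n E (card S + Suc j) (insert v S))) \<le> (\<Prod>i<j. hi (card S + Suc i))"
      using Suc.IH[of "insert v S"] Suc.prems v by auto
  qed
  let ?N = "common_nbrs n E S"
  have N: "lo (card S) \<le> card ?N" "card ?N \<le> hi (card S)"
    using ext Suc.prems unfolding extensible_def lo_def hi_def
    by (auto dest!: spec[of _ S] simp: less_imp_le)
  have "real (Suc j * card (cliques_over n E (card S + Suc j) S))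
      = real (\<Sum>v\<in>?N. card (cliques_over n E (card S + Suc j) (insert v S)))"
    by (simp only: cliques_over_double_count[OF E Suc.prems(1)])
  then have "fact j * real (Suc j * card (cliques_over n E (card S + Suc j) S))
      = (\<Sum>v\<in>?N. fact j * real (card (cliques_over n E (card S + Suc j) (insert v S))))"
    by (simp add: sum_distrib_left)
  then have "fact (Suc j) * real (card (cliques_over n E (card S + Suc j) S))
      = (\<Sum>v\<in>?N. fact j * real (card (cliques_over n E (card S + Suc j) (insert v S))))"
    by (simp only: fact_Suc of_nat_mult of_nat_id mult_ac)
  moreover have "lo (card S) * (\<Prod>i<j. lo (card S + Suc i)) \<le> real (card ?N) * (\<Prod>i<j. lo (card S + Suc i))"
    using N lo0 by (intro mult_right_mono prod_nonneg) auto
  moreover have "\<dots> \<le> (\<Sum>v\<in>?N. fact j * real (card (cliques_over n E (card S + Suc j) (insert v S))))"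
    using sum_bounded_below[of ?N, OF IH(1)] by simp
  moreover have "(\<Sum>v\<in>?N. fact j * real (card (cliques_over n E (card S + Suc j) (insert v S)))) \<le> real (card ?N) * (\<Prod>i<j. hi (card S + Suc i))"
    using sum_bounded_above[of ?N, OF IH(2)] by simp
  moreover have "\<dots> \<le> hi (card S) * (\<Prod>i<j. hi (card S + Suc i))"
    using N hi0 by (intro mult_right_mono prod_nonneg) auto
  ultimately show ?case unfolding prod.lessThan_Suc_shift by simp
qed

text \<open>Fixing an edge skips the first two extension steps, whose ideal product is n^2/2, so
  without errors the proportion would be 2 t (t - 1)/n^2. Bernoulli's inequality with \<eta> =
  1/(4t) shows that the accumulated errors cost at most a factor 2.\<close>

lemma edge_in_many_cliques:
  assumes E: "E \<subseteq> vertex_pairs {..<n}" and ext: "extensible n t E" and t: "2 \<le> t" and n: "0 < n"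
    and e: "e \<in> E"
  shows "real t * (real t - 1) / (real n)\<^sup>2 * real (card (cliques_over n E t {}))
     \<le> real (card {Q \<in> cliques_over n E t {}. e \<subseteq> Q})"
proof -
  define \<eta> where "\<eta> = 1 / (4 * real t)"
  have \<eta>: "0 < \<eta>" "\<eta> \<le> 1/8" using t by (auto simp: \<eta>_def field_simps)
  define lo where "lo = (\<lambda>i. (1 - \<eta>) * (real n / 2 ^ i))"
  define hi where "hi = (\<lambda>i. (1 + \<eta>) * (real n / 2 ^ i))"
  have ce: "card e = 2" "e \<subseteq> {..<n}" using E e by (auto simp: vertex_pairs_def)
  have pe: "vertex_pairs e \<subseteq> E"
  proof
    fix f assume "f \<in> vertex_pairs e"
    then have "f \<subseteq> e" "card f = card e" using ce by (auto simp: vertex_pairs_def)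
    then have "f = e" using ce card_subset_eq[of e f] finite_subset by blast
    then show "f \<in> E" using e by simp
  qed
  have eq: "{Q \<in> cliques_over n E t {}. e \<subseteq> Q} = cliques_over n E t e"
    by (auto simp: cliques_over_def)
  obtain m where m: "t = Suc (Suc m)" using t by (metis Suc_le_D numeral_2_eq_2 Suc_le_mono)
  have low: "(\<Prod>i<m. lo (Suc (Suc i))) \<le> fact m * real (card (cliques_over n E t e))"
    using card_cliques_over_bounds[OF E ext _ ce(2) pe, of m] ce m by (auto simp: lo_def \<eta>_def)
  have "vertex_pairs {} \<subseteq> E" by (auto simp: vertex_pairs_def)
  then have "fact t * real (card (cliques_over n E t {})) \<le> (\<Prod>i<t. hi i)"
    using card_cliques_over_bounds[OF E ext _ _, of "{}" t] t by (auto simp: hi_def \<eta>_def)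
  also have "(\<Prod>i<t. hi i) = hi 0 * hi 1 * (\<Prod>i<m. hi (Suc (Suc i)))"
    unfolding m prod.lessThan_Suc_shift by simp
  finally have high: "fact t * real (card (cliques_over n E t {})) \<le> hi 0 * hi 1 * (\<Prod>i<m. hi (Suc (Suc i)))" .
  have "1 / 2 * (\<Prod>i<m. hi (Suc (Suc i))) * (1 + \<eta>)\<^sup>2 \<le> (1 - 2 * \<eta>) ^ t * (\<Prod>i<m. hi (Suc (Suc i))) * (1 + \<eta>)\<^sup>2"
  proof (intro mult_right_mono prod_nonneg)
    have "1 - real t * (2 * \<eta>) \<le> (1 - 2 * \<eta>) ^ t" using \<eta> Bernoulli_inequality[of "- (2 * \<eta>)" t] by simp
    then show "1 / 2 \<le> (1 - 2 * \<eta>) ^ t" using t by (simp add: \<eta>_def)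
  qed (use \<eta> in \<open>auto simp: hi_def\<close>)
  also have "\<dots> = ((1 - 2 * \<eta>) ^ m * (\<Prod>i<m. hi (Suc (Suc i)))) * ((1 - 2 * \<eta>) * (1 + \<eta>))\<^sup>2"
    by (simp add: m power_mult_distrib power2_eq_square)
  also have "\<dots> \<le> (\<Prod>i<m. lo (Suc (Suc i))) * 1\<^sup>2"
  proof (intro mult_mono power_mono)
    have "(1 - 2 * \<eta>) ^ m * (\<Prod>i<m. hi (Suc (Suc i))) = (\<Prod>i<m. (1 - 2 * \<eta>) * hi (Suc (Suc i)))"
      by (simp add: prod.distrib)
    also have "\<dots> \<le> (\<Prod>i<m. lo (Suc (Suc i)))"
    proof (intro prod_mono conjI)
      fix i
      have "(1 - 2 * \<eta>) * (1 + \<eta>) \<le> 1 - \<eta>" using \<eta> by (simp add: algebra_simps)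
      then have "(1 - 2 * \<eta>) * (1 + \<eta>) * (real n / 2 ^ Suc (Suc i)) \<le> (1 - \<eta>) * (real n / 2 ^ Suc (Suc i))"
        by (rule mult_right_mono) simp
      then show "(1 - 2 * \<eta>) * hi (Suc (Suc i)) \<le> lo (Suc (Suc i))" by (simp add: lo_def hi_def mult.assoc)
    qed (use \<eta> in \<open>auto simp: hi_def\<close>)
    finally show "(1 - 2 * \<eta>) ^ m * (\<Prod>i<m. hi (Suc (Suc i))) \<le> (\<Prod>i<m. lo (Suc (Suc i)))" .
    show "(1 - 2 * \<eta>) * (1 + \<eta>) \<le> 1" using \<eta> by (simp add: algebra_simps)
  qed (use \<eta> in \<open>auto simp: hi_def lo_def intro!: prod_nonneg\<close>)
  finally have A: "1 / 2 * (\<Prod>i<m. hi (Suc (Suc i))) * (1 + \<eta>)\<^sup>2 \<le> (\<Prod>i<m. lo (Suc (Suc i)))" by simp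
  have "hi 0 * hi 1 * (\<Prod>i<m. hi (Suc (Suc i))) = (real n)\<^sup>2 * (1 / 2 * (\<Prod>i<m. hi (Suc (Suc i))) * (1 + \<eta>)\<^sup>2)"
    by (simp add: hi_def power2_eq_square)
  also have "\<dots> \<le> (real n)\<^sup>2 * (fact m * real (card (cliques_over n E t e)))"
    using A low by (intro mult_left_mono) auto
  finally have "fact t * real (card (cliques_over n E t {})) \<le> (real n)\<^sup>2 * (fact m * real (card (cliques_over n E t e)))"
    using high by linarith
  moreover have "fact t = real t * (real t - 1) * fact m" by (simp add: m algebra_simps)
  ultimately have "fact m * (real t * (real t - 1) * real (card (cliques_over n E t {})))
     \<le> fact m * ((real n)\<^sup>2 * real (card (cliques_over n E t e)))"
    by (simp add: algebra_simps)
  then have "real t * (real t - 1) * real (card (cliques_over n E t {})) \<le> (real n)\<^sup>2 * real (card (cliques_over n E t e))"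
    by (simp only: mult_le_cancel_left_pos[OF fact_gt_zero])
  then show ?thesis unfolding eq using n by (simp add: field_simps)
qed

text \<open>Every uncovered element lies in a proportion \<phi> of the sets, so an average set
  covers this proportion of what is still uncovered, and some set does at least as well.\<close>

lemma greedy_cover:
  fixes \<phi> :: real
  assumes "finite K" "finite H" "\<phi> \<le> 1"
    and dense: "\<And>e. e \<in> H \<Longrightarrow> \<phi> * card K \<le> card {Q \<in> K. R e Q}" and "K \<noteq> {}"
  shows "\<exists>Qs. length Qs = m \<and> set Qs \<subseteq> K \<and> real (card {e \<in> H. \<forall>Q\<in>set Qs. \<not> R e Q}) \<le> (1 - \<phi>) ^ m * card H"
proof (induction m)
  case (Suc m)
  then obtain Qs where Qs: "length Qs = m" "set Qs \<subseteq> K"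
    "real (card {e \<in> H. \<forall>Q\<in>set Qs. \<not> R e Q}) \<le> (1 - \<phi>) ^ m * card H" by blast
  let ?U = "{e \<in> H. \<forall>Q\<in>set Qs. \<not> R e Q}"
  have fU: "finite ?U" using assms(2) by auto
  have "\<exists>Q\<in>K. \<phi> * card ?U \<le> real (card {e \<in> ?U. R e Q})"
  proof (rule ccontr)
    assume "\<not> ?thesis"
    then have "(\<Sum>Q\<in>K. real (card {e \<in> ?U. R e Q})) < (\<Sum>Q\<in>K. \<phi> * card ?U)"
      using assms(1,5) by (intro sum_strict_mono) auto
    moreover have "(\<Sum>Q\<in>K. real (card {e \<in> ?U. R e Q})) = (\<Sum>e\<in>?U. real (card {Q \<in> K. R e Q}))"
    proof -
      have "(\<Sum>Q\<in>K. real (card {e \<in> ?U. R e Q})) = (\<Sum>Q\<in>K. \<Sum>e\<in>?U. if R e Q then 1 else 0)"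
        using fU by (simp add: sum.If_cases Int_def)
      also have "\<dots> = (\<Sum>e\<in>?U. \<Sum>Q\<in>K. if R e Q then 1 else 0)" by (rule sum.swap)
      also have "\<dots> = (\<Sum>e\<in>?U. real (card {Q \<in> K. R e Q}))"
        using assms(1) by (simp add: sum.If_cases Int_def)
      finally show ?thesis .
    qed
    moreover have "(\<Sum>e\<in>?U. \<phi> * card K) \<le> (\<Sum>e\<in>?U. real (card {Q \<in> K. R e Q}))"
      by (intro sum_mono dense) auto
    ultimately show False by (simp add: mult_ac)
  qed
  then obtain Q where Q: "Q \<in> K" "\<phi> * card ?U \<le> real (card {e \<in> ?U. R e Q})" by blast
  have "{e \<in> H. \<forall>Q\<in>set (Q # Qs). \<not> R e Q} = ?U - {e \<in> ?U. R e Q}" by auto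
  moreover have "card (?U - {e \<in> ?U. R e Q}) = card ?U - card {e \<in> ?U. R e Q}"
    by (intro card_Diff_subset finite_subset[OF _ fU]) auto
  moreover have "card {e \<in> ?U. R e Q} \<le> card ?U" using fU by (intro card_mono) auto
  ultimately have "real (card {e \<in> H. \<forall>Q\<in>set (Q # Qs). \<not> R e Q}) = real (card ?U) - card {e \<in> ?U. R e Q}"
    by (simp only: of_nat_diff)
  also have "\<dots> \<le> (1 - \<phi>) * card ?U" using Q by (simp add: algebra_simps)
  also have "\<dots> \<le> (1 - \<phi>) * ((1 - \<phi>) ^ m * card H)" using Qs(3) assms(3) by (intro mult_left_mono) auto
  finally show ?case using Qs Q by (intro exI[of _ "Q # Qs"]) auto
qed (auto intro!: exI[of _ "[]"])

section \<open>From clique covers to representations\<close>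

lemma coverage_eq_0: "(\<And>A. A \<in> set Ws \<Longrightarrow> \<not> e \<subseteq> A) \<Longrightarrow> coverage Ws e = 0"
  by (simp add: coverage_def filter_empty_conv)

lemma coverage_pos: "A \<in> set Ws \<Longrightarrow> e \<subseteq> A \<Longrightarrow> 1 \<le> coverage Ws e"
  by (induction Ws) auto

lemma coverage_edge_list:
  assumes "E \<subseteq> vertex_pairs V" "e \<in> vertex_pairs V" "e \<notin> E" "set us \<subseteq> E"
  shows "coverage us e = 0"
proof (rule coverage_eq_0, rule notI)
  fix f assume f: "f \<in> set us" "e \<subseteq> f"
  then have "card f = 2" "finite f" "card e = 2" using assms by (auto simp: vertex_pairs_def card_ge_0_finite)
  then have "e = f" using f(2) card_subset_eq[of f e] by simp
  then show False using f assms by auto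
qed

text \<open>Cliques never cover a non-edge, and an edge that they miss becomes a two-vertex set of
  its own.\<close>

lemma theta_le_clique_cover:
  assumes E: "E \<subseteq> vertex_pairs V" and V: "finite V" and k: "1 \<le> k"
    and Q: "\<And>Q. Q \<in> set Qs \<Longrightarrow> vertex_pairs Q \<subseteq> E"
  shows "theta k V E \<le> length Qs + card {e \<in> E. \<forall>Q\<in>set Qs. \<not> e \<subseteq> Q} + (k - 1)"
proof -
  let ?U = "{e \<in> E. \<forall>Q\<in>set Qs. \<not> e \<subseteq> Q}"
  have "finite E" by (rule finite_subset[OF E]) (use V in simp)
  then have "finite ?U" by simp
  from finite_distinct_list[OF this] obtain us where us: "set us = ?U" "distinct us"
    by (elim exE conjE)
  have "theta k V E \<le> length (Qs @ us @ replicate (k - 1) V)"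
  proof (rule theta_le_length)
    fix e assume e: "e \<in> vertex_pairs V"
    then have e': "e \<subseteq> V" "card e = 2" by (auto simp: vertex_pairs_def)
    show "k \<le> coverage (Qs @ us @ replicate (k - 1) V) e \<longleftrightarrow> e \<in> E"
    proof (cases "e \<in> E")
      case True
      have "1 \<le> coverage Qs e + coverage us e"
      proof (cases "\<exists>Q\<in>set Qs. e \<subseteq> Q")
        case True
        then obtain Q where "Q \<in> set Qs" "e \<subseteq> Q" by blast
        from coverage_pos[OF this] show ?thesis by linarith
      next
        case False
        then have "e \<in> set us" using \<open>e \<in> E\<close> us by auto
        then show ?thesis using coverage_pos[of e us e] by simp
      qed
      then show ?thesis using True e' by simp
    next
      case False
      have "coverage Qs e = 0"
        using Q e' False by (intro coverage_eq_0) (auto simp: vertex_pairs_def)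
      moreover have "coverage us e = 0"
        using coverage_edge_list[OF E e False] us by auto
      ultimately show ?thesis using False e' k by simp
    qed
  qed
  also have "\<dots> = length Qs + card ?U + (k - 1)"
    using us distinct_card[of us] by simp
  finally show ?thesis .
qed

text \<open>\<open>m\<close> is the number of greedy steps, each of which shrinks the set of
  uncovered edges by the factor 1 - t (t - 1)/n^2 from \<open>edge_in_many_cliques\<close>.\<close>

lemma theta_le_extensible:
  fixes m n t k :: nat
  assumes E: "E \<subseteq> vertex_pairs {..<n}" and ext: "extensible n t E" and t: "2 \<le> t" "t \<le> n" and k: "1 \<le> k"
  shows "real (theta k {..<n} E) \<le> m + exp (- (real t * (real t - 1) / (real n)\<^sup>2) * m) * (real n)\<^sup>2 + k"
proof -
  let ?K = "cliques_over n E t {}"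
  define \<phi> where "\<phi> = real t * (real t - 1) / (real n)\<^sup>2"
  have "real t * (real t - 1) \<le> real n * real n" using t by (intro mult_mono) auto
  then have \<phi>: "\<phi> \<le> 1" using t by (simp add: \<phi>_def power2_eq_square)
  have "0 < (\<Prod>i<t. (1 - 1 / (4 * real t)) * (real n / 2 ^ i))"
    using t by (intro prod_pos) (auto simp: field_simps)
  also have "\<dots> \<le> fact t * real (card ?K)"
  proof -
    have "vertex_pairs {} \<subseteq> E" by (auto simp: vertex_pairs_def)
    then show ?thesis using card_cliques_over_bounds[OF E ext, of "{}" t] t by simp
  qed
  finally have "?K \<noteq> {}" by auto
  moreover have "\<phi> * card ?K \<le> card {Q \<in> ?K. e \<subseteq> Q}" if "e \<in> E" for e
    using edge_in_many_cliques[OF E ext t(1) _ that] t unfolding \<phi>_def by simp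
  moreover have "finite E" by (rule finite_subset[OF E]) simp
  ultimately obtain Qs where Qs: "length Qs = m" "set Qs \<subseteq> ?K"
    "real (card {e \<in> E. \<forall>Q\<in>set Qs. \<not> e \<subseteq> Q}) \<le> (1 - \<phi>) ^ m * card E"
    using greedy_cover[of ?K E \<phi> "\<lambda>e Q. e \<subseteq> Q" m] \<phi> by auto
  have "theta k {..<n} E \<le> m + card {e \<in> E. \<forall>Q\<in>set Qs. \<not> e \<subseteq> Q} + (k - 1)"
    using theta_le_clique_cover[OF E _ k, of Qs] Qs by (auto simp: cliques_over_def)
  then have "real (theta k {..<n} E) \<le> real m + real (card {e \<in> E. \<forall>Q\<in>set Qs. \<not> e \<subseteq> Q}) + real k" by linarith
  also have "real (card {e \<in> E. \<forall>Q\<in>set Qs. \<not> e \<subseteq> Q}) \<le> (1 - \<phi>) ^ m * card E" by (rule Qs(3))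
  also have "\<dots> \<le> exp (- \<phi>) ^ m * (real n)\<^sup>2"
  proof (intro mult_mono power_mono)
    have "card E \<le> card (vertex_pairs {..<n})" using E by (intro card_mono) auto
    then show "real (card E) \<le> (real n)\<^sup>2"
      using real_choose_two[of n] by (simp add: card_vertex_pairs power2_eq_square algebra_simps)
  qed (use \<phi> exp_ge_add_one_self[of "- \<phi>"] in auto)
  also have "exp (- \<phi>) ^ m = exp (- \<phi> * m)" by (simp add: exp_of_nat_mult[symmetric] mult.commute)
  finally show ?thesis by (simp add: \<phi>_def)
qed

section \<open>Expectations over sequences of independent choices\<close>

text \<open>The expectation of \<phi> over \<open>m\<close> independent draws with law \<mu>. The
  recursion replaces a product measure and lets all identities go by induction on
  \<open>m\<close>.\<close>

primrec list_expect :: "'c set \<Rightarrow> ('c \<Rightarrow> real) \<Rightarrow> nat \<Rightarrow> ('c list \<Rightarrow> real) \<Rightarrow> real" where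
  "list_expect C \<mu> 0 \<phi> = \<phi> []"
| "list_expect C \<mu> (Suc m) \<phi> = (\<Sum>c\<in>C. \<mu> c * list_expect C \<mu> m (\<lambda>l. \<phi> (c # l)))"

locale weights =
  fixes C :: "'c set" and \<mu> :: "'c \<Rightarrow> real"
  assumes finite_C: "finite C" and nonneg: "\<And>c. c \<in> C \<Longrightarrow> 0 \<le> \<mu> c" and sum1: "sum \<mu> C = 1"
begin

abbreviation LE where "LE \<equiv> list_expect C \<mu>"

lemma LE_add: "LE m (\<lambda>l. f l + g l) = LE m f + LE m g"
  by (induction m arbitrary: f g) (simp_all add: sum.distrib algebra_simps)

lemma LE_cmult: "LE m (\<lambda>l. c * f l) = c * LE m f"
  by (induction m arbitrary: f) (simp_all add: sum_distrib_left algebra_simps)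

lemma LE_cmult_right: "LE m (\<lambda>l. f l * c) = LE m f * c"
  using LE_cmult[of m c f] by (simp add: mult.commute)

lemma LE_const: "LE m (\<lambda>l. c) = c"
  by (induction m) (simp_all add: sum_distrib_right[symmetric] sum1)

lemma LE_diff: "LE m (\<lambda>l. f l - g l) = LE m f - LE m g"
  using LE_add[of m f "\<lambda>l. (-1) * g l"] LE_cmult[of m "-1" g] by simp

lemma LE_sum: "LE m (\<lambda>l. \<Sum>i\<in>I. f i l) = (\<Sum>i\<in>I. LE m (f i))"
proof (induction I rule: infinite_finite_induct)
  case (insert x F)
  then show ?case by (simp add: LE_add)
qed (auto simp: LE_const)

lemma LE_mono:
  assumes "\<And>l. set l \<subseteq> C \<Longrightarrow> length l = m \<Longrightarrow> f l \<le> g l"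
  shows "LE m f \<le> LE m g"
  using assms
proof (induction m arbitrary: f g)
  case (Suc m)
  show ?case unfolding list_expect.simps
  proof (intro sum_mono mult_left_mono nonneg)
    fix c assume c: "c \<in> C"
    show "LE m (\<lambda>l. f (c # l)) \<le> LE m (\<lambda>l. g (c # l))"
      by (rule Suc.IH) (use Suc.prems c in auto)
  qed
qed auto

lemma LE_nonneg:
  assumes "\<And>l. set l \<subseteq> C \<Longrightarrow> length l = m \<Longrightarrow> 0 \<le> f l"
  shows "0 \<le> LE m f"
  using LE_mono[of m "\<lambda>_. 0" f] assms by (simp add: LE_const)

lemma LE_le_1:
  assumes "\<And>l. set l \<subseteq> C \<Longrightarrow> length l = m \<Longrightarrow> f l \<le> 1"
  shows "LE m f \<le> 1"
  using LE_mono[of m f "\<lambda>_. 1"] assms by (simp add: LE_const)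

text \<open>The probabilistic method: here an average over lists turns into an actual list.\<close>

lemma LE_exists:
  "\<exists>l. set l \<subseteq> C \<and> length l = m \<and> f l \<le> LE m f"
proof (induction m arbitrary: f)
  case (Suc m)
  have "\<exists>c\<in>C. LE m (\<lambda>l. f (c # l)) \<le> LE (Suc m) f"
  proof (rule ccontr)
    assume "\<not> ?thesis"
    then have lt: "LE (Suc m) f < LE m (\<lambda>l. f (c # l))" if "c \<in> C" for c
      using that by (auto simp: not_le)
    have "\<exists>c\<in>C. 0 < \<mu> c"
    proof (rule ccontr)
      assume "\<not> ?thesis"
      then have "sum \<mu> C = 0" using nonneg by (intro sum.neutral) (force simp: not_less)
      then show False using sum1 by simp
    qed
    then obtain d where d: "d \<in> C" "0 < \<mu> d" by blast
    have "(\<Sum>c\<in>C. \<mu> c * LE (Suc m) f) < (\<Sum>c\<in>C. \<mu> c * LE m (\<lambda>l. f (c # l)))"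
    proof (rule sum_strict_mono_ex1[OF finite_C])
      show "\<forall>c\<in>C. \<mu> c * LE (Suc m) f \<le> \<mu> c * LE m (\<lambda>l. f (c # l))"
        using mult_left_mono[OF less_imp_le[OF lt] nonneg] by blast
      show "\<exists>c\<in>C. \<mu> c * LE (Suc m) f < \<mu> c * LE m (\<lambda>l. f (c # l))"
        using mult_strict_left_mono[OF lt[OF d(1)] d(2)] d(1) by blast
    qed
    then show False by (simp add: sum_distrib_right[symmetric] sum1)
  qed
  then obtain c where c: "c \<in> C" "LE m (\<lambda>l. f (c # l)) \<le> LE (Suc m) f" by blast
  obtain l where "set l \<subseteq> C" "length l = m" "f (c # l) \<le> LE m (\<lambda>l. f (c # l))"
    using Suc.IH[of "\<lambda>l. f (c # l)"] by auto
  then show ?case using c by (intro exI[of _ "c # l"]) auto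
qed auto

lemma LE_prod_list: "LE m (\<lambda>l. \<Prod>c\<leftarrow>l. f c) = (\<Sum>c\<in>C. \<mu> c * f c) ^ m"
  by (induction m) (simp_all add: LE_cmult sum_distrib_right[symmetric] mult.assoc[symmetric])

lemma LE_sum_list:
  "LE m (\<lambda>l. \<Sum>c\<leftarrow>l. f c) = real m * (\<Sum>c\<in>C. \<mu> c * f c)"
proof (induction m)
  case (Suc m)
  have "LE (Suc m) (\<lambda>l. \<Sum>c\<leftarrow>l. f c) = (\<Sum>c\<in>C. \<mu> c * f c + \<mu> c * (real m * (\<Sum>c\<in>C. \<mu> c * f c)))"
    by (simp add: LE_add LE_const Suc.IH distrib_left)
  also have "\<dots> = (\<Sum>c\<in>C. \<mu> c * f c) + sum \<mu> C * (real m * (\<Sum>c\<in>C. \<mu> c * f c))"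
    by (simp only: sum.distrib sum_distrib_right)
  finally show ?case by (simp add: sum1 algebra_simps)
qed simp

lemma LE_sum_list_mult:
  "LE m (\<lambda>l. (\<Sum>c\<leftarrow>l. f c) * (\<Sum>c\<leftarrow>l. g c))
     = real m * (\<Sum>c\<in>C. \<mu> c * (f c * g c)) + real m * (real m - 1) * ((\<Sum>c\<in>C. \<mu> c * f c) * (\<Sum>c\<in>C. \<mu> c * g c))"
proof (induction m)
  case (Suc m)
  let ?f = "\<Sum>c\<in>C. \<mu> c * f c" and ?g = "\<Sum>c\<in>C. \<mu> c * g c" and ?fg = "\<Sum>c\<in>C. \<mu> c * (f c * g c)"
  let ?X = "LE m (\<lambda>l. (\<Sum>c\<leftarrow>l. f c) * (\<Sum>c\<leftarrow>l. g c))"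
  have "LE (Suc m) (\<lambda>l. (\<Sum>c\<leftarrow>l. f c) * (\<Sum>c\<leftarrow>l. g c))
     = (\<Sum>c\<in>C. \<mu> c * LE m (\<lambda>l. f c * g c + f c * (\<Sum>c\<leftarrow>l. g c) + g c * (\<Sum>c\<leftarrow>l. f c)
          + (\<Sum>c\<leftarrow>l. f c) * (\<Sum>c\<leftarrow>l. g c)))"
    by (simp add: algebra_simps)
  also have "\<dots> = (\<Sum>c\<in>C. \<mu> c * (f c * g c) + \<mu> c * f c * (real m * ?g) + \<mu> c * g c * (real m * ?f) + \<mu> c * ?X)"
    by (simp only: LE_add LE_const LE_cmult LE_sum_list distrib_left mult.assoc)
  also have "\<dots> = ?fg + ?f * (real m * ?g) + ?g * (real m * ?f) + ?X"
    by (simp only: sum.distrib sum_distrib_right[symmetric] sum1 mult_1)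
  finally show ?case unfolding Suc.IH by (simp add: algebra_simps)
qed simp

text \<open>By linearity one of the \<open>m\<close> draws carries the extra weight
  \<open>f\<close>, while the others contribute their plain factor. For m = 0 both sides
  vanish.\<close>

lemma LE_prod_list_sum_list:
  "LE m (\<lambda>l. (\<Prod>c\<leftarrow>l. w c) * (\<Sum>c\<leftarrow>l. f c))
     = real m * (\<Sum>c\<in>C. \<mu> c * w c * f c) * (\<Sum>c\<in>C. \<mu> c * w c) ^ (m - 1)"
proof (induction m)
  case (Suc m)
  let ?a = "\<Sum>c\<in>C. \<mu> c * w c" and ?b = "\<Sum>c\<in>C. \<mu> c * w c * f c"
  have "LE (Suc m) (\<lambda>l. (\<Prod>c\<leftarrow>l. w c) * (\<Sum>c\<leftarrow>l. f c))
     = (\<Sum>c\<in>C. \<mu> c * LE m (\<lambda>l. w c * f c * (\<Prod>c\<leftarrow>l. w c) + w c * ((\<Prod>c\<leftarrow>l. w c) * (\<Sum>c\<leftarrow>l. f c))))"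
    by (simp add: algebra_simps)
  also have "\<dots> = ?b * ?a ^ m + ?a * LE m (\<lambda>l. (\<Prod>c\<leftarrow>l. w c) * (\<Sum>c\<leftarrow>l. f c))"
    by (simp add: LE_add LE_cmult LE_prod_list sum.distrib distrib_left sum_distrib_right mult.assoc)
  also have "\<dots> = real (Suc m) * ?b * ?a ^ (Suc m - 1)"
    unfolding Suc.IH by (cases m) (simp_all add: algebra_simps)
  finally show ?case .
qed simp

end

section \<open>Repairing an approximate representation\<close>

text \<open>The price of repairing a non-edge \<open>f\<close>: removing its ends from
  \<open>A\<close> affects at most 2 |A| pairs of \<open>A\<close>.\<close>

definition covered_size :: "'a set list \<Rightarrow> 'a set \<Rightarrow> real" where
  "covered_size As f = (\<Sum>A\<leftarrow>As. if f \<subseteq> A then real (card A) else 0)"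

lemma coverage_concat_replicate: "coverage (concat (map (replicate k) us)) e = k * coverage us e"
  by (induction us) auto

lemma length_concat_replicate: "length (concat (map (replicate k) us)) = k * length us"
  by (induction us) auto

lemma coverage_map_subset: "(\<And>A. h A \<subseteq> A) \<Longrightarrow> coverage (map h As) e \<le> coverage As e"
proof (induction As)
  case (Cons A As)
  have "e \<subseteq> h A \<Longrightarrow> e \<subseteq> A" using Cons.prems[of A] by blast
  then show ?case using Cons by (auto intro: le_SucI)
qed simp

lemma coverage_map_eq:
  "(\<And>A. A \<in> set As \<Longrightarrow> e \<subseteq> h A \<longleftrightarrow> e \<subseteq> A) \<Longrightarrow> coverage (map h As) e = coverage As e"
  by (induction As) auto

lemma sum_set_le_sum_list:
  fixes g :: "'a \<Rightarrow> real"
  assumes "\<And>x. 0 \<le> g x"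
  shows "sum g (set xs) \<le> (\<Sum>x\<leftarrow>xs. g x)"
proof (induction xs)
  case (Cons x xs)
  have "sum g (set (x # xs)) \<le> g x + sum g (set xs)"
    using assms[of x] by (cases "x \<in> set xs") (auto simp: insert_absorb)
  then show ?case using Cons by simp
qed simp

lemma card_pairs_meeting:
  assumes "finite A" "card f = 2"
  shows "card {e \<in> vertex_pairs A. e \<inter> f \<noteq> {}} \<le> 2 * card A"
proof -
  have ff: "finite f" using assms(2) card_ge_0_finite[of f] by simp
  have "e \<in> (\<lambda>(x, w). {x, w}) ` (f \<times> A)" if "e \<in> {e \<in> vertex_pairs A. e \<inter> f \<noteq> {}}" for e
  proof -
    have "e \<in> vertex_pairs A" using that by simp
    then obtain u v where uv: "e = {u, v}" "u \<in> A" "v \<in> A" by (rule vertex_pairsE)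
    then consider "u \<in> f" | "v \<in> f" using \<open>e \<in> {e \<in> vertex_pairs A. e \<inter> f \<noteq> {}}\<close> by auto
    then show ?thesis
    proof cases
      case 1 then show ?thesis using uv by (intro image_eqI[of _ _ "(u, v)"]) auto
    next
      case 2 then show ?thesis using uv by (intro image_eqI[of _ _ "(v, u)"]) auto
    qed
  qed
  then have "card {e \<in> vertex_pairs A. e \<inter> f \<noteq> {}} \<le> card (f \<times> A)"
    using assms ff by (intro surj_card_le[of _ _ "\<lambda>(x, w). {x, w}"]) auto
  then show ?thesis using assms(2) by (simp add: card_cartesian_product)
qed

text \<open>Both endpoints of an overcovered non-edge are removed from every set that contains it. Every edge
  that is undercovered afterwards becomes \<open>k\<close> additional two-element sets.\<close>

lemma theta_le_repair:
  assumes E: "E \<subseteq> vertex_pairs V" and V: "finite V" and As: "\<And>A. A \<in> set As \<Longrightarrow> A \<subseteq> V" and k: "1 \<le> k"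
  defines "BN \<equiv> {f \<in> vertex_pairs V - E. k \<le> coverage As f}"
  shows "real (theta k V E) \<le> length As
     + k * (real (card {e \<in> E. coverage As e < k}) + 2 * (\<Sum>f\<in>BN. covered_size As f))"
proof -
  define fix_set where "fix_set = (\<lambda>A. A - \<Union> {f \<in> BN. f \<subseteq> A})"
  let ?As' = "map fix_set As"
  let ?BE = "{e \<in> E. coverage ?As' e < k}"
  have fE: "finite E" by (rule finite_subset[OF E]) (use V in simp)
  have fBN: "finite BN" unfolding BN_def using V by simp
  have "finite ?BE" using fE by simp
  from finite_distinct_list[OF this] obtain us where us: "set us = ?BE" "distinct us"
    by (elim exE conjE)
  have sub: "fix_set A \<subseteq> A" for A by (auto simp: fix_set_def)
  have "theta k V E \<le> length (?As' @ concat (map (replicate k) us))"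
  proof (rule theta_le_length)
    fix e assume e: "e \<in> vertex_pairs V"
    then have e2: "e \<noteq> {}" by (auto simp: vertex_pairs_def)
    show "k \<le> coverage (?As' @ concat (map (replicate k) us)) e \<longleftrightarrow> e \<in> E"
    proof (cases "e \<in> E")
      case True
      show ?thesis
      proof (cases "coverage ?As' e < k")
        case True
        then have "1 \<le> coverage us e" using coverage_pos[of e us e] us \<open>e \<in> E\<close> by simp
        then have "k * 1 \<le> k * coverage us e" by (rule mult_left_mono) simp
        then have "k \<le> coverage ?As' e + k * coverage us e" by linarith
        then show ?thesis using \<open>e \<in> E\<close> by (simp add: coverage_concat_replicate)
      qed (use \<open>e \<in> E\<close> in simp)
    next
      case False
      have "coverage us e = 0" by (rule coverage_edge_list[OF E e False]) (use us in auto)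
      moreover have "coverage ?As' e < k"
      proof (cases "e \<in> BN")
        case True
        have "coverage ?As' e = 0"
        proof (rule coverage_eq_0, rule notI)
          fix B assume B: "B \<in> set ?As'" "e \<subseteq> B"
          then obtain A where A: "B = fix_set A" by auto
          then have "e \<subseteq> A" using B sub by blast
          then show False using A B True e2 by (auto simp: fix_set_def)
        qed
        then show ?thesis using k by simp
      next
        case False
        then have "coverage As e < k" using e \<open>e \<notin> E\<close> by (auto simp: BN_def)
        then show ?thesis using coverage_map_subset[of fix_set As e] sub by (meson le_less_trans)
      qed
      ultimately show ?thesis using False by (simp add: coverage_concat_replicate)
    qed
  qed
  also have "\<dots> = length As + k * card ?BE"
    using us distinct_card[of us] by (simp add: length_concat_replicate)
  finally have theta: "real (theta k V E) \<le> length As + k * real (card ?BE)"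
    by (metis of_nat_add of_nat_le_iff of_nat_mult)
  \<comment> \<open>The pairs that can lose a set through the removals.\<close>
  define D where "D = (\<Union>f\<in>BN. \<Union>A\<in>{A \<in> set As. f \<subseteq> A}. {e \<in> vertex_pairs A. e \<inter> f \<noteq> {}})"
  have fA: "finite A" if "A \<in> set As" for A using As[OF that] V finite_subset by auto
  have "?BE \<subseteq> {e \<in> E. coverage As e < k} \<union> D"
  proof
    fix e assume e: "e \<in> ?BE"
    show "e \<in> {e \<in> E. coverage As e < k} \<union> D"
    proof (cases "coverage As e < k")
      case False
      then have "coverage ?As' e \<noteq> coverage As e" using e by auto
      then obtain A where A: "A \<in> set As" "\<not> (e \<subseteq> fix_set A \<longleftrightarrow> e \<subseteq> A)"
        using coverage_map_eq[of As e fix_set] by blast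
      then have eA: "e \<subseteq> A" "\<not> e \<subseteq> fix_set A" using sub[of A] by auto
      then obtain f where f: "f \<in> BN" "f \<subseteq> A" "e \<inter> f \<noteq> {}" by (auto simp: fix_set_def)
      moreover have "e \<in> vertex_pairs A" using e E eA by (auto simp: vertex_pairs_def)
      ultimately show ?thesis using A unfolding D_def by blast
    qed (use e in auto)
  qed
  then have "card ?BE \<le> card ({e \<in> E. coverage As e < k} \<union> D)"
    using fE fBN fA by (intro card_mono) (auto simp: D_def)
  also have "\<dots> \<le> card {e \<in> E. coverage As e < k} + card D" by (rule card_Un_le)
  finally have "real (card ?BE) \<le> real (card {e \<in> E. coverage As e < k}) + real (card D)" by linarith
  moreover have "real (card D) \<le> 2 * (\<Sum>f\<in>BN. covered_size As f)"
  proof -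
    have "card D \<le> (\<Sum>f\<in>BN. card (\<Union>A\<in>{A \<in> set As. f \<subseteq> A}. {e \<in> vertex_pairs A. e \<inter> f \<noteq> {}}))"
      unfolding D_def by (rule card_UN_le[OF fBN])
    also have "\<dots> \<le> (\<Sum>f\<in>BN. \<Sum>A\<in>{A \<in> set As. f \<subseteq> A}. card {e \<in> vertex_pairs A. e \<inter> f \<noteq> {}})"
      by (intro sum_mono card_UN_le) auto
    also have "\<dots> \<le> (\<Sum>f\<in>BN. \<Sum>A\<in>{A \<in> set As. f \<subseteq> A}. 2 * card A)"
      by (intro sum_mono card_pairs_meeting fA) (auto simp: BN_def vertex_pairs_def)
    finally have "real (card D) \<le> real (\<Sum>f\<in>BN. \<Sum>A\<in>{A \<in> set As. f \<subseteq> A}. 2 * card A)" by (rule of_nat_mono)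
    also have "\<dots> = (\<Sum>f\<in>BN. 2 * (\<Sum>A\<in>{A \<in> set As. f \<subseteq> A}. real (card A)))"
      by (simp add: sum_distrib_left)
    also have "\<dots> \<le> (\<Sum>f\<in>BN. 2 * covered_size As f)"
    proof (intro sum_mono mult_left_mono)
      fix f
      have "(\<Sum>A\<in>{A \<in> set As. f \<subseteq> A}. real (card A)) = (\<Sum>A\<in>set As. if f \<subseteq> A then real (card A) else 0)"
        by (simp add: sum.inter_filter)
      also have "\<dots> \<le> covered_size As f"
        unfolding covered_size_def by (rule sum_set_le_sum_list) auto
      finally show "(\<Sum>A\<in>{A \<in> set As. f \<subseteq> A}. real (card A)) \<le> covered_size As f" .
    qed auto
    finally show ?thesis by (simp add: sum_distrib_left)
  qed
  ultimately have "real (card ?BE) \<le> real (card {e \<in> E. coverage As e < k}) + 2 * (\<Sum>f\<in>BN. covered_size As f)"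
    by linarith
  then have "k * real (card ?BE) \<le> k * (real (card {e \<in> E. coverage As e < k}) + 2 * (\<Sum>f\<in>BN. covered_size As f))"
    by (intro mult_left_mono) auto
  with theta show ?thesis by linarith
qed

lemma power_coverage: "(y::real) ^ coverage As e = (\<Prod>A\<leftarrow>As. if e \<subseteq> A then y else 1)"
  by (induction As) auto

text \<open>The list of sets is drawn independently with law \<mu>, and the repair cost is bounded
  by exponential moments, with \<open>y\<close> below 1 for undercovered edges and \<open>z\<close>
  above 1 for overcovered non-edges. The probability bounds are available only for pairs in
  \<open>G\<close>; the remaining \<open>B\<close> pairs are all counted as failures.\<close>

lemma theta_le_random_sets:
  fixes y z p1 p0 b b' :: real and k m :: nat and V :: "'a set" and \<mu> :: "'a set \<Rightarrow> real"
  assumes E: "E \<subseteq> vertex_pairs V" and V: "finite V" and k: "1 \<le> k"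
    and W: "weights (Pow V) \<mu>"
    and y: "0 < y" "y \<le> 1" and z: "1 \<le> z" and G: "G \<subseteq> vertex_pairs V"
    and p1: "\<And>e. e \<in> E \<inter> G \<Longrightarrow> p1 \<le> (\<Sum>A\<in>Pow V. \<mu> A * of_bool (e \<subseteq> A))"
    and p0: "\<And>f. f \<in> G - E \<Longrightarrow> (\<Sum>A\<in>Pow V. \<mu> A * of_bool (f \<subseteq> A)) \<le> p0"
    and b0: "0 \<le> b" and b: "\<And>f. f \<in> G - E \<Longrightarrow> (\<Sum>A\<in>Pow V. \<mu> A * of_bool (f \<subseteq> A) * card A) \<le> b"
    and b': "\<And>f. f \<in> vertex_pairs V \<Longrightarrow> (\<Sum>A\<in>Pow V. \<mu> A * of_bool (f \<subseteq> A) * card A) \<le> b'"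
  defines "N \<equiv> real (card (vertex_pairs V))" and "B \<equiv> real (card (vertex_pairs V - G))"
  shows "real (theta k V E) \<le> m + k * (B + N * (exp (- (1 - y) * p1 * m) / y ^ k)
     + 2 * (N * (m * z * b * exp ((z - 1) * p0 * m) / z ^ k) + B * (m * b')))"
proof -
  interpret weights "Pow V" \<mu> by (rule W)
  let ?P = "vertex_pairs V"
  have fP: "finite ?P" using V by simp
  have fin: "finite E" "finite G" using finite_subset[OF E] finite_subset[OF G] V by auto
  define pr where "pr = (\<lambda>e. \<Sum>A\<in>Pow V. \<mu> A * of_bool (e \<subseteq> A))"
  define sz where "sz = (\<lambda>e. \<Sum>A\<in>Pow V. \<mu> A * of_bool (e \<subseteq> A) * card A)"
  have pr01: "0 \<le> pr e" "pr e \<le> 1" for e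
  proof -
    show "0 \<le> pr e" unfolding pr_def by (intro sum_nonneg mult_nonneg_nonneg nonneg) auto
    have "pr e \<le> (\<Sum>A\<in>Pow V. \<mu> A)" unfolding pr_def by (intro sum_mono) (use nonneg in auto)
    then show "pr e \<le> 1" using sum1 by linarith
  qed
  have sz0: "0 \<le> sz e" for e unfolding sz_def by (intro sum_nonneg mult_nonneg_nonneg nonneg) auto
  have mom: "(\<Sum>A\<in>Pow V. \<mu> A * (if e \<subseteq> A then x else 1)) = 1 + (x - 1) * pr e" for e x
  proof -
    have "(\<Sum>A\<in>Pow V. \<mu> A * (if e \<subseteq> A then x else 1)) = (\<Sum>A\<in>Pow V. \<mu> A + (x - 1) * (\<mu> A * of_bool (e \<subseteq> A)))"
      by (intro sum.cong) (auto simp: algebra_simps)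
    then show ?thesis by (simp add: sum.distrib sum1 pr_def sum_distrib_left)
  qed
  \<comment> \<open>y^(coverage - k) is at least 1 on undercovered edges and z^(coverage - k) on
    overcovered non-edges, so one functional dominates all repair costs and a single choice of
    \<open>As\<close> controls them together.\<close>
  define \<Psi> where "\<Psi> = (\<lambda>As. (\<Sum>e\<in>E \<inter> G. y ^ coverage As e * (1 / y ^ k))
     + 2 * ((\<Sum>f\<in>G - E. z ^ coverage As f * covered_size As f * (1 / z ^ k)) + (\<Sum>f\<in>?P - E - G. covered_size As f)))"
  obtain As where As: "set As \<subseteq> Pow V" "length As = m" "\<Psi> As \<le> LE m \<Psi>" using LE_exists by blast
  have cs: "0 \<le> covered_size As f" for f unfolding covered_size_def by (intro sum_list_nonneg) auto
  have e1: "LE m (\<lambda>As. y ^ coverage As e) \<le> exp (- (1 - y) * p1 * m)" if "e \<in> E \<inter> G" for e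
  proof -
    have "LE m (\<lambda>As. y ^ coverage As e) = (1 + (y - 1) * pr e) ^ m"
      unfolding power_coverage LE_prod_list mom by simp
    also have "\<dots> \<le> exp (- (1 - y) * p1) ^ m"
    proof (rule power_mono)
      have "(1 - y) * p1 \<le> (1 - y) * pr e" using p1[OF that] y by (intro mult_left_mono) (auto simp: pr_def)
      then have "1 + (y - 1) * pr e \<le> 1 + (- (1 - y) * p1)" by (simp add: algebra_simps)
      also have "\<dots> \<le> exp (- (1 - y) * p1)" by (rule exp_ge_add_one_self)
      finally show "1 + (y - 1) * pr e \<le> exp (- (1 - y) * p1)" .
      have "(1 - y) * pr e \<le> 1 * 1" using y pr01 by (intro mult_mono) auto
      then show "0 \<le> 1 + (y - 1) * pr e" by (simp add: algebra_simps)
    qed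
    finally show ?thesis by (simp add: exp_of_nat_mult[symmetric] mult_ac)
  qed
  have e2: "LE m (\<lambda>As. z ^ coverage As f * covered_size As f) \<le> m * z * b * exp ((z - 1) * p0 * m)" if f: "f \<in> G - E" for f
  proof -
    have 1: "1 + (z - 1) * pr f \<le> exp ((z - 1) * p0)"
    proof -
      have "(z - 1) * pr f \<le> (z - 1) * p0" using p0[OF f] z by (intro mult_left_mono) (auto simp: pr_def)
      then show ?thesis using exp_ge_add_one_self[of "(z - 1) * p0"] by linarith
    qed
    have 0: "1 \<le> 1 + (z - 1) * pr f" using z pr01 by simp
    have "LE m (\<lambda>As. z ^ coverage As f * covered_size As f)
        = real m * (\<Sum>A\<in>Pow V. \<mu> A * (if f \<subseteq> A then z else 1) * (if f \<subseteq> A then real (card A) else 0)) * (1 + (z - 1) * pr f) ^ (m - 1)"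
      unfolding power_coverage covered_size_def LE_prod_list_sum_list mom by simp
    also have "(\<Sum>A\<in>Pow V. \<mu> A * (if f \<subseteq> A then z else 1) * (if f \<subseteq> A then real (card A) else 0)) = z * sz f"
      unfolding sz_def sum_distrib_left by (intro sum.cong) auto
    also have "real m * (z * sz f) * (1 + (z - 1) * pr f) ^ (m - 1) \<le> real m * (z * b) * exp ((z - 1) * p0) ^ m"
    proof (intro mult_mono)
      have "(1 + (z - 1) * pr f) ^ (m - 1) \<le> (1 + (z - 1) * pr f) ^ m" using 0 by (intro power_increasing) auto
      also have "\<dots> \<le> exp ((z - 1) * p0) ^ m" using 0 1 by (intro power_mono) auto
      finally show "(1 + (z - 1) * pr f) ^ (m - 1) \<le> exp ((z - 1) * p0) ^ m" .
      show "sz f \<le> b" using b[OF f] by (simp add: sz_def)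
      then show "0 \<le> real m * (z * b)" using sz0[of f] z by simp
    qed (use 0 z sz0[of f] in auto)
    finally show ?thesis by (simp add: exp_of_nat_mult[symmetric] mult_ac)
  qed
  have e3: "LE m (\<lambda>As. covered_size As f) \<le> m * b'" if "f \<in> ?P" for f
  proof -
    have "LE m (\<lambda>As. covered_size As f) = real m * (\<Sum>A\<in>Pow V. \<mu> A * (if f \<subseteq> A then real (card A) else 0))"
      unfolding covered_size_def by (rule LE_sum_list)
    also have "(\<Sum>A\<in>Pow V. \<mu> A * (if f \<subseteq> A then real (card A) else 0)) = sz f"
      unfolding sz_def by (intro sum.cong) auto
    also have "real m * sz f \<le> m * b'" using b'[OF that] by (intro mult_left_mono) (auto simp: sz_def)
    finally show ?thesis .
  qed
  have cE: "real (card (E \<inter> G)) \<le> N" unfolding N_def using E fP by (intro of_nat_mono card_mono) auto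
  have cN: "real (card (G - E)) \<le> N" unfolding N_def using G fP by (intro of_nat_mono card_mono) auto
  have cB: "real (card (?P - E - G)) \<le> B" unfolding B_def using fP by (intro of_nat_mono card_mono) auto
  have "LE m \<Psi> = (\<Sum>e\<in>E \<inter> G. LE m (\<lambda>As. y ^ coverage As e) * (1 / y ^ k))
     + 2 * ((\<Sum>f\<in>G - E. LE m (\<lambda>As. z ^ coverage As f * covered_size As f) * (1 / z ^ k)) + (\<Sum>f\<in>?P - E - G. LE m (\<lambda>As. covered_size As f)))"
    unfolding \<Psi>_def by (simp only: LE_add LE_cmult LE_cmult_right LE_sum)
  also have "\<dots> \<le> (\<Sum>e\<in>E \<inter> G. exp (- (1 - y) * p1 * m) * (1 / y ^ k))
     + 2 * ((\<Sum>f\<in>G - E. (m * z * b * exp ((z - 1) * p0 * m)) * (1 / z ^ k)) + (\<Sum>f\<in>?P - E - G. m * b'))"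
    using e1 e2 e3 y z by (intro add_mono mult_left_mono sum_mono mult_right_mono) auto
  also have "\<dots> = real (card (E \<inter> G)) * (exp (- (1 - y) * p1 * m) / y ^ k)
     + 2 * (real (card (G - E)) * (m * z * b * exp ((z - 1) * p0 * m) / z ^ k) + real (card (?P - E - G)) * (m * b'))"
    by simp
  also have "\<dots> \<le> N * (exp (- (1 - y) * p1 * m) / y ^ k)
     + 2 * (N * (m * z * b * exp ((z - 1) * p0 * m) / z ^ k) + B * (m * b'))"
  proof (intro add_mono mult_left_mono)
    show "real (card (E \<inter> G)) * (exp (- (1 - y) * p1 * m) / y ^ k) \<le> N * (exp (- (1 - y) * p1 * m) / y ^ k)"
      using cE y by (intro mult_right_mono) auto
    show "real (card (G - E)) * (m * z * b * exp ((z - 1) * p0 * m) / z ^ k) \<le> N * (m * z * b * exp ((z - 1) * p0 * m) / z ^ k)"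
      using cN z b0 by (intro mult_right_mono) auto
    show "real (card (?P - E - G)) * (m * b') \<le> B * (m * b')"
    proof (cases "?P = {}")
      case False
      then obtain f where "f \<in> ?P" by blast
      then have "0 \<le> b'" using b'[of f] sz0[of f] by (simp add: sz_def)
      then show ?thesis using cB by (intro mult_right_mono) auto
    qed (auto simp: B_def)
  qed auto
  finally have Psi: "\<Psi> As \<le> N * (exp (- (1 - y) * p1 * m) / y ^ k)
     + 2 * (N * (m * z * b * exp ((z - 1) * p0 * m) / z ^ k) + B * (m * b'))" using As(3) by linarith
  have c1: "real (card {e \<in> E. coverage As e < k}) \<le> B + (\<Sum>e\<in>E \<inter> G. y ^ coverage As e * (1 / y ^ k))"
  proof -
    have "{e \<in> E. coverage As e < k} \<subseteq> (?P - G) \<union> {e \<in> E \<inter> G. coverage As e < k}" using E by auto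
    then have "card {e \<in> E. coverage As e < k} \<le> card ((?P - G) \<union> {e \<in> E \<inter> G. coverage As e < k})"
      using fP fin by (intro card_mono) auto
    also have "\<dots> \<le> card (?P - G) + card {e \<in> E \<inter> G. coverage As e < k}" by (rule card_Un_le)
    finally have "real (card {e \<in> E. coverage As e < k}) \<le> B + real (card {e \<in> E \<inter> G. coverage As e < k})"
      unfolding B_def by linarith
    also have "real (card {e \<in> E \<inter> G. coverage As e < k}) = (\<Sum>e\<in>{e \<in> E \<inter> G. coverage As e < k}. 1)" by simp
    also have "\<dots> \<le> (\<Sum>e\<in>{e \<in> E \<inter> G. coverage As e < k}. y ^ coverage As e * (1 / y ^ k))"
    proof (rule sum_mono)
      fix e assume "e \<in> {e \<in> E \<inter> G. coverage As e < k}"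
      then have "y ^ k \<le> y ^ coverage As e" using y by (intro power_decreasing) auto
      then show "1 \<le> y ^ coverage As e * (1 / y ^ k)" using y by simp
    qed
    also have "\<dots> \<le> (\<Sum>e\<in>E \<inter> G. y ^ coverage As e * (1 / y ^ k))"
      using fin y by (intro sum_mono2) auto
    finally show ?thesis by linarith
  qed
  have c2: "(\<Sum>f\<in>{f \<in> ?P - E. k \<le> coverage As f}. covered_size As f)
      \<le> (\<Sum>f\<in>G - E. z ^ coverage As f * covered_size As f * (1 / z ^ k)) + (\<Sum>f\<in>?P - E - G. covered_size As f)"
  proof -
    have "(\<Sum>f\<in>{f \<in> ?P - E. k \<le> coverage As f}. covered_size As f)
       \<le> (\<Sum>f\<in>{f \<in> G - E. k \<le> coverage As f} \<union> (?P - E - G). covered_size As f)"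
      using fP fin cs by (intro sum_mono2) auto
    also have "\<dots> \<le> (\<Sum>f\<in>{f \<in> G - E. k \<le> coverage As f}. covered_size As f) + (\<Sum>f\<in>?P - E - G. covered_size As f)"
      using fP fin by (subst sum.union_disjoint) auto
    also have "(\<Sum>f\<in>{f \<in> G - E. k \<le> coverage As f}. covered_size As f)
        \<le> (\<Sum>f\<in>{f \<in> G - E. k \<le> coverage As f}. z ^ coverage As f * covered_size As f * (1 / z ^ k))"
    proof (rule sum_mono)
      fix f assume "f \<in> {f \<in> G - E. k \<le> coverage As f}"
      then have "z ^ k \<le> z ^ coverage As f" using z by (intro power_increasing) auto
      then have "1 * covered_size As f \<le> (z ^ coverage As f * (1 / z ^ k)) * covered_size As f"
        using z cs by (intro mult_right_mono) auto
      then show "covered_size As f \<le> z ^ coverage As f * covered_size As f * (1 / z ^ k)" by (simp add: mult_ac)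
    qed
    also have "\<dots> \<le> (\<Sum>f\<in>G - E. z ^ coverage As f * covered_size As f * (1 / z ^ k))"
      using fin z cs by (intro sum_mono2) auto
    finally show ?thesis by linarith
  qed
  have "real (theta k V E) \<le> length As
     + k * (real (card {e \<in> E. coverage As e < k}) + 2 * (\<Sum>f\<in>{f \<in> ?P - E. k \<le> coverage As f}. covered_size As f))"
    by (rule theta_le_repair[OF E V _ k]) (use As in auto)
  also have "\<dots> \<le> m + k * (B + N * (exp (- (1 - y) * p1 * m) / y ^ k)
     + 2 * (N * (m * z * b * exp ((z - 1) * p0 * m) / z ^ k) + B * (m * b')))"
  proof -
    have "real (card {e \<in> E. coverage As e < k}) + 2 * (\<Sum>f\<in>{f \<in> ?P - E. k \<le> coverage As f}. covered_size As f)
       \<le> B + \<Psi> As" using add_mono[OF c1 mult_left_mono[OF c2, of 2]] unfolding \<Psi>_def by (simp only: add.assoc)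
    also have "\<dots> \<le> B + (N * (exp (- (1 - y) * p1 * m) / y ^ k)
     + 2 * (N * (m * z * b * exp ((z - 1) * p0 * m) / z ^ k) + B * (m * b')))" using Psi by (rule add_left_mono)
    finally show ?thesis unfolding As(2) by (intro add_left_mono mult_left_mono) (simp_all only: add.assoc of_nat_0_le_iff)
  qed
  finally show ?thesis .
qed

section \<open>Comparing sequences of choices with fair coin tosses\<close>

text \<open>A hybrid argument: the draws are switched from one law to the other one at a time, and
  each switch costs at most the L1 distance.\<close>

lemma list_expect_hybrid:
  assumes "weights C \<mu>" "weights C \<nu>" and \<phi>: "\<And>l. 0 \<le> \<phi> l \<and> \<phi> l \<le> 1"
  shows "\<bar>list_expect C \<mu> m \<phi> - list_expect C \<nu> m \<phi>\<bar> \<le> m * (\<Sum>c\<in>C. \<bar>\<mu> c - \<nu> c\<bar>)"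
  using \<phi>
proof (induction m arbitrary: \<phi>)
  case (Suc m)
  interpret mu: weights C \<mu> by fact
  interpret nu: weights C \<nu> by fact
  let ?d = "\<Sum>c\<in>C. \<bar>\<mu> c - \<nu> c\<bar>"
  define x where "x = (\<lambda>c. list_expect C \<mu> m (\<lambda>l. \<phi> (c # l)))"
  define y where "y = (\<lambda>c. list_expect C \<nu> m (\<lambda>l. \<phi> (c # l)))"
  have xy: "\<bar>x c - y c\<bar> \<le> m * ?d" for c unfolding x_def y_def by (rule Suc.IH) (use Suc.prems in auto)
  have y: "\<bar>y c\<bar> \<le> 1" for c
    using nu.LE_nonneg[of m "\<lambda>l. \<phi> (c # l)"] nu.LE_le_1[of m "\<lambda>l. \<phi> (c # l)"] Suc.prems by (simp add: y_def)
  have "list_expect C \<mu> (Suc m) \<phi> - list_expect C \<nu> (Suc m) \<phi> = (\<Sum>c\<in>C. \<mu> c * (x c - y c) + (\<mu> c - \<nu> c) * y c)"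
    by (simp add: x_def y_def sum_subtractf[symmetric] algebra_simps)
  also have "\<bar>\<dots>\<bar> \<le> (\<Sum>c\<in>C. \<bar>\<mu> c * (x c - y c) + (\<mu> c - \<nu> c) * y c\<bar>)" by (rule sum_abs)
  also have "\<dots> \<le> (\<Sum>c\<in>C. \<mu> c * (m * ?d) + \<bar>\<mu> c - \<nu> c\<bar> * 1)"
  proof (rule sum_mono)
    fix c assume c: "c \<in> C"
    have "\<bar>\<mu> c * (x c - y c) + (\<mu> c - \<nu> c) * y c\<bar> \<le> \<bar>\<mu> c * (x c - y c)\<bar> + \<bar>(\<mu> c - \<nu> c) * y c\<bar>" by (rule abs_triangle_ineq)
    also have "\<dots> \<le> \<mu> c * (m * ?d) + \<bar>\<mu> c - \<nu> c\<bar> * 1"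
      using xy y mu.nonneg[OF c] unfolding abs_mult by (intro add_mono mult_mono) auto
    finally show "\<bar>\<mu> c * (x c - y c) + (\<mu> c - \<nu> c) * y c\<bar> \<le> \<mu> c * (m * ?d) + \<bar>\<mu> c - \<nu> c\<bar> * 1" .
  qed
  also have "\<dots> = sum \<mu> C * (m * ?d) + ?d" by (simp only: sum.distrib sum_distrib_right mult_1_right)
  finally show ?case by (simp add: mu.sum1 algebra_simps)
qed simp

lemma list_expect_map:
  assumes "finite C" "finite C'" "g ` C \<subseteq> C'"
  shows "list_expect C \<mu> m (\<lambda>l. \<phi> (map g l)) = list_expect C' (\<lambda>c'. \<Sum>c\<in>{c \<in> C. g c = c'}. \<mu> c) m \<phi>"
proof (induction m arbitrary: \<phi>)
  case (Suc m)
  have "list_expect C \<mu> (Suc m) (\<lambda>l. \<phi> (map g l))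
      = (\<Sum>c\<in>C. \<mu> c * list_expect C' (\<lambda>c'. \<Sum>c\<in>{c \<in> C. g c = c'}. \<mu> c) m (\<lambda>l. \<phi> (g c # l)))"
    using Suc.IH[of "\<lambda>l. \<phi> (g c # l)" for c] by simp
  also have "\<dots> = (\<Sum>c'\<in>C'. \<Sum>c\<in>{c \<in> C. g c = c'}. \<mu> c * list_expect C' (\<lambda>c'. \<Sum>c\<in>{c \<in> C. g c = c'}. \<mu> c) m (\<lambda>l. \<phi> (g c # l)))"
    using assms by (intro sum.group[symmetric])
  also have "\<dots> = (\<Sum>c'\<in>C'. (\<Sum>c\<in>{c \<in> C. g c = c'}. \<mu> c) * list_expect C' (\<lambda>c'. \<Sum>c\<in>{c \<in> C. g c = c'}. \<mu> c) m (\<lambda>l. \<phi> (c' # l)))"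
    by (simp add: sum_distrib_right)
  finally show ?case by simp
qed simp

section \<open>Binomial tails of fair coins\<close>

definition trues :: "bool list \<Rightarrow> nat" where "trues l = length (filter id l)"

lemma trues_simps [simp]: "trues [] = 0" "trues (b # l) = of_bool b + trues l"
  by (auto simp: trues_def)

definition binomial_tail :: "nat \<Rightarrow> nat \<Rightarrow> real" where
  "binomial_tail a T = (\<Sum>j=T..a. real (a choose j)) / 2 ^ a"

lemma binomial_tail_Suc:
  "binomial_tail (Suc a) T = (binomial_tail a (T - 1) + binomial_tail a T) / 2"
proof -
  have A: "(\<Sum>j=T..Suc a. real (Suc a choose j)) = (\<Sum>j=T-1..a. real (a choose j)) + (\<Sum>j=T..a. real (a choose j))"
  proof (cases T)
    case 0
    have "(\<Sum>j=0..m. real (m choose j)) = 2 ^ m" for m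
      using choose_row_sum[of m] by (simp add: atLeast0AtMost flip: of_nat_sum)
    then show ?thesis using 0 by (simp del: sum.cl_ivl_Suc)
  next
    case (Suc U)
    have "(\<Sum>j=T..Suc a. real (Suc a choose j)) = (\<Sum>j=U..a. real (Suc a choose Suc j))"
      unfolding Suc by (rule sum.shift_bounds_cl_Suc_ivl)
    also have "\<dots> = (\<Sum>j=U..a. real (a choose j)) + (\<Sum>j=U..a. real (a choose Suc j))"
      by (simp add: sum.distrib add.commute)
    also have "(\<Sum>j=U..a. real (a choose Suc j)) = (\<Sum>j=Suc U..Suc a. real (a choose j))"
      by (rule sum.shift_bounds_cl_Suc_ivl[symmetric])
    also have "\<dots> = (\<Sum>j=Suc U..a. real (a choose j))"
      by (intro sum.mono_neutral_right) (auto simp: not_le binomial_eq_0)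
    finally show ?thesis using Suc by simp
  qed
  show ?thesis unfolding binomial_tail_def A by (simp add: field_simps)
qed

lemma binomial_tail_bounds: "0 \<le> binomial_tail a T" "binomial_tail a T \<le> 1"
proof -
  show "0 \<le> binomial_tail a T" by (simp add: binomial_tail_def sum_nonneg)
  have "(\<Sum>j=T..a. real (a choose j)) \<le> (\<Sum>j\<le>a. real (a choose j))" by (intro sum_mono2) auto
  also have "\<dots> = 2 ^ a" using choose_row_sum[of a] by (simp flip: of_nat_sum)
  finally show "binomial_tail a T \<le> 1" by (simp add: binomial_tail_def)
qed

text \<open>Given at least \<open>T\<close> heads among \<open>a\<close> tosses, a fixed toss is
  heads with probability at least T/a. In formulas, T (a choose j) <= j (a choose j) = a (a - 1
  choose j - 1) for j >= T.\<close>

lemma binomial_tail_absorb: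
  assumes "1 \<le> T" "1 \<le> a"
  shows "2 * real T / real a * binomial_tail a T \<le> binomial_tail (a - 1) (T - 1)"
proof -
  obtain b U where ab: "a = Suc b" "T = Suc U" using assms by (metis Suc_le_D One_nat_def)
  have "real T * (\<Sum>j=T..a. real (a choose j)) \<le> (\<Sum>j=T..a. real j * real (a choose j))"
    unfolding sum_distrib_left by (intro sum_mono mult_right_mono) auto
  also have "\<dots> = (\<Sum>j=U..b. real (Suc j) * real (Suc b choose Suc j))"
    unfolding ab by (rule sum.shift_bounds_cl_Suc_ivl)
  also have "\<dots> = (\<Sum>j=U..b. real a * real (b choose j))"
    unfolding ab of_nat_mult[symmetric] by (intro sum.cong refl) (simp only: Suc_times_binomial_eq mult.commute)
  also have "\<dots> = real a * (\<Sum>j=U..b. real (b choose j))" by (simp only: sum_distrib_left)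
  finally have "real T * (\<Sum>j=T..a. real (a choose j)) \<le> real a * (\<Sum>j=U..b. real (b choose j))" .
  then have le: "real T * (\<Sum>j=T..a. real (a choose j)) \<le> real a * (\<Sum>j=T-1..a-1. real ((a-1) choose j))"
    by (simp only: ab diff_Suc_1)
  have "2 * real T / real a * binomial_tail a T = real T * (\<Sum>j=T..a. real (a choose j)) / (real a * 2 ^ (a - 1))"
    using assms power_eq_if[of "2::real" a] by (simp add: binomial_tail_def)
  also have "\<dots> \<le> real a * (\<Sum>j=T-1..a-1. real ((a-1) choose j)) / (real a * 2 ^ (a - 1))"
    by (intro divide_right_mono le) auto
  also have "\<dots> = binomial_tail (a - 1) (T - 1)" using assms by (simp add: binomial_tail_def)
  finally show ?thesis .
qed

lemma fair_coin_tail: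
  "list_expect UNIV (\<lambda>_. 1/2) a (\<lambda>l. of_bool (T \<le> trues l)) = binomial_tail a T"
proof (induction a arbitrary: T)
  case 0
  then show ?case by (cases T) (auto simp: binomial_tail_def)
next
  case (Suc a)
  have "(\<lambda>l. of_bool (T \<le> trues (True # l))) = (\<lambda>l. of_bool (T - 1 \<le> trues l) :: real)"
    "(\<lambda>l. of_bool (T \<le> trues (False # l))) = (\<lambda>l. of_bool (T \<le> trues l) :: real)"
    by (simp_all add: le_diff_conv)
  then have "list_expect UNIV (\<lambda>_. 1/2) (Suc a) (\<lambda>l. of_bool (T \<le> trues l))
     = 1/2 * list_expect UNIV (\<lambda>_. 1/2) a (\<lambda>l. of_bool (T \<le> trues l))
     + 1/2 * list_expect UNIV (\<lambda>_. 1/2) a (\<lambda>l. of_bool (T - 1 \<le> trues l))"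
    unfolding list_expect.simps by (subst (1) UNIV_bool) simp
  then show ?case unfolding Suc.IH binomial_tail_Suc by simp
qed

lemma list_expect_pair_product:
  fixes C :: "'c set" and D :: "'d set"
  assumes "finite C" "finite D"
  shows "list_expect (C \<times> D) (\<lambda>(c, d). \<mu> c * \<nu> d) m (\<lambda>l. f (map fst l) * g (map snd l))
     = list_expect C \<mu> m f * list_expect D \<nu> m g"
proof (induction m arbitrary: f g)
  case (Suc m)
  have "list_expect (C \<times> D) (\<lambda>(c, d). \<mu> c * \<nu> d) (Suc m) (\<lambda>l. f (map fst l) * g (map snd l))
     = (\<Sum>c\<in>C. \<Sum>d\<in>D. \<mu> c * \<nu> d * (list_expect C \<mu> m (\<lambda>l. f (c # l)) * list_expect D \<nu> m (\<lambda>l. g (d # l))))"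
    using Suc.IH[of "\<lambda>l. f (c # l)" "\<lambda>l. g (d # l)" for c d]
    by (simp add: sum.cartesian_product case_prod_unfold)
  also have "\<dots> = (\<Sum>c\<in>C. \<Sum>d\<in>D. (\<mu> c * list_expect C \<mu> m (\<lambda>l. f (c # l))) * (\<nu> d * list_expect D \<nu> m (\<lambda>l. g (d # l))))"
    by (simp add: mult_ac)
  also have "\<dots> = list_expect C \<mu> (Suc m) f * list_expect D \<nu> (Suc m) g"
    by (simp add: sum_product)
  finally show ?case .
qed simp

lemma fair_coin_pair_tail:
  "list_expect UNIV (\<lambda>_. 1/4) a (\<lambda>l. of_bool (T \<le> trues (map fst l)) * of_bool (T \<le> trues (map snd l)))
     = (binomial_tail a T)\<^sup>2"
  using list_expect_pair_product[of "UNIV :: bool set" "UNIV :: bool set" "\<lambda>_. 1/2" "\<lambda>_. 1/2" a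
      "\<lambda>l. of_bool (T \<le> trues l)" "\<lambda>l. of_bool (T \<le> trues l)"]
  by (simp add: fair_coin_tail power2_eq_square case_prod_unfold)

section \<open>Independent vertex sampling\<close>

lemma weights_uniform: "0 < n \<Longrightarrow> weights {..<n} (\<lambda>_. 1 / real n)"
  by unfold_locales auto

lemma weights_bool: "weights (UNIV :: bool set) (\<lambda>_. 1/2)"
  by unfold_locales (auto simp: UNIV_bool)

lemma weights_bool2: "weights (UNIV :: (bool \<times> bool) set) (\<lambda>_. 1/4)"
  by unfold_locales (auto simp: card_UNIV_bool)

text \<open>With signs instead of bits, deviations from fair coins become character sums, whose
  second moments over random graphs follow from orthogonality.\<close>

definition chi :: "bool \<Rightarrow> real" where "chi b = (if b then 1 else -1)"

lemma chi_simps [simp]: "chi True = 1" "chi False = -1" "chi b * chi b = 1" "\<bar>chi b\<bar> = 1"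
  by (auto simp: chi_def)

text \<open>In both sums below, \<open>x = v\<close> contributes as a non-neighbour of \<open>v\<close>, since \<open>{v, v}\<close> is not an edge.\<close>

definition nbr_sum :: "nat \<Rightarrow> nat set set \<Rightarrow> nat \<Rightarrow> real" where
  "nbr_sum n E v = (\<Sum>x<n. chi ({x, v} \<in> E))"

definition conbr_sum :: "nat \<Rightarrow> nat set set \<Rightarrow> nat \<Rightarrow> nat \<Rightarrow> real" where
  "conbr_sum n E u v = (\<Sum>x<n. chi ({x, u} \<in> E) * chi ({x, v} \<in> E))"

definition degree_into :: "nat set set \<Rightarrow> nat \<Rightarrow> nat list \<Rightarrow> nat" where
  "degree_into E v xs = trues (map (\<lambda>x. {x, v} \<in> E) xs)"

lemma degree_into_simps [simp]:
  "degree_into E v [] = 0"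
  "degree_into E v (x # xs) = of_bool ({x, v} \<in> E) + degree_into E v xs"
  by (auto simp: degree_into_def)

lemma weights_pushforward:
  assumes "weights C \<mu>" "finite C'" "g ` C \<subseteq> C'"
  shows "weights C' (\<lambda>c'. \<Sum>c\<in>{c \<in> C. g c = c'}. \<mu> c)"
proof -
  interpret weights C \<mu> by fact
  show ?thesis
  proof
    show "(\<Sum>c'\<in>C'. \<Sum>c\<in>{c \<in> C. g c = c'}. \<mu> c) = 1"
      using sum.group[OF finite_C assms(2,3), of \<mu>] sum1 by simp
  qed (use assms nonneg in \<open>auto intro!: sum_nonneg\<close>)
qed

locale sampling =
  fixes n :: nat and E :: "nat set set"
  assumes n_pos: "0 < n" and E: "E \<subseteq> vertex_pairs {..<n}"
begin

sublocale X: weights "{..<n}" "\<lambda>_. 1 / real n"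
  by (rule weights_uniform[OF n_pos])

abbreviation EV where "EV \<equiv> list_expect {..<n} (\<lambda>_. 1 / real n)"

abbreviation hit :: "nat \<Rightarrow> nat \<Rightarrow> nat list \<Rightarrow> real" where
  "hit T v xs \<equiv> of_bool (T \<le> degree_into E v xs)"

abbreviation mem :: "nat \<Rightarrow> nat list \<Rightarrow> real" where
  "mem v xs \<equiv> of_bool (v \<in> set xs)"

text \<open>Whether a random sample is a neighbour of \<open>v\<close> is a coin at L1 distance
  |\<open>nbr_sum\<close>|/n from a fair one, so \<open>list_expect_hybrid\<close> applies.\<close>

lemma prob_degree_ge:
  "\<bar>EV a (hit T v) - binomial_tail a T\<bar> \<le> a * (\<bar>nbr_sum n E v\<bar> / n)"
proof -
  let ?g = "\<lambda>x. {x, v} \<in> E"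
  let ?\<nu> = "\<lambda>b. \<Sum>c\<in>{c \<in> {..<n}. ?g c = b}. 1 / real n"
  have "EV a (hit T v) = list_expect UNIV ?\<nu> a (\<lambda>l. of_bool (T \<le> trues l))"
    unfolding degree_into_def
    by (rule list_expect_map[where \<phi> = "\<lambda>l. of_bool (T \<le> trues l)"]) auto
  moreover have "\<bar>list_expect UNIV ?\<nu> a (\<lambda>l. of_bool (T \<le> trues l)) - binomial_tail a T\<bar> \<le> a * (\<Sum>b\<in>UNIV. \<bar>?\<nu> b - 1/2\<bar>)"
    unfolding fair_coin_tail[symmetric]
    by (rule list_expect_hybrid[OF weights_pushforward[OF weights_uniform[OF n_pos]] weights_bool]) auto
  moreover have "?\<nu> b - 1/2 = chi b * nbr_sum n E v / (2 * n)" for b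
  proof -
    have "?\<nu> b = (\<Sum>x<n. of_bool (?g x = b) / real n)"
      by (subst sum.inter_filter) (auto intro!: sum.cong)
    \<comment> \<open>The indicator of b = b' is (1 + \<open>chi b * chi b'\<close>)/2.\<close>
    also have "\<dots> = (\<Sum>x<n. (1 + chi b * chi (?g x)) / 2 / real n)"
      by (intro sum.cong refl arg_cong2[of _ _ _ _ "(/)"]) (auto simp: chi_def)
    also have "\<dots> = (real n + chi b * nbr_sum n E v) / 2 / real n"
      unfolding nbr_sum_def by (simp add: sum_divide_distrib[symmetric] sum.distrib sum_distrib_left[symmetric])
    finally show ?thesis using n_pos by (simp add: field_simps)
  qed
  moreover from calculation have "(\<Sum>b\<in>UNIV. \<bar>?\<nu> b - 1/2\<bar>) = \<bar>nbr_sum n E v\<bar> / n"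
    by (simp only: UNIV_bool sum.insert finite.intros) (simp add: abs_mult)
  ultimately show ?thesis by (simp only:)
qed

text \<open>Now two bits per sample are compared with independent fair bits. Besides the two single
  biases, the third nontrivial character of a pair of bits contributes
  \<open>conbr_sum\<close>.\<close>

lemma prob_two_degrees_ge:
  "\<bar>EV a (\<lambda>xs. hit T u xs * hit T v xs) - (binomial_tail a T)\<^sup>2\<bar>
    \<le> a * ((\<bar>nbr_sum n E u\<bar> + \<bar>nbr_sum n E v\<bar> + \<bar>conbr_sum n E u v\<bar>) / n)"
proof -
  let ?g = "\<lambda>x. ({x, u} \<in> E, {x, v} \<in> E)"
  let ?\<nu> = "\<lambda>b. \<Sum>c\<in>{c \<in> {..<n}. ?g c = b}. 1 / real n"
  let ?\<phi> = "\<lambda>l. of_bool (T \<le> trues (map fst l)) * of_bool (T \<le> trues (map snd l))"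
  have "EV a (\<lambda>xs. hit T u xs * hit T v xs) = list_expect UNIV ?\<nu> a ?\<phi>"
    by (subst list_expect_map[where \<phi> = ?\<phi>, symmetric]) (auto simp: degree_into_def comp_def)
  moreover have "\<bar>list_expect UNIV ?\<nu> a ?\<phi> - (binomial_tail a T)\<^sup>2\<bar> \<le> a * (\<Sum>b\<in>UNIV. \<bar>?\<nu> b - 1/4\<bar>)"
    unfolding fair_coin_pair_tail[symmetric]
    by (rule list_expect_hybrid[OF weights_pushforward[OF weights_uniform[OF n_pos]] weights_bool2]) auto
  moreover have "(\<Sum>b\<in>UNIV. \<bar>?\<nu> b - 1/4\<bar>) \<le> (\<bar>nbr_sum n E u\<bar> + \<bar>nbr_sum n E v\<bar> + \<bar>conbr_sum n E u v\<bar>) / n"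
  proof -
    have "\<bar>?\<nu> b - 1/4\<bar> \<le> (\<bar>nbr_sum n E u\<bar> + \<bar>nbr_sum n E v\<bar> + \<bar>conbr_sum n E u v\<bar>) / (4 * n)" for b
    proof -
      obtain b1 b2 where b: "b = (b1, b2)" by (cases b)
      have "?\<nu> b = (\<Sum>x<n. of_bool (?g x = b) / real n)"
        by (subst sum.inter_filter) (auto intro!: sum.cong)
      also have "\<dots> = (\<Sum>x<n. (1 + chi b1 * chi ({x, u} \<in> E) + chi b2 * chi ({x, v} \<in> E)
           + (chi b1 * chi b2) * (chi ({x, u} \<in> E) * chi ({x, v} \<in> E))) / 4 / real n)"
        by (intro sum.cong refl arg_cong2[of _ _ _ _ "(/)"]) (auto simp: chi_def b)
      also have "\<dots> = (real n + chi b1 * nbr_sum n E u + chi b2 * nbr_sum n E v + (chi b1 * chi b2) * conbr_sum n E u v) / 4 / real n"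
        unfolding nbr_sum_def conbr_sum_def sum_divide_distrib[symmetric] sum.distrib sum_distrib_left[symmetric] by simp
      finally have "?\<nu> b - 1/4 = (chi b1 * nbr_sum n E u + chi b2 * nbr_sum n E v + (chi b1 * chi b2) * conbr_sum n E u v) / (4 * n)"
        using n_pos by (simp add: field_simps)
      moreover have "\<bar>chi b1 * nbr_sum n E u + chi b2 * nbr_sum n E v + (chi b1 * chi b2) * conbr_sum n E u v\<bar>
          \<le> \<bar>nbr_sum n E u\<bar> + \<bar>nbr_sum n E v\<bar> + \<bar>conbr_sum n E u v\<bar>"
        by (auto simp: chi_def)
      ultimately show ?thesis using n_pos by (simp add: divide_right_mono)
    qed
    then have "(\<Sum>b\<in>UNIV. \<bar>?\<nu> b - 1/4\<bar>) \<le> (\<Sum>b\<in>(UNIV :: (bool \<times> bool) set). (\<bar>nbr_sum n E u\<bar> + \<bar>nbr_sum n E v\<bar> + \<bar>conbr_sum n E u v\<bar>) / (4 * n))"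
      by (intro sum_mono)
    also have "\<dots> = (\<bar>nbr_sum n E u\<bar> + \<bar>nbr_sum n E v\<bar> + \<bar>conbr_sum n E u v\<bar>) / n"
      using n_pos by (simp add: card_UNIV_bool field_simps)
    finally show ?thesis .
  qed
  ultimately show ?thesis by (smt (verit) mult_left_mono of_nat_0_le_iff)
qed

text \<open>Multiplicity is additive over the draws, which membership is not, so its expectations
  are exact. The two differ by repeated samples, which \<open>EV_occ_excess\<close>
  controls.\<close>

definition occ :: "nat \<Rightarrow> nat list \<Rightarrow> real" where "occ u xs = (\<Sum>x\<leftarrow>xs. of_bool (x = u))"

lemma occ_simps [simp]: "occ u [] = 0" "occ u (x # xs) = of_bool (x = u) + occ u xs"
  by (auto simp: occ_def)

lemma occ_cases: "occ u xs = 0 \<and> u \<notin> set xs \<or> 1 \<le> occ u xs \<and> u \<in> set xs"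
  by (induction xs) auto

lemma sum_occ: "set xs \<subseteq> {..<n} \<Longrightarrow> (\<Sum>u<n. mem u xs) \<le> real (length xs)"
proof -
  assume "set xs \<subseteq> {..<n}"
  then have "(\<Sum>u<n. mem u xs) = real (card (set xs))"
    by (simp add: of_bool_def sum.If_cases Int_absorb1)
  then show ?thesis using card_length[of xs] by simp
qed

lemma avg_delta: "u < n \<Longrightarrow> (\<Sum>c<n. 1 / real n * of_bool (c = u)) = 1 / n"
  by (simp add: of_bool_def if_distrib[of "\<lambda>x. x / _"] cong: if_cong)

lemma EV_occ_mult:
  assumes "u < n" "v < n" "u \<noteq> v"
  shows "EV a (\<lambda>xs. occ u xs * occ v xs) = real a * (real a - 1) / (real n)\<^sup>2"
proof -
  have "(\<Sum>c<n. 1 / real n * (of_bool (c = u) * of_bool (c = v))) = 0"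
    using assms(3) by (intro sum.neutral) auto
  then show ?thesis
    unfolding occ_def X.LE_sum_list_mult avg_delta[OF assms(1)] avg_delta[OF assms(2)]
    by (simp add: power2_eq_square)
qed

lemma EV_occ_excess:
  assumes "u < n"
  shows "EV a (\<lambda>xs. occ u xs * occ u xs - occ u xs) = real a * (real a - 1) / (real n)\<^sup>2"
proof -
  have "(\<Sum>c<n. 1 / real n * (of_bool (c = u) * of_bool (c = u))) = (\<Sum>c<n. 1 / real n * of_bool (c = u))"
    by (intro sum.cong) auto
  then show ?thesis
    unfolding X.LE_diff unfolding occ_def X.LE_sum_list_mult X.LE_sum_list avg_delta[OF assms]
    by (simp add: power2_eq_square avg_delta[OF assms])
qed

lemma EV_occ: "u < n \<Longrightarrow> EV a (\<lambda>xs. occ u xs) = real a / real n"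
  unfolding occ_def X.LE_sum_list by (simp only: avg_delta) simp

text \<open>The source of the bias: a sample known to equal \<open>u\<close> lowers the threshold for \<open>v\<close> by one exactly if
  \<open>u\<close> is a neighbour of \<open>v\<close>.\<close>

lemma EV_occ_degree:
  assumes "u < n"
  shows "EV (Suc a) (\<lambda>xs. occ u xs * hit T v xs)
     = real (Suc a) / n * EV a (\<lambda>xs. of_bool (T \<le> of_bool ({u, v} \<in> E) + degree_into E v xs))"
proof (induction a arbitrary: T)
  case 0
  let ?d = "\<lambda>y. of_bool ({y, v} \<in> E) :: nat"
  have "EV (Suc 0) (\<lambda>xs. occ u xs * hit T v xs)
      = (\<Sum>y<n. if y = u then 1 / n * of_bool (T \<le> ?d u) else 0)"
    unfolding list_expect.simps by (intro sum.cong) auto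
  then show ?case using assms by simp
next
  case (Suc a)
  let ?d = "\<lambda>y. of_bool ({y, v} \<in> E) :: nat"
  \<comment> \<open>The first draw only shifts the threshold, so the induction hypothesis applies at
    \<open>T - ?d y\<close>. Truncation at 0 is harmless, since a threshold 0 is always met.\<close>
  have shift: "of_bool (T \<le> ?d y + k) = (of_bool (T - ?d y \<le> k) :: real)" for y k T by auto
  have "EV (Suc (Suc a)) (\<lambda>xs. occ u xs * hit T v xs)
    = (\<Sum>y<n. 1/n * (of_bool (y = u) * EV (Suc a) (\<lambda>xs. of_bool (T \<le> ?d y + degree_into E v xs))))
      + (\<Sum>y<n. 1/n * EV (Suc a) (\<lambda>xs. occ u xs * of_bool (T \<le> ?d y + degree_into E v xs)))"
    by (subst list_expect.simps(2)) (simp only: occ_simps degree_into_simps distrib_right distrib_left X.LE_add X.LE_cmult sum.distrib)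
  also have "(\<Sum>y<n. 1/n * (of_bool (y = u) * EV (Suc a) (\<lambda>xs. of_bool (T \<le> ?d y + degree_into E v xs))))
    = 1/n * EV (Suc a) (\<lambda>xs. of_bool (T \<le> ?d u + degree_into E v xs))"
  proof -
    have "(\<Sum>y<n. 1/n * (of_bool (y = u) * EV (Suc a) (\<lambda>xs. of_bool (T \<le> ?d y + degree_into E v xs))))
      = (\<Sum>y<n. if y = u then 1/n * EV (Suc a) (\<lambda>xs. of_bool (T \<le> ?d u + degree_into E v xs)) else 0)"
      by (intro sum.cong) (auto simp del: list_expect.simps)
    then show ?thesis using assms by (simp del: list_expect.simps)
  qed
  also have "(\<Sum>y<n. 1/n * EV (Suc a) (\<lambda>xs. occ u xs * of_bool (T \<le> ?d y + degree_into E v xs)))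
     = (\<Sum>y<n. 1/n * (real (Suc a) / n * EV a (\<lambda>xs. of_bool (T \<le> ?d u + (?d y + degree_into E v xs)))))"
  proof (intro sum.cong refl arg_cong2[of _ _ _ _ "(*)"])
    fix y
    have "EV (Suc a) (\<lambda>xs. occ u xs * of_bool (T \<le> ?d y + degree_into E v xs))
       = EV (Suc a) (\<lambda>xs. occ u xs * of_bool (T - ?d y \<le> degree_into E v xs))"
      unfolding shift ..
    also have "\<dots> = real (Suc a) / n * EV a (\<lambda>xs. of_bool (T - ?d y \<le> ?d u + degree_into E v xs))"
      by (rule Suc.IH)
    also have "(\<lambda>xs. of_bool (T - ?d y \<le> ?d u + degree_into E v xs)) = (\<lambda>xs. of_bool (T \<le> ?d u + (?d y + degree_into E v xs)) :: real)"
      by (intro ext) auto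
    finally show "EV (Suc a) (\<lambda>xs. occ u xs * of_bool (T \<le> ?d y + degree_into E v xs))
       = real (Suc a) / n * EV a (\<lambda>xs. of_bool (T \<le> ?d u + (?d y + degree_into E v xs)))" .
  qed
  also have "\<dots> = real (Suc a) / n * EV (Suc a) (\<lambda>xs. of_bool (T \<le> ?d u + degree_into E v xs))"
    by (simp add: sum_distrib_left mult_ac)
  finally show ?case using n_pos by (simp add: field_simps del: list_expect.simps)
qed

text \<open>Inclusion-exclusion for the event that two given vertices are both sampled. The value
  depends neither on the pair nor on the graph.\<close>

definition both_prob :: "nat \<Rightarrow> real" where
  "both_prob a = 1 - 2 * (1 - 1 / n) ^ a + (1 - 2 / n) ^ a"

lemma EV_both_mem:
  assumes "u < n" "v < n" "u \<noteq> v"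
  shows "EV a (\<lambda>xs. mem u xs * mem v xs) = both_prob a"
proof -
  have nm: "1 - mem w xs = (\<Prod>x\<leftarrow>xs. of_bool (x \<noteq> w) :: real)" for w xs
    by (induction xs) auto
  have pm: "(\<Prod>x\<leftarrow>xs. f x) * (\<Prod>x\<leftarrow>xs. g x) = (\<Prod>x\<leftarrow>xs. f x * g x)" for f g :: "nat \<Rightarrow> real" and xs
    by (induction xs) (auto simp: mult_ac)
  have "mem u xs * mem v xs
      = 1 - (\<Prod>x\<leftarrow>xs. of_bool (x \<noteq> u)) - (\<Prod>x\<leftarrow>xs. of_bool (x \<noteq> v)) + (\<Prod>x\<leftarrow>xs. of_bool (x \<noteq> u) * of_bool (x \<noteq> v) :: real)" for xs
    unfolding pm[symmetric] nm[symmetric] by (simp add: algebra_simps)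
  then have "EV a (\<lambda>xs. mem u xs * mem v xs)
      = 1 - (\<Sum>c<n. 1/n * of_bool (c \<noteq> u)) ^ a - (\<Sum>c<n. 1/n * of_bool (c \<noteq> v)) ^ a
        + (\<Sum>c<n. 1/n * (of_bool (c \<noteq> u) * of_bool (c \<noteq> v))) ^ a"
    by (simp only: X.LE_add X.LE_diff X.LE_const X.LE_prod_list)
  moreover have nw: "(\<Sum>c<n. 1/n * of_bool (c \<noteq> w)) = 1 - 1/n" if "w < n" for w
  proof -
    have "(\<Sum>c<n. 1/n * of_bool (c \<noteq> w)) = (\<Sum>c<n. 1/n - 1/n * of_bool (c = w))" by (intro sum.cong) auto
    then show ?thesis using that n_pos by (simp only: sum_subtractf avg_delta) simp
  qed
  moreover have "(\<Sum>c<n. 1/n * (of_bool (c \<noteq> u) * of_bool (c \<noteq> v))) = 1 - 2/n"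
  proof -
    have "(\<Sum>c<n. 1/n * (of_bool (c \<noteq> u) * of_bool (c \<noteq> v))) = (\<Sum>c<n. 1/n - 1/n * of_bool (c = u) - 1/n * of_bool (c = v))"
      using assms(3) by (intro sum.cong) auto
    then show ?thesis using assms n_pos by (simp only: sum_subtractf avg_delta) simp
  qed
  ultimately show ?thesis unfolding both_prob_def by (simp only: nw[OF assms(1)] nw[OF assms(2)])
qed

lemma both_prob_bounds:
  assumes "2 \<le> n"
  shows "0 \<le> both_prob a" "both_prob a \<le> (real a / n)\<^sup>2"
proof -
  have eq: "EV a (\<lambda>xs. mem 0 xs * mem 1 xs) = both_prob a"
    using assms by (intro EV_both_mem) auto
  show "0 \<le> both_prob a" unfolding eq[symmetric] by (intro X.LE_nonneg) auto
  have "both_prob a \<le> EV a (\<lambda>xs. occ 0 xs * occ 1 xs)"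
    unfolding eq[symmetric]
  proof (intro X.LE_mono mult_mono)
    fix xs
    show "mem 0 xs \<le> occ 0 xs" "mem 1 xs \<le> occ 1 xs" "0 \<le> occ 0 xs"
      using occ_cases[of 0 xs] occ_cases[of 1 xs] by auto
  qed auto
  also have "\<dots> = real a * (real a - 1) / (real n)\<^sup>2" using assms by (intro EV_occ_mult) auto
  also have "\<dots> \<le> (real a / n)\<^sup>2"
    by (simp add: power_divide power2_eq_square divide_right_mono mult_left_mono)
  finally show "both_prob a \<le> (real a / n)\<^sup>2" .
qed

end

section \<open>Independent inclusion\<close>

definition incl :: "'a set \<Rightarrow> ('a \<Rightarrow> real) \<Rightarrow> 'a set \<Rightarrow> real" where
  "incl V \<pi> A = (\<Prod>v\<in>V. if v \<in> A then \<pi> v else 1 - \<pi> v)"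

lemma sum_incl:
  assumes "finite V" "B \<subseteq> V"
  shows "(\<Sum>A\<in>Pow V. incl V \<pi> A * of_bool (B \<subseteq> A)) = (\<Prod>v\<in>B. \<pi> v)"
proof -
  define h where "h = (\<lambda>v b. if b then \<pi> v else if v \<in> B then 0 else 1 - \<pi> v)"
  have "incl V \<pi> A * of_bool (B \<subseteq> A) = (\<Prod>v\<in>V. h v (v \<in> A))" for A
  proof (cases "B \<subseteq> A")
    case True
    then show ?thesis unfolding incl_def by (auto simp: h_def intro!: prod.cong)
  next
    case False
    then obtain v where "v \<in> B" "v \<notin> A" by blast
    then have "(\<Prod>v\<in>V. h v (v \<in> A)) = 0"
      using assms by (intro prod_zero) (auto simp: h_def)
    then show ?thesis using False by simp
  qed
  then have "(\<Sum>A\<in>Pow V. incl V \<pi> A * of_bool (B \<subseteq> A)) = (\<Prod>v\<in>V. h v True + h v False)"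
    using sum_Pow_prod[OF assms(1), of h] by simp
  also have "\<dots> = (\<Prod>v\<in>V. if v \<in> B then \<pi> v else 1)"
    by (intro prod.cong) (auto simp: h_def)
  also have "\<dots> = (\<Prod>v\<in>B. \<pi> v)"
    using assms by (simp add: prod.If_cases Int_absorb1)
  finally show ?thesis .
qed

lemma incl_nonneg:
  "(\<And>v. v \<in> V \<Longrightarrow> 0 \<le> \<pi> v \<and> \<pi> v \<le> 1) \<Longrightarrow> 0 \<le> incl V \<pi> A"
  unfolding incl_def by (intro prod_nonneg) auto

lemma sum_incl_card_le:
  fixes \<pi> :: "'a \<Rightarrow> real"
  assumes V: "finite V" "B \<subseteq> V" and \<pi>: "\<And>v. v \<in> V \<Longrightarrow> 0 \<le> \<pi> v"
  shows "(\<Sum>A\<in>Pow V. incl V \<pi> A * of_bool (B \<subseteq> A) * card A) \<le> (\<Prod>v\<in>B. \<pi> v) * (card B + (\<Sum>v\<in>V. \<pi> v))"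
proof -
  have fB: "finite B" using V finite_subset by auto
  have p0: "0 \<le> (\<Prod>v\<in>B. \<pi> v)" using V \<pi> by (intro prod_nonneg) auto
  have "(\<Sum>A\<in>Pow V. incl V \<pi> A * of_bool (B \<subseteq> A) * card A)
      = (\<Sum>A\<in>Pow V. \<Sum>x\<in>V. incl V \<pi> A * of_bool (insert x B \<subseteq> A))"
  proof (rule sum.cong)
    fix A assume "A \<in> Pow V"
    then have "real (card A) = (\<Sum>x\<in>V. of_bool (x \<in> A))"
      using V(1) by (simp add: of_bool_def sum.If_cases Int_absorb1)
    then show "incl V \<pi> A * of_bool (B \<subseteq> A) * card A = (\<Sum>x\<in>V. incl V \<pi> A * of_bool (insert x B \<subseteq> A))"
      by (simp add: sum_distrib_left sum_distrib_right of_bool_conj mult_ac)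
  qed simp
  also have "\<dots> = (\<Sum>x\<in>V. \<Sum>A\<in>Pow V. incl V \<pi> A * of_bool (insert x B \<subseteq> A))" by (rule sum.swap)
  also have "\<dots> = (\<Sum>x\<in>V. \<Prod>v\<in>insert x B. \<pi> v)"
    using V by (intro sum.cong refl sum_incl) auto
  also have "\<dots> \<le> (\<Sum>x\<in>V. (\<Prod>v\<in>B. \<pi> v) * (of_bool (x \<in> B) + \<pi> x))"
  proof (rule sum_mono)
    fix x assume x: "x \<in> V"
    show "(\<Prod>v\<in>insert x B. \<pi> v) \<le> (\<Prod>v\<in>B. \<pi> v) * (of_bool (x \<in> B) + \<pi> x)"
      using fB p0 \<pi>[OF x] by (cases "x \<in> B") (auto simp: insert_absorb algebra_simps)
  qed
  also have "\<dots> = (\<Prod>v\<in>B. \<pi> v) * (card B + (\<Sum>v\<in>V. \<pi> v))"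
    using V by (simp add: sum_distrib_left[symmetric] sum.distrib of_bool_def sum.If_cases Int_absorb1)
  finally show ?thesis .
qed

section \<open>Biased random sets\<close>

text \<open>With one sample known, a neighbour lowers the threshold among the other a - 1 samples to
  T - 1 and a non-neighbour leaves it at T. The tail for \<open>a\<close> samples is the average of
  the two, so what the first case gains the second loses.\<close>

lemma binomial_tail_shifted:
  assumes "1 \<le> T" "1 \<le> a" "1 + 2 * \<delta> \<le> 2 * real T / real a"
  shows "(1 + 2 * \<delta>) * binomial_tail a T \<le> binomial_tail (a - 1) (T - 1)"
    and "binomial_tail (a - 1) T \<le> (1 - 2 * \<delta>) * binomial_tail a T"
proof -
  have "(1 + 2 * \<delta>) * binomial_tail a T \<le> 2 * real T / real a * binomial_tail a T"
    by (intro mult_right_mono assms binomial_tail_bounds)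
  then show 1: "(1 + 2 * \<delta>) * binomial_tail a T \<le> binomial_tail (a - 1) (T - 1)"
    using binomial_tail_absorb[OF assms(1,2)] by linarith
  have "2 * binomial_tail a T = binomial_tail (a - 1) (T - 1) + binomial_tail (a - 1) T"
    using binomial_tail_Suc[of "a - 1" T] assms(2) by simp
  with 1 show "binomial_tail (a - 1) T \<le> (1 - 2 * \<delta>) * binomial_tail a T"
    by (simp add: algebra_simps)
qed

context sampling
begin

definition W_size :: "nat \<Rightarrow> nat list \<Rightarrow> real" where
  "W_size T xs = (\<Sum>v<n. hit T v xs)"

definition balanced :: "real \<Rightarrow> nat \<Rightarrow> nat \<Rightarrow> bool" where
  "balanced D u v \<longleftrightarrow> \<bar>nbr_sum n E u\<bar> \<le> D \<and> \<bar>nbr_sum n E v\<bar> \<le> D \<and> \<bar>conbr_sum n E u v\<bar> \<le> D"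

lemma balanced_commute: "balanced D u v \<longleftrightarrow> balanced D v u"
  by (auto simp: balanced_def conbr_sum_def mult.commute)

definition unbalanced_pairs :: "real \<Rightarrow> (nat \<times> nat) set" where
  "unbalanced_pairs D = {(u, v) \<in> {..<n} \<times> {..<n}. \<not> balanced D u v}"

lemma finite_unbalanced_pairs [simp]: "finite (unbalanced_pairs D)"
  unfolding unbalanced_pairs_def by (rule finite_subset[of _ "{..<n} \<times> {..<n}"]) auto

lemma balanced_tail:
  fixes a b :: nat
  assumes "balanced D u v" "b \<le> a"
  shows "\<bar>EV b (hit T v) - binomial_tail b T\<bar> \<le> 3 * real a * D / n"
proof -
  have D: "\<bar>nbr_sum n E v\<bar> \<le> D" "0 \<le> D" using assms(1) by (auto simp: balanced_def)
  have "real b * (\<bar>nbr_sum n E v\<bar> / n) \<le> real a * (3 * D / n)"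
    using D assms(2) by (intro mult_mono divide_right_mono) auto
  then show ?thesis using prob_degree_ge[of b T v] by (simp add: mult_ac)
qed

lemma balanced_pair_tail:
  fixes a :: nat
  assumes "balanced D u v"
  shows "\<bar>EV a (\<lambda>xs. hit T u xs * hit T v xs) - (binomial_tail a T)\<^sup>2\<bar> \<le> 3 * real a * D / n"
proof -
  have D: "\<bar>nbr_sum n E u\<bar> \<le> D" "\<bar>nbr_sum n E v\<bar> \<le> D" "\<bar>conbr_sum n E u v\<bar> \<le> D"
    using assms(1) by (auto simp: balanced_def)
  have "real a * ((\<bar>nbr_sum n E u\<bar> + \<bar>nbr_sum n E v\<bar> + \<bar>conbr_sum n E u v\<bar>) / n) \<le> real a * (3 * D / n)"
    using D by (intro mult_left_mono divide_right_mono) auto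
  then show ?thesis using prob_two_degrees_ge[of a T u v] by (simp add: mult_ac)
qed

text \<open>For a balanced pair the two hits are nearly uncorrelated, and every other pair
  contributes at most 1. The diagonal is no special case: \<open>conbr_sum n E u u\<close> equals n,
  so (u, u) is unbalanced unless \<open>D\<close> is at least n.\<close>

lemma W_size_variance:
  fixes a T :: nat and D \<rho> e :: real
  defines "\<rho> \<equiv> binomial_tail a T" and "e \<equiv> 3 * real a * D / n"
  assumes "0 \<le> D"
  shows "EV a (\<lambda>xs. (W_size T xs - \<rho> * n)\<^sup>2) \<le> 3 * e * (real n)\<^sup>2 + card (unbalanced_pairs D)"
proof -
  have \<rho>: "0 \<le> \<rho>" "\<rho> \<le> 1" using binomial_tail_bounds[of a T] by (auto simp: \<rho>_def)
  have e0: "0 \<le> e" using assms by (simp add: e_def)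
  have each: "EV a (\<lambda>xs. (hit T u xs - \<rho>) * (hit T v xs - \<rho>)) \<le> 3 * e + of_bool ((u, v) \<in> unbalanced_pairs D)"
    if uv: "u < n" "v < n" for u v
  proof (cases "balanced D u v")
    case True
    have "EV a (\<lambda>xs. (hit T u xs - \<rho>) * (hit T v xs - \<rho>)) = EV a (\<lambda>xs. hit T u xs * hit T v xs - \<rho> * hit T u xs - \<rho> * hit T v xs + \<rho> * \<rho>)"
      by (simp add: algebra_simps)
    also have "\<dots> = EV a (\<lambda>xs. hit T u xs * hit T v xs) - \<rho> * EV a (hit T u) - \<rho> * EV a (hit T v) + \<rho> * \<rho>"
      by (simp only: X.LE_add X.LE_diff X.LE_cmult X.LE_const)
    also have "\<dots> \<le> (\<rho> * \<rho> + e) - \<rho> * (\<rho> - e) - \<rho> * (\<rho> - e) + \<rho> * \<rho>"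
    proof (intro add_mono diff_mono mult_left_mono \<rho>)
      show "EV a (\<lambda>xs. hit T u xs * hit T v xs) \<le> \<rho> * \<rho> + e"
        using balanced_pair_tail[OF True, of a T] by (simp add: \<rho>_def e_def power2_eq_square abs_le_iff)
      show "\<rho> - e \<le> EV a (hit T v)"
        using balanced_tail[OF True, of a a T] by (simp add: \<rho>_def e_def abs_le_iff)
      show "\<rho> - e \<le> EV a (hit T u)"
        using balanced_tail[OF True[unfolded balanced_commute[of D u]], of a a T] by (simp add: \<rho>_def e_def abs_le_iff)
    qed simp
    also have "\<dots> = e + 2 * (\<rho> * e)" by (simp add: algebra_simps)
    also have "\<dots> \<le> e + 2 * (1 * e)" using \<rho> e0 by (intro add_left_mono mult_left_mono mult_right_mono) auto
    finally show ?thesis by (simp add: add_increasing2)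
  next
    case False
    have "EV a (\<lambda>xs. (hit T u xs - \<rho>) * (hit T v xs - \<rho>)) \<le> 1"
    proof (rule X.LE_le_1)
      fix xs
      have "\<bar>hit T u xs - \<rho>\<bar> \<le> 1" "\<bar>hit T v xs - \<rho>\<bar> \<le> 1" using \<rho> by auto
      then have "\<bar>hit T u xs - \<rho>\<bar> * \<bar>hit T v xs - \<rho>\<bar> \<le> 1 * 1" by (intro mult_mono) auto
      then show "(hit T u xs - \<rho>) * (hit T v xs - \<rho>) \<le> 1" unfolding abs_mult[symmetric] by linarith
    qed
    moreover have "(u, v) \<in> unbalanced_pairs D" using False uv by (simp add: unbalanced_pairs_def)
    ultimately show ?thesis using e0 by simp
  qed
  have "W_size T xs - \<rho> * n = (\<Sum>v<n. hit T v xs - \<rho>)" for xs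
    by (simp add: W_size_def sum_subtractf)
  then have "EV a (\<lambda>xs. (W_size T xs - \<rho> * n)\<^sup>2) = (\<Sum>u<n. \<Sum>v<n. EV a (\<lambda>xs. (hit T u xs - \<rho>) * (hit T v xs - \<rho>)))"
    by (simp only: power2_eq_square sum_product X.LE_sum)
  also have "\<dots> \<le> (\<Sum>u<n. \<Sum>v<n. 3 * e + of_bool ((u, v) \<in> unbalanced_pairs D))"
    by (intro sum_mono each) auto
  also have "\<dots> = 3 * e * (real n)\<^sup>2 + (\<Sum>p\<in>{..<n} \<times> {..<n}. of_bool (p \<in> unbalanced_pairs D))"
  proof -
    have "(\<Sum>u<n. \<Sum>v<n. of_bool ((u, v) \<in> unbalanced_pairs D)) = (\<Sum>p\<in>{..<n} \<times> {..<n}. of_bool (p \<in> unbalanced_pairs D) :: real)"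
      by (simp only: sum.cartesian_product case_prod_unfold prod.collapse)
    then show ?thesis by (simp only: sum.distrib) (simp add: power2_eq_square)
  qed
  also have "(\<Sum>p\<in>{..<n} \<times> {..<n}. of_bool (p \<in> unbalanced_pairs D)) = real (card (unbalanced_pairs D))"
    by (simp add: of_bool_def sum.If_cases) (rule arg_cong[of _ _ card], auto simp: unbalanced_pairs_def)
  finally show ?thesis .
qed

end

text \<open>Vertices are included independently given the sampled list \<open>xs\<close>, with probabilities \<open>pi1 xs\<close>. The
  thinning factor \<open>q\<close> makes the sampled vertices and the thinned high-degree vertices equally
  frequent. Samples with an exceptionally large set of high-degree vertices are discarded
  (\<open>keep\<close>), which bounds the expected set size; the probability that a pair loses by this is \<open>loss\<close>.\<close>

locale biased = sampling +
  fixes a T :: nat and \<delta> D \<omega> :: real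
  assumes n2: "2 \<le> n" and a1: "1 \<le> a" and T1: "1 \<le> T" and bt0: "0 < binomial_tail a T"
    and q1: "real a \<le> n * binomial_tail a T" and \<delta>: "0 < \<delta>" "\<delta> \<le> 1" "1 + 2 * \<delta> \<le> 2 * real T / real a"
    and D0: "0 \<le> D" and \<omega>0: "0 < \<omega>"
    and small: "(3 * real a * D / n + a / n) / (binomial_tail a T)\<^sup>2 + \<omega> \<le> \<delta> / 2"
begin

abbreviation "\<rho> \<equiv> binomial_tail a T"
abbreviation "e \<equiv> 3 * real a * D / n"

definition r :: real where "r = real a / n"
definition q :: real where "q = r / \<rho>"

lemma rho_bounds: "0 < \<rho>" "\<rho> \<le> 1" using bt0 binomial_tail_bounds by auto

lemma e_nonneg: "0 \<le> e" using D0 by simp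

lemma r_pos: "0 < r" using a1 n2 by (simp add: r_def)

lemma q_bounds: "0 < q" "q \<le> 1" "r \<le> q" "q * \<rho> = r"
proof -
  show "0 < q" using r_pos rho_bounds by (simp add: q_def)
  show "q \<le> 1" using q1 rho_bounds n2 by (simp add: q_def r_def field_simps)
  show "r \<le> q" using r_pos rho_bounds by (simp add: q_def field_simps)
  show "q * \<rho> = r" using rho_bounds by (simp add: q_def)
qed

text \<open>Halving keeps this at most 1 for a sampled vertex that also has high degree.\<close>

definition pi0 :: "nat list \<Rightarrow> nat \<Rightarrow> real" where
  "pi0 xs v = (mem v xs + q * hit T v xs) / 2"

definition keep :: "nat list \<Rightarrow> bool" where "keep xs \<longleftrightarrow> q * W_size T xs \<le> 4 * a"

definition pi1 :: "nat list \<Rightarrow> nat \<Rightarrow> real" where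
  "pi1 xs v = (if keep xs then pi0 xs v else 0)"

definition pair_prob :: "nat \<Rightarrow> nat \<Rightarrow> real" where "pair_prob u v = EV a (\<lambda>xs. pi1 xs u * pi1 xs v)"
definition pair_prob0 :: "nat \<Rightarrow> nat \<Rightarrow> real" where "pair_prob0 u v = EV a (\<lambda>xs. pi0 xs u * pi0 xs v)"
definition loss :: "nat \<Rightarrow> nat \<Rightarrow> real" where "loss u v = EV a (\<lambda>xs. pi0 xs u * pi0 xs v * of_bool (\<not> keep xs))"

text \<open>Averaging over the samples gives one law on vertex sets, which is what
  \<open>theta_le_random_sets\<close> asks for.\<close>

definition set_weight :: "nat set \<Rightarrow> real" where "set_weight A = EV a (\<lambda>xs. incl {..<n} (pi1 xs) A)"

lemma pi0_bounds: "0 \<le> pi0 xs v" "pi0 xs v \<le> 1" using q_bounds by (auto simp: pi0_def)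

lemma pi1_bounds: "0 \<le> pi1 xs v" "pi1 xs v \<le> 1" using pi0_bounds by (auto simp: pi1_def)

lemma pair_prob_eq: "pair_prob u v = pair_prob0 u v - loss u v"
proof -
  have "pi1 xs u * pi1 xs v = pi0 xs u * pi0 xs v - pi0 xs u * pi0 xs v * of_bool (\<not> keep xs)" for xs
    by (simp add: pi1_def)
  then show ?thesis unfolding pair_prob_def pair_prob0_def loss_def by (simp only: X.LE_diff)
qed

lemma loss_nonneg: "0 \<le> loss u v"
  unfolding loss_def using pi0_bounds by (intro X.LE_nonneg) auto

lemma sum_pi0: "set xs \<subseteq> {..<n} \<Longrightarrow> length xs = a \<Longrightarrow> (\<Sum>v<n. pi0 xs v) \<le> (a + q * W_size T xs) / 2"
proof -
  assume "set xs \<subseteq> {..<n}" "length xs = a"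
  moreover have "(\<Sum>v<n. pi0 xs v) = ((\<Sum>v<n. mem v xs) + q * W_size T xs) / 2"
    by (simp only: pi0_def W_size_def sum_divide_distrib[symmetric] sum.distrib sum_distrib_left[symmetric])
  ultimately show ?thesis using sum_occ[of xs] by simp
qed

lemma weights_set_weight: "weights (Pow {..<n}) set_weight"
proof
  show "0 \<le> set_weight A" if "A \<in> Pow {..<n}" for A
    unfolding set_weight_def using pi1_bounds by (intro X.LE_nonneg incl_nonneg) auto
  have "(\<Sum>A\<in>Pow {..<n}. set_weight A) = EV a (\<lambda>xs. \<Sum>A\<in>Pow {..<n}. incl {..<n} (pi1 xs) A)"
    unfolding set_weight_def X.LE_sum ..
  also have "\<dots> = 1" using sum_incl[of "{..<n}" "{}"] by (simp add: X.LE_const)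
  finally show "sum set_weight (Pow {..<n}) = 1" .
qed simp

lemma set_weight_pair:
  assumes "u < n" "v < n" "u \<noteq> v"
  shows "(\<Sum>A\<in>Pow {..<n}. set_weight A * of_bool ({u, v} \<subseteq> A)) = pair_prob u v"
proof -
  have "(\<Sum>A\<in>Pow {..<n}. set_weight A * of_bool ({u, v} \<subseteq> A))
      = EV a (\<lambda>xs. \<Sum>A\<in>Pow {..<n}. incl {..<n} (pi1 xs) A * of_bool ({u, v} \<subseteq> A))"
    unfolding set_weight_def X.LE_sum X.LE_cmult_right ..
  also have "\<dots> = pair_prob u v"
    unfolding pair_prob_def using assms by (subst sum_incl) auto
  finally show ?thesis .
qed

text \<open>A kept sample has total inclusion probability at most (a + 4a)/2, and 2 + 5a/2 <= 5a;
  the 2 accounts for \<open>u\<close> and \<open>v\<close> themselves.\<close>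

lemma set_weight_pair_size:
  assumes "u < n" "v < n" "u \<noteq> v"
  shows "(\<Sum>A\<in>Pow {..<n}. set_weight A * of_bool ({u, v} \<subseteq> A) * card A) \<le> 5 * a * pair_prob u v"
proof -
  have "(\<Sum>A\<in>Pow {..<n}. set_weight A * of_bool ({u, v} \<subseteq> A) * card A)
      = EV a (\<lambda>xs. \<Sum>A\<in>Pow {..<n}. incl {..<n} (pi1 xs) A * of_bool ({u, v} \<subseteq> A) * card A)"
    unfolding set_weight_def X.LE_sum X.LE_cmult_right ..
  also have "\<dots> \<le> EV a (\<lambda>xs. 5 * a * (pi1 xs u * pi1 xs v))"
  proof (rule X.LE_mono)
    fix xs assume xs: "set xs \<subseteq> {..<n}" "length xs = a"
    have "(\<Sum>A\<in>Pow {..<n}. incl {..<n} (pi1 xs) A * of_bool ({u, v} \<subseteq> A) * card A)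
        \<le> (\<Prod>v\<in>{u, v}. pi1 xs v) * (card {u, v} + (\<Sum>v<n. pi1 xs v))"
      by (rule sum_incl_card_le) (use assms pi1_bounds in auto)
    also have "\<dots> = (pi1 xs u * pi1 xs v) * (2 + (\<Sum>v<n. pi1 xs v))" using assms by simp
    also have "\<dots> \<le> (pi1 xs u * pi1 xs v) * (5 * a)"
    proof (intro mult_left_mono)
      have "(\<Sum>v<n. pi1 xs v) \<le> (5/2) * a"
        using sum_pi0[OF xs] by (cases "keep xs") (auto simp: pi1_def keep_def)
      then show "2 + (\<Sum>v<n. pi1 xs v) \<le> real (5 * a)" using a1 by simp
    qed (use pi1_bounds in auto)
    finally show "(\<Sum>A\<in>Pow {..<n}. incl {..<n} (pi1 xs) A * of_bool ({u, v} \<subseteq> A) * card A) \<le> 5 * a * (pi1 xs u * pi1 xs v)"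
      by (simp add: mult_ac)
  qed
  also have "\<dots> = 5 * a * pair_prob u v" unfolding pair_prob_def X.LE_cmult ..
  finally show ?thesis .
qed

lemma sum_loss: "(\<Sum>u<n. \<Sum>v<n. loss u v) \<le> q\<^sup>2 * (3 * e * (real n)\<^sup>2 + card (unbalanced_pairs D))"
proof -
  have "(\<Sum>u<n. \<Sum>v<n. loss u v) = EV a (\<lambda>xs. (\<Sum>v<n. pi0 xs v)\<^sup>2 * of_bool (\<not> keep xs))"
  proof -
    have "(\<Sum>v<n. pi0 xs v)\<^sup>2 * of_bool (\<not> keep xs) = (\<Sum>u<n. \<Sum>v<n. pi0 xs u * pi0 xs v * of_bool (\<not> keep xs))" for xs
      by (simp add: power2_eq_square sum_product sum_distrib_right sum_distrib_left mult_ac)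
    then show ?thesis by (simp only: loss_def X.LE_sum)
  qed
  also have "\<dots> \<le> EV a (\<lambda>xs. q\<^sup>2 * (W_size T xs - \<rho> * n)\<^sup>2)"
  proof (rule X.LE_mono)
    fix xs assume xs: "set xs \<subseteq> {..<n}" "length xs = a"
    show "(\<Sum>v<n. pi0 xs v)\<^sup>2 * of_bool (\<not> keep xs) \<le> q\<^sup>2 * (W_size T xs - \<rho> * n)\<^sup>2"
    proof (cases "keep xs")
      case False
      have "q * (\<rho> * n) = (q * \<rho>) * n" by simp
      also have "\<dots> = a" using n2 by (simp only: q_bounds) (simp add: r_def)
      finally have qa: "q * (\<rho> * n) = a" .
      \<comment> \<open>As q \<rho> n = a, a discarded sample has x = \<open>q * W_size T xs\<close>
        above 4a, and then (a + x)/2 <= x - a. So the loss is dominated by the squared deviation of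
        \<open>W_size\<close> from its typical value.\<close>
      have "(\<Sum>v<n. pi0 xs v) \<le> q * (W_size T xs - \<rho> * n)"
        using sum_pi0[OF xs] False qa by (simp add: keep_def right_diff_distrib)
      then have "(\<Sum>v<n. pi0 xs v)\<^sup>2 \<le> (q * (W_size T xs - \<rho> * n))\<^sup>2"
        using pi0_bounds by (intro power_mono sum_nonneg) auto
      then show ?thesis using False by (simp add: power_mult_distrib)
    qed simp
  qed
  also have "\<dots> \<le> q\<^sup>2 * (3 * e * (real n)\<^sup>2 + card (unbalanced_pairs D))"
    unfolding X.LE_cmult by (intro mult_left_mono W_size_variance D0) auto
  finally show ?thesis .
qed

section \<open>Pair probabilities of edges and of non-edges\<close>

lemma pair_prob0_eq:
  assumes "u < n" "v < n" "u \<noteq> v"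
  shows "pair_prob0 u v = (both_prob a
     + q * (EV a (\<lambda>xs. mem u xs * hit T v xs)
          + EV a (\<lambda>xs. mem v xs * hit T u xs))
     + q\<^sup>2 * EV a (\<lambda>xs. hit T u xs * hit T v xs)) / 4"
proof -
  have "pi0 xs u * pi0 xs v = (1/4) * (mem u xs * mem v xs + q * (mem u xs * hit T v xs + mem v xs * hit T u xs)
      + q\<^sup>2 * (hit T u xs * hit T v xs))" for xs
    by (simp add: pi0_def field_simps power2_eq_square)
  then have "pair_prob0 u v = (1/4) * (EV a (\<lambda>xs. mem u xs * mem v xs)
      + q * (EV a (\<lambda>xs. mem u xs * hit T v xs) + EV a (\<lambda>xs. mem v xs * hit T u xs)) + q\<^sup>2 * EV a (\<lambda>xs. hit T u xs * hit T v xs))"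
    unfolding pair_prob0_def by (simp only: X.LE_add X.LE_cmult)
  then show ?thesis unfolding EV_both_mem[OF assms] by simp
qed

lemma pair_prob0_le: 
  assumes "u < n" "v < n" "u \<noteq> v"
  shows "pair_prob0 u v \<le> q\<^sup>2"
proof -
  have mem: "EV a (\<lambda>xs. mem u xs * hit T v xs) \<le> q" if "u < n" for u v
  proof -
    have "EV a (\<lambda>xs. mem u xs * hit T v xs) \<le> EV a (\<lambda>xs. occ u xs)"
    proof (rule X.LE_mono)
      fix xs
      show "mem u xs * hit T v xs \<le> occ u xs"
        using occ_cases[of u xs] by auto
    qed
    then show ?thesis using EV_occ[OF that, of a] q_bounds(3) by (simp add: r_def)
  qed
  have "both_prob a \<le> q\<^sup>2"
    using both_prob_bounds[OF n2, of a] power_mono[OF q_bounds(3), of 2] r_pos by (simp add: r_def)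
  moreover have "EV a (\<lambda>xs. hit T u xs * hit T v xs) \<le> 1"
    by (intro X.LE_le_1) auto
  ultimately have "pair_prob0 u v \<le> (q\<^sup>2 + q * (q + q) + q\<^sup>2 * 1) / 4"
    unfolding pair_prob0_eq[OF assms] using q_bounds mem assms
    by (intro divide_right_mono add_mono mult_left_mono) auto
  then show ?thesis by (simp add: power2_eq_square)
qed

text \<open>The ideal value of \<open>pair_prob0\<close> without bias: if hits had probability
  \<rho>, independent of each other and of being sampled, and sampling had probability r, then the
  two mixed terms would be q r \<rho> = r^2 each and the last term (q \<rho>)^2 = r^2.\<close>

definition pbar :: real where "pbar = (both_prob a + 3 * r\<^sup>2) / 4"

lemma pbar_bounds: "3 / 4 * r\<^sup>2 \<le> pbar" "pbar \<le> r\<^sup>2" "0 < pbar"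
proof -
  show "3 / 4 * r\<^sup>2 \<le> pbar" "pbar \<le> r\<^sup>2"
    using both_prob_bounds[OF n2, of a] by (auto simp: pbar_def r_def)
  moreover have "0 < r\<^sup>2" using r_pos by simp
  ultimately show "0 < pbar" by linarith
qed

text \<open>This collects the errors from imbalance (\<open>e\<close>) and from repeated samples
  (\<open>r\<close>). The locale assumption \<open>small\<close> is tailored to it and leaves room
  \<omega> r^2 for discarded samples.\<close>

lemma error_terms_le: "2 * q * (r * e + r\<^sup>2) + q\<^sup>2 * e \<le> 4 * (\<delta> / 2 - \<omega>) * r\<^sup>2"
proof -
  have qr: "q = r / \<rho>" by (rule q_def)
  have "2 * q * (r * e + r\<^sup>2) + q\<^sup>2 * e = r\<^sup>2 * (2 * (e + r) / \<rho> + e / \<rho>\<^sup>2)"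
    unfolding qr using rho_bounds by (simp add: field_simps power2_eq_square)
  also have "\<dots> \<le> r\<^sup>2 * (4 * ((e + r) / \<rho>\<^sup>2))"
  proof (intro mult_left_mono)
    have "\<rho>\<^sup>2 \<le> \<rho>" using rho_bounds by (simp add: power2_eq_square mult_left_le)
    then have "2 * (e + r) / \<rho> \<le> 2 * (e + r) / \<rho>\<^sup>2" using e_nonneg r_pos rho_bounds by (intro divide_left_mono) auto
    then have "2 * (e + r) / \<rho> \<le> 2 * ((e + r) / \<rho>\<^sup>2)" by (simp only: times_divide_eq_right)
    moreover have "e / \<rho>\<^sup>2 \<le> (e + r) / \<rho>\<^sup>2" using r_pos by (intro divide_right_mono) auto
    moreover have "0 \<le> (e + r) / \<rho>\<^sup>2" using e_nonneg r_pos by (intro divide_nonneg_nonneg) auto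
    moreover have "A \<le> 2 * X \<Longrightarrow> B \<le> X \<Longrightarrow> 0 \<le> X \<Longrightarrow> A + B \<le> 4 * X" for A B X :: real by linarith
    ultimately show "2 * (e + r) / \<rho> + e / \<rho>\<^sup>2 \<le> 4 * ((e + r) / \<rho>\<^sup>2)" by blast
  qed simp
  also have "\<dots> \<le> r\<^sup>2 * (4 * (\<delta> / 2 - \<omega>))"
  proof (intro mult_left_mono)
    show "(e + r) / \<rho>\<^sup>2 \<le> \<delta> / 2 - \<omega>" using small unfolding r_def by (simp only: le_diff_eq)
  qed auto
  finally show ?thesis by (simp add: mult_ac)
qed

text \<open>Each of the two mixed terms in \<open>4 * pair_prob0\<close> exceeds its ideal value by
  2 \<delta> r^2, a gain of \<delta> r^2 in the probability. Errors take (\<delta>/2 - \<omega>) r^2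
  and discarded samples \<omega> r^2; what remains is \<delta>/2 r^2, at least \<delta>/2 times
  \<open>pbar\<close>.\<close>

lemma edge_prob:
  assumes "u < n" "v < n" "u \<noteq> v" and bal: "balanced D u v" and uv: "{u, v} \<in> E" and loss: "loss u v \<le> \<omega> * r\<^sup>2"
  shows "pbar * (1 + \<delta> / 2) \<le> pair_prob u v"
proof -
  obtain b where b: "a = Suc b" using a1 by (cases a) auto
  have rb: "real (Suc b) / n = r" by (simp only: r_def b[symmetric])
  have one: "r * ((1 + 2 * \<delta>) * \<rho> - e) - r\<^sup>2 \<le> EV a (\<lambda>xs. mem u xs * hit T v xs)"
    if "u < n" "v < n" "u \<noteq> v" "balanced D u v" "{u, v} \<in> E" for u v
  proof -
    have "EV a (\<lambda>xs. occ u xs * hit T v xs) = r * EV b (\<lambda>xs. of_bool (T \<le> 1 + degree_into E v xs))"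
      unfolding b EV_occ_degree[OF that(1)] rb using that(5) by simp
    also have "(\<lambda>xs. of_bool (T \<le> 1 + degree_into E v xs)) = (\<lambda>xs. hit (T - 1) v xs :: real)"
      by (simp add: le_diff_conv)
    finally have 1: "EV a (\<lambda>xs. occ u xs * hit T v xs) = r * EV b (hit (T - 1) v)" .
    have "(1 + 2 * \<delta>) * \<rho> - e \<le> EV b (hit (T - 1) v)"
      using binomial_tail_shifted(1)[OF T1 a1 \<delta>(3)] balanced_tail[OF that(4), of b a "T - 1"] b by (simp add: abs_le_iff)
    then have 2: "r * ((1 + 2 * \<delta>) * \<rho> - e) \<le> EV a (\<lambda>xs. occ u xs * hit T v xs)"
      unfolding 1 using r_pos by (intro mult_left_mono) auto
    \<comment> \<open>For x = \<open>occ u xs\<close> at least 1 this is 2 x - x^2 <= 1 if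
      \<open>v\<close> is hit and x - x^2 <= 0 if not.\<close>
    have "EV a (\<lambda>xs. occ u xs * hit T v xs) - EV a (\<lambda>xs. occ u xs * occ u xs - occ u xs)
        \<le> EV a (\<lambda>xs. mem u xs * hit T v xs)"
      unfolding X.LE_diff[symmetric]
    proof (rule X.LE_mono)
      fix xs
      show "occ u xs * hit T v xs - (occ u xs * occ u xs - occ u xs)
          \<le> mem u xs * hit T v xs"
      proof (cases "u \<in> set xs")
        case True
        then have "1 \<le> occ u xs" using occ_cases[of u xs] by auto
        moreover have "0 \<le> (occ u xs - 1)\<^sup>2" by simp
        moreover have "occ u xs * 1 \<le> occ u xs * occ u xs" using calculation(1) by (intro mult_left_mono) auto
        ultimately show ?thesis using True by (auto simp: power2_eq_square algebra_simps)
      next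
        case False
        then show ?thesis using occ_cases[of u xs] by auto
      qed
    qed
    moreover have "EV a (\<lambda>xs. occ u xs * occ u xs - occ u xs) \<le> r\<^sup>2"
      unfolding EV_occ_excess[OF that(1)] r_def power_divide
      by (intro divide_right_mono) (auto simp: power2_eq_square algebra_simps)
    ultimately show ?thesis using 2 by linarith
  qed
  have bal': "balanced D v u" and uv': "{v, u} \<in> E \<longleftrightarrow> {u, v} \<in> E"
    using bal by (simp_all add: balanced_commute[of D v u] insert_commute)
  note o1 = one[OF assms(1-3) bal uv]
  note o2 = one[OF assms(2,1) assms(3)[symmetric] bal' uv[folded uv']]
  have eq: "4 * pair_prob0 u v = both_prob a
     + q * (EV a (\<lambda>xs. mem u xs * hit T v xs)
          + EV a (\<lambda>xs. mem v xs * hit T u xs))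
     + q\<^sup>2 * EV a (\<lambda>xs. hit T u xs * hit T v xs)"
    unfolding pair_prob0_eq[OF assms(1-3)] by simp
  have h: "\<rho>\<^sup>2 - e \<le> EV a (\<lambda>xs. hit T u xs * hit T v xs)"
    using balanced_pair_tail[OF bal, of a T] by (simp add: abs_le_iff)
  have "both_prob a + q * ((r * ((1 + 2 * \<delta>) * \<rho> - e) - r\<^sup>2) + (r * ((1 + 2 * \<delta>) * \<rho> - e) - r\<^sup>2)) + q\<^sup>2 * (\<rho>\<^sup>2 - e)
      \<le> 4 * pair_prob0 u v"
    unfolding eq by (intro add_mono mult_left_mono order_refl o1 o2 h) (use q_bounds in auto)
  also have "both_prob a + q * ((r * ((1 + 2 * \<delta>) * \<rho> - e) - r\<^sup>2) + (r * ((1 + 2 * \<delta>) * \<rho> - e) - r\<^sup>2)) + q\<^sup>2 * (\<rho>\<^sup>2 - e)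
      = both_prob a + 2 * ((q * \<rho>) * r * (1 + 2 * \<delta>)) + (q * \<rho>)\<^sup>2 - (2 * q * (r * e + r\<^sup>2) + q\<^sup>2 * e)"
    by (simp add: algebra_simps power2_eq_square)
  also have "\<dots> = 4 * pbar + 4 * \<delta> * r\<^sup>2 - (2 * q * (r * e + r\<^sup>2) + q\<^sup>2 * e)"
    unfolding q_bounds pbar_def by (simp add: algebra_simps power2_eq_square)
  finally have "4 * pbar + 4 * \<delta> * r\<^sup>2 - 4 * (\<delta> / 2 - \<omega>) * r\<^sup>2 \<le> 4 * pair_prob0 u v" using error_terms_le by linarith
  then have "pbar + \<delta> / 2 * r\<^sup>2 \<le> pair_prob u v" unfolding pair_prob_eq using loss by (simp add: algebra_simps)
  moreover have "\<delta> / 2 * pbar \<le> \<delta> / 2 * r\<^sup>2" using pbar_bounds \<delta> by (intro mult_left_mono) auto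
  ultimately show ?thesis by (simp add: algebra_simps)
qed

text \<open>The mirror image of \<open>edge_prob\<close>. For an upper bound, \<open>mem\<close> is
  at most \<open>occ\<close>, and discarding samples only lowers the probability.\<close>

lemma nonedge_prob:
  assumes "u < n" "v < n" "u \<noteq> v" and bal: "balanced D u v" and uv: "{u, v} \<notin> E"
  shows "pair_prob u v \<le> pbar * (1 - \<delta> / 2)"
proof -
  obtain b where b: "a = Suc b" using a1 by (cases a) auto
  have rb: "real (Suc b) / n = r" by (simp only: r_def b[symmetric])
  have one: "EV a (\<lambda>xs. mem u xs * hit T v xs) \<le> r * ((1 - 2 * \<delta>) * \<rho> + e) + r\<^sup>2"
    if "u < n" "v < n" "u \<noteq> v" "balanced D u v" "{u, v} \<notin> E" for u v
  proof -
    have 1: "EV a (\<lambda>xs. occ u xs * hit T v xs) = r * EV b (hit T v)"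
      unfolding b EV_occ_degree[OF that(1)] rb using that(5) by simp
    have "EV b (hit T v) \<le> (1 - 2 * \<delta>) * \<rho> + e"
      using binomial_tail_shifted(2)[OF T1 a1 \<delta>(3)] balanced_tail[OF that(4), of b a T] b by (simp add: abs_le_iff)
    then have 2: "EV a (\<lambda>xs. occ u xs * hit T v xs) \<le> r * ((1 - 2 * \<delta>) * \<rho> + e)"
      unfolding 1 using r_pos by (intro mult_left_mono) auto
    have "EV a (\<lambda>xs. mem u xs * hit T v xs) \<le> EV a (\<lambda>xs. occ u xs * hit T v xs)"
    proof (intro X.LE_mono mult_right_mono)
      fix xs show "mem u xs \<le> occ u xs" using occ_cases[of u xs] by auto
    qed auto
    with 2 show ?thesis by (simp add: add_increasing2)
  qed
  have bal': "balanced D v u" and uv': "{v, u} \<in> E \<longleftrightarrow> {u, v} \<in> E"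
    using bal by (simp_all add: balanced_commute[of D v u] insert_commute)
  note o1 = one[OF assms(1-3) bal uv]
  note o2 = one[OF assms(2,1) assms(3)[symmetric] bal' uv[folded uv']]
  have eq: "4 * pair_prob0 u v = both_prob a
     + q * (EV a (\<lambda>xs. mem u xs * hit T v xs)
          + EV a (\<lambda>xs. mem v xs * hit T u xs))
     + q\<^sup>2 * EV a (\<lambda>xs. hit T u xs * hit T v xs)"
    unfolding pair_prob0_eq[OF assms(1-3)] by simp
  have h: "EV a (\<lambda>xs. hit T u xs * hit T v xs) \<le> \<rho>\<^sup>2 + e"
    using balanced_pair_tail[OF bal, of a T] by (simp add: abs_le_iff)
  have "4 * pair_prob0 u v \<le>
      both_prob a + q * ((r * ((1 - 2 * \<delta>) * \<rho> + e) + r\<^sup>2) + (r * ((1 - 2 * \<delta>) * \<rho> + e) + r\<^sup>2)) + q\<^sup>2 * (\<rho>\<^sup>2 + e)"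
    unfolding eq by (intro add_mono mult_left_mono order_refl o1 o2 h) (use q_bounds in auto)
  also have "\<dots> = both_prob a + 2 * ((q * \<rho>) * r * (1 - 2 * \<delta>)) + (q * \<rho>)\<^sup>2 + (2 * q * (r * e + r\<^sup>2) + q\<^sup>2 * e)"
    by (simp add: algebra_simps power2_eq_square)
  also have "\<dots> = 4 * pbar - 4 * \<delta> * r\<^sup>2 + (2 * q * (r * e + r\<^sup>2) + q\<^sup>2 * e)"
    unfolding q_bounds pbar_def by (simp add: algebra_simps power2_eq_square)
  finally have "4 * pair_prob0 u v \<le> 4 * pbar - 4 * \<delta> * r\<^sup>2 + 4 * (\<delta> / 2 - \<omega>) * r\<^sup>2" using error_terms_le by linarith
  moreover have "0 \<le> \<omega> * r\<^sup>2" using \<omega>0 by simp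
  ultimately have "pair_prob u v \<le> pbar - \<delta> / 2 * r\<^sup>2"
    unfolding pair_prob_eq using loss_nonneg[of u v] by (simp add: algebra_simps)
  moreover have "\<delta> / 2 * pbar \<le> \<delta> / 2 * r\<^sup>2" using pbar_bounds \<delta> by (intro mult_left_mono) auto
  ultimately show ?thesis by (simp add: algebra_simps)
qed

section \<open>Good pairs and the bound on theta for one graph\<close>

definition good_pairs :: "nat set set" where
  "good_pairs = {e \<in> vertex_pairs {..<n}. \<forall>u v. e = {u, v} \<longrightarrow> balanced D u v \<and> loss u v \<le> \<omega> * r\<^sup>2}"

text \<open>Markov's inequality turns \<open>sum_loss\<close> into a count of the pairs that lose
  more than \<omega> r^2, and q^2/r^2 = 1/\<rho>^2.\<close>

lemma card_bad_pairs:
  "real (card (vertex_pairs {..<n} - good_pairs))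
     \<le> card (unbalanced_pairs D) + (3 * e * (real n)\<^sup>2 + card (unbalanced_pairs D)) / (\<rho>\<^sup>2 * \<omega>)"
proof -
  let ?L = "{p \<in> {..<n} \<times> {..<n}. \<omega> * r\<^sup>2 \<le> loss (fst p) (snd p)}"
  have "p \<in> (\<lambda>(u, v). {u, v}) ` (unbalanced_pairs D \<union> ?L)" if p: "p \<in> vertex_pairs {..<n} - good_pairs" for p
  proof -
    obtain u v where uv: "p = {u, v}" "\<not> (balanced D u v \<and> loss u v \<le> \<omega> * r\<^sup>2)"
      using p by (auto simp: good_pairs_def)
    then have "u < n" "v < n" using p by auto
    then have "(u, v) \<in> unbalanced_pairs D \<union> ?L" using uv by (auto simp: unbalanced_pairs_def)
    then show ?thesis using uv(1) by force
  qed
  then have "card (vertex_pairs {..<n} - good_pairs) \<le> card (unbalanced_pairs D \<union> ?L)"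
    by (intro surj_card_le[of _ _ "\<lambda>(u, v). {u, v}"]) auto
  also have "\<dots> \<le> card (unbalanced_pairs D) + card ?L" by (rule card_Un_le)
  finally have "real (card (vertex_pairs {..<n} - good_pairs)) \<le> card (unbalanced_pairs D) + real (card ?L)" by linarith
  also have "real (card ?L) \<le> (\<Sum>p\<in>{..<n} \<times> {..<n}. loss (fst p) (snd p)) / (\<omega> * r\<^sup>2)"
    using loss_nonneg \<omega>0 r_pos by (intro card_markov) auto
  also have "(\<Sum>p\<in>{..<n} \<times> {..<n}. loss (fst p) (snd p)) = (\<Sum>u<n. \<Sum>v<n. loss u v)"
    by (simp add: sum.cartesian_product case_prod_unfold)
  also have "(\<Sum>u<n. \<Sum>v<n. loss u v) / (\<omega> * r\<^sup>2) \<le> (q\<^sup>2 * (3 * e * (real n)\<^sup>2 + card (unbalanced_pairs D))) / (\<omega> * r\<^sup>2)"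
    using \<omega>0 r_pos by (intro divide_right_mono sum_loss) auto
  also have "\<dots> = (3 * e * (real n)\<^sup>2 + card (unbalanced_pairs D)) / (\<rho>\<^sup>2 * \<omega>)"
    using r_pos \<omega>0 rho_bounds unfolding q_def power_divide by simp
  finally show ?thesis by simp
qed

text \<open>About k/\<open>pbar\<close> sets give an edge mean coverage at least k (1 + \<delta>/2)
  and a non-edge at most about k (1 - \<delta>/2). Rounding up adds less than 1 to \<open>m\<close>,
  hence at most \<open>pbar\<close> <= 1 to \<open>m * pbar\<close>.\<close>

lemma theta_le_biased:
  fixes k :: nat and B :: real
  assumes k: "2 \<le> k"
  defines "B \<equiv> card (unbalanced_pairs D) + (3 * e * (real n)\<^sup>2 + card (unbalanced_pairs D)) / (\<rho>\<^sup>2 * \<omega>)"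
  shows "real (theta k {..<n} E) \<le> 2 * k * (real n)\<^sup>2 / (real a)\<^sup>2 + 1
     + k * (B + (real n)\<^sup>2 * (exp (- (k * \<delta>\<^sup>2 / 32)) * (1 + 60 * a * (k + 1))) + 20 * a * (k + 1) * B / \<rho>\<^sup>2)"
proof -
  \<comment> \<open>The tilt in y = 1 - t and z = 1 + t. As \<delta>/2 = 4t, the exponents are - (t
    + 4 t^2) k + (t + 2 t^2) k = - 2 t^2 k for edges and t (1 - 4t) (k + 1) - (t - t^2) k <= 1 - 2
    t^2 k for non-edges, and 2 t^2 = \<delta>^2/32.\<close>
  define t where "t = \<delta> / 8"
  have t: "0 < t" "t \<le> 1/8" "\<delta> = 8 * t" using \<delta> by (auto simp: t_def)
  define m where "m = nat \<lceil>real k / pbar\<rceil>"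
  have pb1: "pbar \<le> 1"
  proof -
    have "r \<le> 1" using q_bounds by linarith
    then have "r\<^sup>2 \<le> 1\<^sup>2" using r_pos by (intro power_mono) auto
    then show ?thesis using pbar_bounds by simp
  qed
  have mk: "real k / pbar \<le> m" "m \<le> real k / pbar + 1"
    using pbar_bounds by (auto simp: m_def of_nat_ceiling)
  then have m1: "k \<le> m * pbar" "m * pbar \<le> k + 1"
  proof -
    show "k \<le> m * pbar" using mk(1) pbar_bounds by (simp add: field_simps)
    have "m * pbar \<le> (real k / pbar + 1) * pbar" using mk(2) pbar_bounds by (intro mult_right_mono) auto
    also have "\<dots> = k + pbar" using pbar_bounds by (simp add: field_simps)
    finally show "m * pbar \<le> k + 1" using pb1 by linarith
  qed
  have mr: "m * r\<^sup>2 \<le> 2 * (real k + 1)"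
  proof -
    have "m * (3 / 4 * r\<^sup>2) \<le> m * pbar" using pbar_bounds by (intro mult_left_mono) auto
    then show ?thesis using m1 by simp
  qed
  have m2: "m \<le> 2 * k * (real n)\<^sup>2 / (real a)\<^sup>2 + 1"
  proof -
    have "real k / pbar \<le> real k / (3 / 4 * r\<^sup>2)" using pbar_bounds r_pos by (intro divide_left_mono) auto
    also have "\<dots> = 4 / 3 * (k * (real n)\<^sup>2 / (real a)\<^sup>2)" by (simp add: r_def power_divide)
    also have "\<dots> \<le> 2 * (k * (real n)\<^sup>2 / (real a)\<^sup>2)" by (intro mult_right_mono) auto
    finally show ?thesis using mk(2) by simp
  qed
  let ?P = "vertex_pairs {..<n}"
  let ?B = "real (card (?P - good_pairs))" and ?N = "real (card ?P)"
  let ?\<beta> = "exp (- (k * \<delta>\<^sup>2 / 32))"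
  let ?x1 = "exp (- (1 - (1 - t)) * (pbar * (1 + \<delta> / 2)) * m) / (1 - t) ^ k"
  let ?x2 = "m * (1 + t) * (5 * a * pbar) * exp ((1 + t - 1) * (pbar * (1 - \<delta> / 2)) * m) / (1 + t) ^ k"
  have th: "real (theta k {..<n} E) \<le> m + k * (?B + ?N * ?x1
     + 2 * (?N * ?x2 + ?B * (m * (5 * a * q\<^sup>2))))"
  proof (rule theta_le_random_sets[OF E _ _ weights_set_weight])
    show "good_pairs \<subseteq> ?P" by (auto simp: good_pairs_def)
    show "0 \<le> 5 * a * pbar" using pbar_bounds by simp
    show "pbar * (1 + \<delta> / 2) \<le> (\<Sum>A\<in>Pow {..<n}. set_weight A * of_bool (f \<subseteq> A))" if f: "f \<in> E \<inter> good_pairs" for f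
    proof -
      have "f \<in> ?P" using f by (auto simp: good_pairs_def)
      then obtain u v where uv: "f = {u, v}" "u < n" "v < n" "u \<noteq> v" by (auto elim!: vertex_pairsE)
      then show ?thesis using f edge_prob[of u v] set_weight_pair[of u v] by (auto simp: good_pairs_def)
    qed
    show "(\<Sum>A\<in>Pow {..<n}. set_weight A * of_bool (f \<subseteq> A)) \<le> pbar * (1 - \<delta> / 2)" if f: "f \<in> good_pairs - E" for f
    proof -
      have "f \<in> ?P" using f by (auto simp: good_pairs_def)
      then obtain u v where uv: "f = {u, v}" "u < n" "v < n" "u \<noteq> v" by (auto elim!: vertex_pairsE)
      then show ?thesis using f nonedge_prob[of u v] set_weight_pair[of u v] by (auto simp: good_pairs_def)
    qed
    show "(\<Sum>A\<in>Pow {..<n}. set_weight A * of_bool (f \<subseteq> A) * card A) \<le> 5 * a * pbar" if f: "f \<in> good_pairs - E" for f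
    proof -
      have "f \<in> ?P" using f by (auto simp: good_pairs_def)
      then obtain u v where uv: "f = {u, v}" "u < n" "v < n" "u \<noteq> v" by (auto elim!: vertex_pairsE)
      have "pair_prob u v \<le> pbar * (1 - \<delta> / 2)" using uv f nonedge_prob[of u v] by (auto simp: good_pairs_def)
      also have "\<dots> \<le> pbar * 1" using pbar_bounds \<delta> by (intro mult_left_mono) auto
      finally have "5 * a * pair_prob u v \<le> 5 * a * pbar" by (intro mult_left_mono) auto
      then show ?thesis using set_weight_pair_size[of u v] uv by simp
    qed
    show "(\<Sum>A\<in>Pow {..<n}. set_weight A * of_bool (f \<subseteq> A) * card A) \<le> 5 * a * q\<^sup>2" if f: "f \<in> ?P" for f
    proof -
      obtain u v where uv: "f = {u, v}" "u < n" "v < n" "u \<noteq> v" using f by (auto elim!: vertex_pairsE)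
      have "pair_prob u v \<le> q\<^sup>2" unfolding pair_prob_eq using pair_prob0_le[of u v] loss_nonneg[of u v] uv by simp
      then have "5 * a * pair_prob u v \<le> 5 * a * q\<^sup>2" by (intro mult_left_mono) auto
      then show ?thesis using set_weight_pair_size[of u v] uv by simp
    qed
  qed (use k t in auto)
  have N: "?N \<le> (real n)\<^sup>2" using real_choose_two[of n] by (simp add: card_vertex_pairs power2_eq_square algebra_simps)
  have BB: "?B \<le> B" unfolding B_def by (rule card_bad_pairs)
  have B0: "0 \<le> B" using BB by (rule order_trans[rotated]) simp
  have x1: "?x1 \<le> ?\<beta>"
  proof -
    have "t * (1 + \<delta> / 2) * k \<le> t * (1 + \<delta> / 2) * (m * pbar)" using m1 t \<delta> by (intro mult_left_mono) auto
    then have "exp (- (1 - (1 - t)) * (pbar * (1 + \<delta> / 2)) * m) \<le> exp (- (t * (1 + \<delta> / 2) * k))"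
      by (simp add: mult_ac)
    moreover have "exp (k * (- t - 2 * t\<^sup>2)) \<le> (1 - t) ^ k"
    proof -
      have "exp (k * (- t - 2 * t\<^sup>2)) \<le> exp (k * ln (1 - t))"
        using ln_one_minus_pos_lower_bound[of t] t by (auto intro!: mult_left_mono)
      then show ?thesis using t by (simp add: exp_of_nat_mult)
    qed
    ultimately have "?x1
        \<le> exp (- (t * (1 + \<delta> / 2) * k)) / exp (k * (- t - 2 * t\<^sup>2))"
      by (intro frac_le) auto
    also have "\<dots> = exp (- (t * (1 + \<delta> / 2) * k) - k * (- t - 2 * t\<^sup>2))" by (simp only: exp_diff)
    also have "- (t * (1 + \<delta> / 2) * k) - k * (- t - 2 * t\<^sup>2) = - (k * \<delta>\<^sup>2 / 32)"
      unfolding t(3) by (simp add: algebra_simps power2_eq_square)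
    finally show ?thesis .
  qed
  have x2: "?x2
      \<le> 30 * a * (k + 1) * ?\<beta>"
  proof -
    have "exp ((1 + t - 1) * (pbar * (1 - \<delta> / 2)) * m) \<le> exp (t * (1 - \<delta> / 2) * (k + 1))"
    proof -
      have "t * (1 - \<delta> / 2) * (m * pbar) \<le> t * (1 - \<delta> / 2) * (k + 1)" using m1 t \<delta> by (intro mult_left_mono) auto
      then show ?thesis by (simp add: mult_ac)
    qed
    moreover have "exp (k * (t - t\<^sup>2)) \<le> (1 + t) ^ k"
    proof -
      have "exp (k * (t - t\<^sup>2)) \<le> exp (k * ln (1 + t))"
        using ln_one_plus_pos_lower_bound[of t] t by (auto intro!: mult_left_mono)
      then show ?thesis using t by (simp add: exp_of_nat_mult)
    qed
    ultimately have "exp ((1 + t - 1) * (pbar * (1 - \<delta> / 2)) * m) / (1 + t) ^ k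
        \<le> exp (t * (1 - \<delta> / 2) * (k + 1)) / exp (k * (t - t\<^sup>2))"
      by (intro frac_le) auto
    also have "\<dots> = exp (t * (1 - \<delta> / 2) * (k + 1) - k * (t - t\<^sup>2))" by (simp only: exp_diff)
    also have "t * (1 - \<delta> / 2) * (k + 1) - k * (t - t\<^sup>2) \<le> 1 + - (k * \<delta>\<^sup>2 / 32)"
    proof -
      have "t * (1 - \<delta> / 2) * (k + 1) - k * (t - t\<^sup>2) = t - 4 * t\<^sup>2 - 3 * (k * t\<^sup>2)"
        unfolding t(3) by (simp add: algebra_simps power2_eq_square)
      also have "\<dots> \<le> 1 - 2 * (k * t\<^sup>2)"
      proof -
        have "0 \<le> t\<^sup>2" "0 \<le> k * t\<^sup>2" by auto
        then show ?thesis using t by linarith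
      qed
      finally show ?thesis unfolding t(3) by (simp add: power_mult_distrib)
    qed
    finally have ex: "exp ((1 + t - 1) * (pbar * (1 - \<delta> / 2)) * m) / (1 + t) ^ k \<le> exp 1 * ?\<beta>"
      by (simp only: exp_add exp_le_cancel_iff)
    have "m * (1 + t) * (5 * a * pbar) = 5 * a * (1 + t) * (m * pbar)" by (simp add: mult_ac)
    also have "\<dots> \<le> 5 * real a * 2 * (real k + 1)" using m1 t pbar_bounds by (intro mult_mono) auto
    finally have y1: "m * (1 + t) * (5 * a * pbar) \<le> 5 * real a * 2 * (real k + 1)" .
    have "m * (1 + t) * (5 * a * pbar) * (exp ((1 + t - 1) * (pbar * (1 - \<delta> / 2)) * m) / (1 + t) ^ k)
        \<le> (5 * real a * 2 * (real k + 1)) * (exp 1 * ?\<beta>)"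
      by (rule mult_mono[OF y1 ex]) (use t in auto)
    also have "\<dots> \<le> (5 * real a * 2 * (real k + 1)) * (3 * ?\<beta>)"
      using e_less_272 by (intro mult_left_mono mult_right_mono) auto
    also have "\<dots> = 30 * a * (k + 1) * ?\<beta>" by (simp add: algebra_simps)
    finally show ?thesis by (simp only: times_divide_eq_right)
  qed
  have x3: "m * (5 * a * q\<^sup>2) \<le> 10 * a * (k + 1) / \<rho>\<^sup>2"
  proof -
    have "m * (5 * a * q\<^sup>2) = 5 * a * (m * r\<^sup>2) / \<rho>\<^sup>2" by (simp add: q_def power_divide)
    also have "\<dots> \<le> 5 * a * (2 * (real k + 1)) / \<rho>\<^sup>2" using mr by (intro divide_right_mono mult_left_mono) auto
    also have "\<dots> = 10 * a * (k + 1) / \<rho>\<^sup>2" by (simp add: mult_ac add_ac)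
    finally show ?thesis .
  qed
  have "?B + ?N * ?x1
     + 2 * (?N * ?x2 + ?B * (m * (5 * a * q\<^sup>2)))
    \<le> B + (real n)\<^sup>2 * ?\<beta> + 2 * ((real n)\<^sup>2 * (30 * a * (k + 1) * ?\<beta>) + B * (10 * a * (k + 1) / \<rho>\<^sup>2))"
  proof -
    have h1: "?N * ?x1 \<le> (real n)\<^sup>2 * ?\<beta>"
      by (intro mult_mono N x1) (use t in auto)
    have h2: "?N * ?x2
        \<le> (real n)\<^sup>2 * (30 * a * (k + 1) * ?\<beta>)"
      by (intro mult_mono N x2) (use t pbar_bounds in auto)
    have h3: "?B * (m * (5 * a * q\<^sup>2)) \<le> B * (10 * a * (k + 1) / \<rho>\<^sup>2)"
      by (intro mult_mono BB x3) (use B0 in auto)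
    show ?thesis by (rule add_mono[OF add_mono[OF BB h1] mult_left_mono[OF add_mono[OF h2 h3]]]) simp
  qed
  also have "\<dots> = B + (real n)\<^sup>2 * (?\<beta> * (1 + 60 * a * (k + 1))) + 20 * a * (k + 1) * B / \<rho>\<^sup>2"
    by (simp add: algebra_simps)
  finally have "k * (?B + ?N * ?x1
     + 2 * (?N * ?x2 + ?B * (m * (5 * a * q\<^sup>2))))
    \<le> k * (B + (real n)\<^sup>2 * (?\<beta> * (1 + 60 * a * (k + 1))) + 20 * a * (k + 1) * B / \<rho>\<^sup>2)"
    by (rule mult_left_mono) simp
  with th m2 show ?thesis by linarith
qed

end

section \<open>Balanced pairs in random graphs\<close>

lemma sum_Pow_characters:
  assumes "finite P" "R \<subseteq> P" "R \<noteq> {}"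
  shows "(\<Sum>E\<in>Pow P. \<Prod>e\<in>R. chi (e \<in> E)) = 0"
proof -
  define h where "h = (\<lambda>e b. if e \<in> R then chi b else 1)"
  have "(\<Prod>e\<in>R. chi (e \<in> E)) = (\<Prod>e\<in>P. h e (e \<in> E))" for E
    using assms(1,2) by (intro prod.mono_neutral_cong_left) (auto simp: h_def)
  then have "(\<Sum>E\<in>Pow P. \<Prod>e\<in>R. chi (e \<in> E)) = (\<Prod>e\<in>P. h e True + h e False)"
    using sum_Pow_prod[OF assms(1), of h] by simp
  also have "\<dots> = 0"
    using assms by (intro prod_zero) (auto simp: h_def)
  finally show ?thesis .
qed

text \<open>The n signs are pairwise uncorrelated, also with the constant sign -1 at x = v.\<close>

lemma sum_nbr_sum_squared:
  assumes "v < n"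
  shows "(\<Sum>E\<in>Pow (vertex_pairs {..<n}). (nbr_sum n E v)\<^sup>2) = n * 2 ^ card (vertex_pairs {..<n})"
proof -
  let ?P = "vertex_pairs {..<n}"
  have fP: "finite ?P" by simp
  have *: "(\<Sum>E\<in>Pow ?P. chi ({x, v} \<in> E) * chi ({y, v} \<in> E)) = of_bool (x = y) * 2 ^ card ?P"
    if xy: "x < n" "y < n" for x y
  proof -
    have loop: "{v} \<notin> E" if "E \<in> Pow ?P" for E using that by (auto simp: vertex_pairs_def)
    have single: "(\<Sum>E\<in>Pow ?P. chi ({w, v} \<in> E)) = 0" if "w < n" "w \<noteq> v" for w
      using sum_Pow_characters[OF fP, of "{{w, v}}"] that assms by simp
    consider "x = y" | "x \<noteq> y" "x = v" | "x \<noteq> y" "y = v" | "x \<noteq> y" "x \<noteq> v" "y \<noteq> v" by blast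
    then show ?thesis
    proof cases
      case 1
      then show ?thesis by (simp add: card_Pow)
    next
      case 2
      then have "(\<Sum>E\<in>Pow ?P. chi ({x, v} \<in> E) * chi ({y, v} \<in> E)) = (\<Sum>E\<in>Pow ?P. - chi ({y, v} \<in> E))"
        using loop by (intro sum.cong) auto
      then show ?thesis using single[of y] 2 xy by (simp add: sum_negf)
    next
      case 3
      then have "(\<Sum>E\<in>Pow ?P. chi ({x, v} \<in> E) * chi ({y, v} \<in> E)) = (\<Sum>E\<in>Pow ?P. - chi ({x, v} \<in> E))"
        using loop by (intro sum.cong) auto
      then show ?thesis using single[of x] 3 xy by (simp add: sum_negf)
    next
      case 4
      then have "{x, v} \<noteq> {y, v}" by (simp add: doubleton_eq_iff)
      then show ?thesis
        using sum_Pow_characters[OF fP, of "{{x, v}, {y, v}}"] 4 xy assms by simp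
    qed
  qed
  have "(\<Sum>E\<in>Pow ?P. (nbr_sum n E v)\<^sup>2) = (\<Sum>E\<in>Pow ?P. \<Sum>x<n. \<Sum>y<n. chi ({x, v} \<in> E) * chi ({y, v} \<in> E))"
    by (simp add: nbr_sum_def power2_eq_square sum_product)
  also have "\<dots> = (\<Sum>x<n. \<Sum>y<n. \<Sum>E\<in>Pow ?P. chi ({x, v} \<in> E) * chi ({y, v} \<in> E))"
    by (subst sum.swap, intro sum.cong refl, rule sum.swap)
  also have "\<dots> = (\<Sum>x<n. \<Sum>y<n. of_bool (x = y) * 2 ^ card ?P)"
    using * by (intro sum.cong) auto
  also have "\<dots> = n * 2 ^ card ?P"
    by (simp add: sum_distrib_right[symmetric] of_bool_def sum.delta)
  finally show ?thesis .
qed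

text \<open>The terms x = u and x = v both equal the negative sign of the pair {u, v}, so they are
  correlated. They are split off by (s - 2c)^2 <= 2 s^2 + 8 for a sign c; the other terms are
  pairwise uncorrelated.\<close>

lemma sum_conbr_sum_squared:
  assumes "u < n" "v < n" "u \<noteq> v"
  shows "(\<Sum>E\<in>Pow (vertex_pairs {..<n}). (conbr_sum n E u v)\<^sup>2) \<le> (2 * n + 8) * 2 ^ card (vertex_pairs {..<n})"
proof -
  let ?P = "vertex_pairs {..<n}" and ?X = "{..<n} - {u, v}"
  have fP: "finite ?P" by simp
  let ?g = "\<lambda>E x. chi ({x, u} \<in> E) * chi ({x, v} \<in> E)"
  define s where "s = (\<lambda>E. \<Sum>x\<in>?X. ?g E x)"
  have bound: "(conbr_sum n E u v)\<^sup>2 \<le> 2 * (s E)\<^sup>2 + 8" if E: "E \<in> Pow ?P" for E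
  proof -
    have loop: "{w} \<notin> E" for w using E by (auto simp: vertex_pairs_def)
    have "conbr_sum n E u v = s E + ?g E u + ?g E v"
      unfolding conbr_sum_def s_def using assms
      by (simp add: sum.remove[of "{..<n}" u] sum.remove[of "{..<n} - {u}" v] Diff_insert2[symmetric] insert_commute)
    then have eq: "conbr_sum n E u v = s E + - 2 * chi ({u, v} \<in> E)"
      using loop by (simp add: insert_commute)
    have "(conbr_sum n E u v)\<^sup>2 + (s E + 2 * chi ({u, v} \<in> E))\<^sup>2 = 2 * (s E)\<^sup>2 + 8 * (chi ({u, v} \<in> E) * chi ({u, v} \<in> E))"
      unfolding eq by (simp add: power2_eq_square algebra_simps)
    then have "(conbr_sum n E u v)\<^sup>2 + (s E + 2 * chi ({u, v} \<in> E))\<^sup>2 = 2 * (s E)\<^sup>2 + 8" by simp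
    then show ?thesis using zero_le_power2[of "s E + 2 * chi ({u, v} \<in> E)"] by linarith
  qed
  have *: "(\<Sum>E\<in>Pow ?P. ?g E x * ?g E y) = of_bool (x = y) * 2 ^ card ?P" if xy: "x \<in> ?X" "y \<in> ?X" for x y
  proof (cases "x = y")
    case True
    have "?g E x * ?g E x = 1" for E by (simp add: chi_def)
    then show ?thesis using True by (simp add: card_Pow)
  next
    case False
    have "{x, u} \<noteq> {x, v}" "{x, u} \<noteq> {y, u}" "{x, u} \<noteq> {y, v}" "{x, v} \<noteq> {y, u}" "{x, v} \<noteq> {y, v}" "{y, u} \<noteq> {y, v}"
      using False xy assms by (auto simp: doubleton_eq_iff)
    then show ?thesis
      using sum_Pow_characters[OF fP, of "{{x, u}, {x, v}, {y, u}, {y, v}}"] False xy assms by (simp add: mult.assoc)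
  qed
  have "(\<Sum>E\<in>Pow ?P. (s E)\<^sup>2) = (\<Sum>E\<in>Pow ?P. \<Sum>x\<in>?X. \<Sum>y\<in>?X. ?g E x * ?g E y)"
    by (simp only: s_def power2_eq_square sum_product)
  also have "\<dots> = (\<Sum>x\<in>?X. \<Sum>y\<in>?X. \<Sum>E\<in>Pow ?P. ?g E x * ?g E y)"
    by (subst sum.swap, intro sum.cong refl, rule sum.swap)
  also have "\<dots> = (\<Sum>x\<in>?X. \<Sum>y\<in>?X. of_bool (x = y) * 2 ^ card ?P)"
    using * by (intro sum.cong) auto
  also have "\<dots> = real (card ?X) * 2 ^ card ?P"
    by (simp add: sum_distrib_right[symmetric] of_bool_def sum.delta)
  also have "\<dots> \<le> real n * 2 ^ card ?P"
    using card_mono[of "{..<n}" ?X] by (intro mult_right_mono) auto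
  finally have S: "(\<Sum>E\<in>Pow ?P. (s E)\<^sup>2) \<le> real n * 2 ^ card ?P" .
  have "(\<Sum>E\<in>Pow ?P. (conbr_sum n E u v)\<^sup>2) \<le> (\<Sum>E\<in>Pow ?P. 2 * (s E)\<^sup>2 + 8)"
    by (intro sum_mono bound)
  also have "\<dots> = 2 * (\<Sum>E\<in>Pow ?P. (s E)\<^sup>2) + 8 * 2 ^ card ?P"
    by (simp add: sum.distrib sum_distrib_left[symmetric] card_Pow)
  also have "\<dots> \<le> (2 * n + 8) * 2 ^ card ?P" using S by (simp add: algebra_simps)
  finally show ?thesis .
qed

text \<open>The sums have typical size n^(1/2). Second moments therefore predict O(n^2 * n/D^2) =
  O(n^(3/2)) unbalanced pairs for D = n^(3/4), and the threshold n^(7/4) leaves a factor n^(-1/4)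
  for Markov's inequality.\<close>

definition many_unbalanced :: "nat \<Rightarrow> nat set set \<Rightarrow> bool" where
  "many_unbalanced n E \<longleftrightarrow> real n powr (7/4) \<le> card (sampling.unbalanced_pairs n E (real n powr (3/4)))"

lemma many_unbalanced_unlikely:
  assumes n: "0 < n"
  shows "real (card {E. E \<subseteq> vertex_pairs {..<n} \<and> many_unbalanced n E}) \<le> 13 * real n powr (-1/4) * 2 ^ card (vertex_pairs {..<n})"
proof -
  let ?P = "vertex_pairs {..<n}"
  define D where "D = real n powr (3/4)"
  have D0: "0 < D" and D2: "D\<^sup>2 = real n powr (3/2)"
    using n by (auto simp: D_def power2_eq_square powr_add[symmetric])
  define g where "g = (\<lambda>E u v. (nbr_sum n E u)\<^sup>2 + (nbr_sum n E v)\<^sup>2 + (conbr_sum n E u v)\<^sup>2)"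
  define f where "f = (\<lambda>E. real n + (\<Sum>u<n. \<Sum>v\<in>{..<n} - {u}. g E u v / D\<^sup>2))"
  have le: "real (card (sampling.unbalanced_pairs n E D)) \<le> f E" if E: "E \<in> Pow ?P" for E
  proof -
    interpret sampling n E using n E by unfold_locales auto
    have "card (unbalanced_pairs D) = (\<Sum>u<n. card {v \<in> {..<n}. \<not> balanced D u v})"
    proof -
      have "unbalanced_pairs D = (SIGMA u:{..<n}. {v \<in> {..<n}. \<not> balanced D u v})"
        by (auto simp: unbalanced_pairs_def)
      then show ?thesis by (simp add: card_SigmaI)
    qed
    also have "real \<dots> = (\<Sum>u<n. \<Sum>v<n. of_bool (\<not> balanced D u v))"
      by (simp add: of_bool_def sum.If_cases Int_def)
    also have "\<dots> \<le> (\<Sum>u<n. 1 + (\<Sum>v\<in>{..<n} - {u}. g E u v / D\<^sup>2))"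
    proof (rule sum_mono)
      fix u assume u: "u \<in> {..<n}"
      have "(\<Sum>v<n. of_bool (\<not> balanced D u v)) = of_bool (\<not> balanced D u u) + (\<Sum>v\<in>{..<n} - {u}. of_bool (\<not> balanced D u v) :: real)"
        using u by (intro sum.remove) auto
      also have "\<dots> \<le> 1 + (\<Sum>v\<in>{..<n} - {u}. g E u v / D\<^sup>2)"
      proof (intro add_mono sum_mono)
        fix v
        show "of_bool (\<not> balanced D u v) \<le> g E u v / D\<^sup>2"
        proof (cases "balanced D u v")
          case False
          have sq: "D\<^sup>2 \<le> x\<^sup>2" if "\<not> \<bar>x\<bar> \<le> D" for x
            using that D0 by (intro abs_le_square_iff[THEN iffD1]) auto
          have "0 \<le> (nbr_sum n E u)\<^sup>2" "0 \<le> (nbr_sum n E v)\<^sup>2" "0 \<le> (conbr_sum n E u v)\<^sup>2" by auto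
          then have "D\<^sup>2 \<le> g E u v"
            using False sq[of "nbr_sum n E u"] sq[of "nbr_sum n E v"] sq[of "conbr_sum n E u v"]
            unfolding balanced_def g_def by linarith
          then show ?thesis using False D0 by (simp add: field_simps)
        qed (simp add: g_def)
      qed auto
      finally show "(\<Sum>v<n. of_bool (\<not> balanced D u v))
         \<le> 1 + (\<Sum>v\<in>{..<n} - {u}. g E u v / D\<^sup>2)" .
    qed
    also have "\<dots> = f E" by (simp add: f_def sum.distrib)
    finally show ?thesis .
  qed
  have f0: "0 \<le> f E" for E unfolding f_def g_def by (intro add_nonneg_nonneg sum_nonneg divide_nonneg_nonneg) auto
  have "(\<Sum>E\<in>Pow ?P. f E) = n * 2 ^ card ?P + (\<Sum>u<n. \<Sum>v\<in>{..<n} - {u}. \<Sum>E\<in>Pow ?P. g E u v / D\<^sup>2)"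
  proof -
    have "(\<Sum>E\<in>Pow ?P. \<Sum>u<n. \<Sum>v\<in>{..<n} - {u}. g E u v / D\<^sup>2)
       = (\<Sum>u<n. \<Sum>v\<in>{..<n} - {u}. \<Sum>E\<in>Pow ?P. g E u v / D\<^sup>2)"
      by (subst sum.swap, intro sum.cong refl, rule sum.swap)
    then show ?thesis by (simp add: f_def sum.distrib card_Pow)
  qed
  also have "\<dots> \<le> n * 2 ^ card ?P + (\<Sum>u<n. \<Sum>v\<in>{..<n} - {u}. 12 * n * 2 ^ card ?P / D\<^sup>2)"
  proof (intro add_left_mono sum_mono)
    fix u v assume uv: "u \<in> {..<n}" "v \<in> {..<n} - {u}"
    have "(\<Sum>E\<in>Pow ?P. g E u v)
       \<le> n * 2 ^ card ?P + n * 2 ^ card ?P + (2 * n + 8) * 2 ^ card ?P"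
      using sum_nbr_sum_squared[of u n] sum_nbr_sum_squared[of v n] sum_conbr_sum_squared[of u n v] uv
      by (simp add: g_def sum.distrib)
    also have "\<dots> = (4 * real n + 8) * 2 ^ card ?P" by (simp add: algebra_simps)
    also have "\<dots> \<le> (12 * real n) * 2 ^ card ?P" using n by (intro mult_right_mono) auto
    finally show "(\<Sum>E\<in>Pow ?P. g E u v / D\<^sup>2)
        \<le> 12 * n * 2 ^ card ?P / D\<^sup>2"
      unfolding sum_divide_distrib[symmetric] by (intro divide_right_mono) auto
  qed
  also have "\<dots> \<le> n * 2 ^ card ?P + (\<Sum>u<n. \<Sum>v<n. 12 * n * 2 ^ card ?P / D\<^sup>2)"
    by (intro add_left_mono sum_mono sum_mono2) auto
  also have "\<dots> = (n + 12 * (n * n * n / D\<^sup>2)) * 2 ^ card ?P" by (simp add: algebra_simps)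
  also have "n * n * n / D\<^sup>2 = real n powr (3/2)"
  proof -
    have "real n powr 3 = real (n * n * n)" using n by (simp add: power3_eq_cube)
    then have "n * n * n / D\<^sup>2 = real n powr 3 / real n powr (3/2)" by (simp only: D2)
    also have "\<dots> = real n powr (3/2)" unfolding powr_diff[symmetric] by simp
    finally show ?thesis .
  qed
  also have "(n + 12 * real n powr (3/2)) * 2 ^ card ?P \<le> (13 * real n powr (3/2)) * 2 ^ card ?P"
  proof (intro mult_right_mono)
    have "real n powr 1 \<le> real n powr (3/2)" using n by (intro powr_mono) auto
    then show "n + 12 * real n powr (3/2) \<le> 13 * real n powr (3/2)" using n by simp
  qed auto
  finally have sumf: "(\<Sum>E\<in>Pow ?P. f E) \<le> (13 * real n powr (3/2)) * 2 ^ card ?P" .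
  have "card {E. E \<subseteq> ?P \<and> many_unbalanced n E} \<le> card {E \<in> Pow ?P. real n powr (7/4) \<le> f E}"
  proof (intro card_mono subsetI CollectI conjI)
    fix E assume "E \<in> {E. E \<subseteq> ?P \<and> many_unbalanced n E}"
    then have E: "E \<in> Pow ?P" "real n powr (7/4) \<le> card (sampling.unbalanced_pairs n E D)"
      by (auto simp: many_unbalanced_def D_def)
    show "E \<in> Pow ?P" by (rule E(1))
    show "real n powr (7/4) \<le> f E" using E(2) le[OF E(1)] by (rule order_trans)
  qed simp
  then have "real (card {E. E \<subseteq> ?P \<and> many_unbalanced n E}) \<le> real (card {E \<in> Pow ?P. real n powr (7/4) \<le> f E})" by simp
  also have "\<dots> \<le> (\<Sum>E\<in>Pow ?P. f E) / real n powr (7/4)" using f0 n by (intro card_markov) auto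
  also have "\<dots> \<le> (13 * real n powr (3/2)) * 2 ^ card ?P / real n powr (7/4)" using sumf by (intro divide_right_mono) auto
  also have "\<dots> = 13 * (real n powr (3/2) / real n powr (7/4)) * 2 ^ card ?P" by simp
  also have "real n powr (3/2) / real n powr (7/4) = real n powr (-1/4)" by (simp add: powr_diff[symmetric])
  finally show ?thesis by simp
qed

section \<open>A lower bound for binomial tails\<close>

text \<open>The single term at \<open>T\<close> suffices. The central coefficient is at least 2^a/(a
  + 1), at most 2 \<delta> a steps lead from it to \<open>T\<close>, and each multiplies the
  coefficient by at least \<open>c\<close>, where ln c >= - 6 \<delta> - 8 \<delta>^2 >= - 7
  \<delta>.\<close>

lemma binomial_tail_ge:
  fixes \<delta> :: real and a :: nat
  assumes \<delta>: "0 < \<delta>" "\<delta> \<le> 1/8" and a: "2 \<le> \<delta> * a"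
  defines "T \<equiv> nat \<lceil>(1/2 + \<delta>) * a\<rceil>"
  shows "exp (- 14 * \<delta>\<^sup>2 * a) / (a + 1) \<le> binomial_tail a T"
proof -
  define h where "h = a div 2"
  have a16: "16 \<le> real a" using mult_right_mono[OF \<delta>(2), of "real a"] a by simp
  have T: "(1/2 + \<delta>) * a \<le> T" "T \<le> (1/2 + \<delta>) * a + 1"
  proof -
    have "0 \<le> (1/2 + \<delta>) * a" using \<delta> by simp
    then show "(1/2 + \<delta>) * a \<le> T" "T \<le> (1/2 + \<delta>) * a + 1" unfolding T_def by linarith+
  qed
  have da: "\<delta> * a \<le> 1/8 * a" using \<delta> by (intro mult_right_mono) auto
  have hT: "h \<le> T"
  proof -
    have "real h \<le> real a / 2" unfolding h_def by linarith
    also have "\<dots> \<le> T" using T(1) a by (simp add: distrib_right)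
    finally show ?thesis by simp
  qed
  have "real T \<le> real a" using T(2) da a16 unfolding distrib_right by linarith
  then have Ta: "T \<le> a" by simp
  define c where "c = (1 - 2 * \<delta>) / (1 + 4 * \<delta>)"
  have c0: "0 < c" using \<delta> by (simp add: c_def)
  have step: "c * real (a choose j) \<le> real (a choose Suc j)" if j: "j < T" for j
  proof -
    have "Suc j * (a choose Suc j) = (a - j) * (a choose j)"
      by (simp only: binomial_absorb_comp binomial_absorption)
    then have "real (Suc j) * real (a choose Suc j) = real (a - j) * real (a choose j)"
      by (simp only: of_nat_mult[symmetric])
    then have "real (a choose Suc j) = real (a - j) / real (Suc j) * real (a choose j)" by (simp add: field_simps)
    moreover have "c \<le> real (a - j) / real (Suc j)"
    proof -
      have "(1/2 - \<delta>) * a \<le> a - (real T - 1)" using T by (simp add: algebra_simps)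
      also have "\<dots> \<le> real (a - j)" using j Ta by (simp add: of_nat_diff)
      finally have 1: "(1/2 - \<delta>) * a \<le> real (a - j)" .
      have 2: "real (Suc j) \<le> (1/2 + 2 * \<delta>) * a" using T a j by (simp add: algebra_simps)
      have "c = (1/2 - \<delta>) / (1/2 + 2 * \<delta>)" using \<delta> by (simp add: c_def divide_simps) (simp add: algebra_simps)
      also have "\<dots> = ((1/2 - \<delta>) * a) / ((1/2 + 2 * \<delta>) * a)" using a16 by simp
      also have "\<dots> \<le> real (a - j) / real (Suc j)" using 1 2 \<delta> by (intro frac_le) auto
      finally show ?thesis .
    qed
    ultimately show ?thesis by (simp only: mult_right_mono of_nat_0_le_iff)
  qed
  have "c ^ i * real (a choose h) \<le> real (a choose (h + i))" if "h + i \<le> T" for i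
    using that
  proof (induction i)
    case (Suc i)
    have "c ^ Suc i * real (a choose h) = c * (c ^ i * real (a choose h))" by simp
    also have "\<dots> \<le> c * real (a choose (h + i))" using Suc c0 by (intro mult_left_mono) auto
    also have "\<dots> \<le> real (a choose Suc (h + i))" using Suc by (intro step) auto
    finally show ?case by simp
  qed simp
  from this[of "T - h"] have "c ^ (T - h) * real (a choose h) \<le> real (a choose T)" using hT by simp
  moreover have "2 ^ a / (a + 1) \<le> real (a choose h)"
  proof -
    have "(\<Sum>j\<le>a. a choose j) \<le> (\<Sum>j\<le>a. a choose h)" unfolding h_def by (intro sum_mono binomial_maximum)
    then have "real (2 ^ a) \<le> real ((a + 1) * (a choose h))" by (simp only: choose_row_sum sum_constant card_atMost of_nat_le_iff) simp
    then show ?thesis by (simp add: field_simps)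
  qed
  moreover have "exp (- 14 * \<delta>\<^sup>2 * a) \<le> c ^ (T - h)"
  proof -
    have "ln (1 - 2 * \<delta>) \<ge> - (2 * \<delta>) - 2 * (2 * \<delta>)\<^sup>2" using \<delta> by (intro ln_one_minus_pos_lower_bound) auto
    moreover have "ln (1 + 4 * \<delta>) \<le> 4 * \<delta>" using \<delta> by (intro ln_add_one_self_le_self) auto
    moreover have "ln c = ln (1 - 2 * \<delta>) - ln (1 + 4 * \<delta>)" using \<delta> by (simp add: c_def ln_div)
    moreover have "8 * \<delta>\<^sup>2 \<le> \<delta>" using \<delta> by (simp add: power2_eq_square)
    ultimately have lnc: "- 7 * \<delta> \<le> ln c" by (simp add: power_mult_distrib)
    have "real (T - h) \<le> 2 * (\<delta> * a)"
    proof -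
      have "real a / 2 - 1/2 \<le> real h" unfolding h_def by linarith
      then show ?thesis using T(2) a hT by (simp add: of_nat_diff algebra_simps)
    qed
    then have "real (T - h) * (7 * \<delta>) \<le> 2 * (\<delta> * a) * (7 * \<delta>)" using \<delta> by (intro mult_right_mono) auto
    then have "- 14 * \<delta>\<^sup>2 * a \<le> real (T - h) * (- 7 * \<delta>)" by (simp add: power2_eq_square algebra_simps)
    also have "\<dots> \<le> real (T - h) * ln c" by (intro mult_left_mono lnc) auto
    finally have "exp (- 14 * \<delta>\<^sup>2 * a) \<le> exp (real (T - h) * ln c)" by simp
    then show ?thesis using c0 by (simp add: exp_of_nat_mult)
  qed
  ultimately have "exp (- 14 * \<delta>\<^sup>2 * a) * (2 ^ a / (a + 1)) \<le> real (a choose T)"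
    using c0 by (smt (verit) mult_mono exp_ge_zero divide_nonneg_nonneg of_nat_0_le_iff zero_le_power)
  also have "\<dots> \<le> (\<Sum>j=T..a. real (a choose j))" using Ta by (intro member_le_sum) auto
  finally show ?thesis unfolding binomial_tail_def by (simp add: field_simps)
qed

section \<open>Asymptotics\<close>

text \<open>The exponents come from \<rho> >= n^(-1/64), that is 1/\<rho>^2 <= n^(1/32): 57/32 = 7/4
  + 1/32, 29/16 = 57/32 + 1/32, -7/32 = -1/4 + 1/32, 63/64 = 1 - 1/64 and 13/8000 = 1/64 -
  14/1000.\<close>

definition large :: "nat \<Rightarrow> bool" where
  "large n \<longleftrightarrow> 6 \<le> n \<and> 1000 \<le> ln (real n) \<and> 1 < ln (ln (real n)) \<and>
    1 + ln n * (41 * ln n ^ 3 * real n powr (57/32) + 1640 * ln n ^ 6 * real n powr (29/16)) \<le> (real n)\<^sup>2 / (2 * ln n ^ 3) \<and>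
    ln n * (1 + 120 * ln n ^ 3) * exp (- ((ln (ln n))\<^sup>2 / 32)) \<le> 1 / (2 * ln n ^ 3) \<and>
    16 * ln n ^ 3 * real n powr (-7/32) \<le> 1 \<and>
    ln n ^ 2 \<le> real n powr (63/64) \<and>
    ln n ^ 2 + 1 \<le> real n powr (13/8000) \<and>
    1 + (real n)\<^sup>2 * exp (- ((ln (ln n))\<^sup>2)) + ln n \<le> (real n)\<^sup>2 / (ln n)\<^sup>2 \<and>
    ln n \<le> real n"

lemma eventually_large: "eventually large sequentially"
proof -
  have "eventually (\<lambda>n::nat. 6 \<le> n) sequentially" by (rule eventually_ge_at_top)
  moreover have "eventually (\<lambda>n::nat. 1000 \<le> ln (real n)) sequentially" by real_asymp
  moreover have "eventually (\<lambda>n::nat. 1 < ln (ln (real n))) sequentially" by real_asymp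
  moreover have "eventually (\<lambda>n::nat. 1 + ln n * (41 * ln n ^ 3 * real n powr (57/32) + 1640 * ln n ^ 6 * real n powr (29/16))
      \<le> (real n)\<^sup>2 / (2 * ln n ^ 3)) sequentially" by real_asymp
  moreover have "eventually (\<lambda>n::nat. ln n * (1 + 120 * ln n ^ 3) * exp (- ((ln (ln n))\<^sup>2 / 32)) \<le> 1 / (2 * ln n ^ 3)) sequentially"
    by real_asymp
  moreover have "eventually (\<lambda>n::nat. 16 * ln n ^ 3 * real n powr (-7/32) \<le> 1) sequentially" by real_asymp
  moreover have "eventually (\<lambda>n::nat. ln n ^ 2 \<le> real n powr (63/64)) sequentially" by real_asymp
  moreover have "eventually (\<lambda>n::nat. ln n ^ 2 + 1 \<le> real n powr (13/8000)) sequentially" by real_asymp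
  moreover have "eventually (\<lambda>n::nat. 1 + (real n)\<^sup>2 * exp (- ((ln (ln n))\<^sup>2)) + ln n \<le> (real n)\<^sup>2 / (ln n)\<^sup>2) sequentially" by real_asymp
  moreover have "eventually (\<lambda>n::nat. ln n \<le> real n) sequentially" by real_asymp
  ultimately show ?thesis by eventually_elim (simp add: large_def)
qed

text \<open>The main term is the number of sets. The repairs of exceptional good pairs
  (\<open>t2\<close>) and those of bad pairs together with rounding (\<open>t3\<close>) cost at most
  N^2/(2 l^3) each, which together is at most L^4 N^2/(k l^2) since k <= l.\<close>

lemma theta_le_large_k:
  assumes n: "large n" and E: "E \<subseteq> vertex_pairs {..<n}" and bal: "\<not> many_unbalanced n E"
    and k: "64 * (ln (ln (real n)))\<^sup>2 \<le> real k" "real k \<le> ln (real n)"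
  shows "real (theta k {..<n} E) \<le> 8000001 * ((ln (ln (real n))) ^ 4 * (real n)\<^sup>2 / (real k * (ln (real n))\<^sup>2))"
proof -
  define l where "l = ln (real n)"
  define L where "L = ln l"
  define N where "N = real n"
  have l: "1000 \<le> l" and L: "1 < L" and N6: "6 \<le> N"
    using n by (auto simp: large_def l_def L_def N_def)
  have F1: "1 + l * (41 * l ^ 3 * N powr (57/32) + 1640 * l ^ 6 * N powr (29/16)) \<le> N\<^sup>2 / (2 * l ^ 3)"
    and F2: "l * (1 + 120 * l ^ 3) * exp (- (L\<^sup>2 / 32)) \<le> 1 / (2 * l ^ 3)"
    and F3: "16 * l ^ 3 * N powr (-7/32) \<le> 1" and F4: "l ^ 2 \<le> N powr (63/64)"
    and F5: "l ^ 2 + 1 \<le> N powr (13/8000)"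
    using n by (auto simp: large_def l_def L_def N_def)
  have kL: "64 * L\<^sup>2 \<le> k" "k \<le> l" using k by (auto simp: l_def L_def)
  have L2: "1 \<le> L\<^sup>2" using L by simp
  have k64: "64 \<le> real k" using kL L2 by linarith
  have k0: "0 < real k" using k64 by simp
  \<comment> \<open>With this choice exp (- k \<delta>^2/32) = exp (- L^2/32) is smaller than every
    power of 1/l, and 64 L^2 <= k puts \<delta> into the range of
    \<open>binomial_tail_ge\<close>.\<close>
  define \<delta> where "\<delta> = L / sqrt k"
  have sk: "8 * L \<le> sqrt k"
    by (rule real_le_rsqrt) (use kL in \<open>simp add: power_mult_distrib\<close>)
  have \<delta>: "0 < \<delta>" "\<delta> \<le> 1/8" using sk L k0 by (auto simp: \<delta>_def field_simps)
  have \<delta>2: "\<delta>\<^sup>2 * k = L\<^sup>2" using k0 by (simp add: \<delta>_def power_divide)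
  have \<delta>l: "1 / l \<le> \<delta>"
  proof -
    have "sqrt k \<le> k" using k64 real_sqrt_le_mono[of k "k * k"] by simp
    then have "sqrt k \<le> l" using kL by linarith
    then have "1 / l \<le> 1 / sqrt k" using k0 l by (intro divide_left_mono mult_pos_pos) auto
    also have "\<dots> \<le> \<delta>" unfolding \<delta>_def using L by (intro divide_right_mono) auto
    finally show ?thesis .
  qed
  \<comment> \<open>The factor 1/1000 gives \<delta>^2 a <= l/1000, hence a tail of at least
    n^(-14/1000)/(a + 1), and 14/1000 < 1/64.\<close>
  define A where "A = l * k / (1000 * L\<^sup>2)"
  define a where "a = nat \<lfloor>A\<rfloor>"
  have A64: "64 \<le> A"
  proof -
    have "64 * (1000 * L\<^sup>2) \<le> l * k" using mult_mono[OF l kL(1)] L2 l by simp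
    moreover have "0 < 1000 * L\<^sup>2" using L2 by linarith
    ultimately show ?thesis unfolding A_def by (simp only: pos_le_divide_eq)
  qed
  have aA: "a \<le> A" "A / 2 \<le> a"
  proof -
    show "a \<le> A" using A64 by (simp add: a_def)
    have "A - 1 \<le> a" using A64 unfolding a_def by linarith
    then show "A / 2 \<le> a" using A64 by linarith
  qed
  have a1: "1 \<le> real a" using aA A64 by linarith
  have al: "real a \<le> l\<^sup>2"
  proof -
    have "A \<le> l * k / 1" unfolding A_def using l k0 L2 by (intro divide_left_mono) auto
    also have "\<dots> \<le> l * l" using kL l by simp
    finally show ?thesis using aA by (simp add: power2_eq_square)
  qed
  have \<delta>a: "\<delta>\<^sup>2 * a \<le> l / 1000"
  proof -
    have "\<delta>\<^sup>2 * a \<le> \<delta>\<^sup>2 * A" using aA by (intro mult_left_mono) auto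
    also have "\<dots> = (\<delta>\<^sup>2 * k) * l / (1000 * L\<^sup>2)" by (simp add: A_def)
    also have "\<dots> = l / 1000" unfolding \<delta>2 using L by simp
    finally show ?thesis .
  qed
  have \<delta>a2: "2 \<le> \<delta> * a"
  proof -
    have "\<delta> * A = (l / (1000 * L)) * (k / sqrt k)" using L by (simp add: A_def \<delta>_def power2_eq_square)
    also have "k / sqrt k = sqrt k" using k0 by (simp add: real_div_sqrt)
    finally have "\<delta> * A = (l / (1000 * L)) * sqrt k" .
    moreover have "(l / (1000 * L)) * (8 * L) \<le> (l / (1000 * L)) * sqrt k" using sk l L by (intro mult_left_mono) auto
    ultimately have "8 \<le> \<delta> * A" using l L by simp
    moreover have "\<delta> * (A / 2) \<le> \<delta> * a" using aA \<delta> by (intro mult_left_mono) auto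
    ultimately show ?thesis by simp
  qed
  define T where "T = nat \<lceil>(1/2 + \<delta>) * a\<rceil>"
  have T: "(1/2 + \<delta>) * a \<le> T" unfolding T_def by linarith
  define \<rho> where "\<rho> = binomial_tail a T"
  define R where "R = N powr (1/32)"
  have R1: "1 \<le> R" using N6 by (simp add: R_def ge_one_powr_ge_zero)
  have \<rho>_ge: "N powr (-1/64) \<le> \<rho>"
  proof -
    have "N powr (-1/64) = N powr (-14/1000) / N powr (13/8000)"
      unfolding powr_diff[symmetric] by simp
    also have "\<dots> \<le> exp (- 14 * \<delta>\<^sup>2 * a) / (real a + 1)"
    proof (intro frac_le)
      have "N powr (-14/1000) = exp (- 14 * (l / 1000))" using N6 by (simp add: powr_def l_def N_def)
      also have "\<dots> \<le> exp (- 14 * (\<delta>\<^sup>2 * a))" unfolding exp_le_cancel_iff using \<delta>a by linarith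
      finally show "N powr (-14/1000) \<le> exp (- 14 * \<delta>\<^sup>2 * a)" by (simp add: mult.assoc)
    qed (use al F5 a1 in auto)
    also have "\<dots> \<le> \<rho>" unfolding \<rho>_def T_def using binomial_tail_ge[OF \<delta> \<delta>a2] by (simp only: of_nat_add of_nat_1)
    finally show ?thesis .
  qed
  have \<rho>0: "0 < \<rho>" using \<rho>_ge N6 by (smt (verit) powr_gt_zero)
  have R: "1 / \<rho>\<^sup>2 \<le> R"
  proof -
    have "1 / \<rho>\<^sup>2 \<le> 1 / (N powr (-1/64))\<^sup>2"
      using \<rho>_ge \<rho>0 N6 by (intro divide_left_mono power_mono) auto
    also have "\<dots> = R" using N6 by (simp add: R_def power2_eq_square powr_add[symmetric] powr_minus_divide)
    finally show ?thesis .
  qed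
  define D where "D = N powr (3/4)"
  define e where "e = 3 * real a * D / n"
  have e: "e = 3 * a * N powr (-1/4)"
  proof -
    have "D / N = N powr (3/4) / N powr 1" using N6 by (simp add: D_def)
    also have "\<dots> = N powr (-1/4)" unfolding powr_diff[symmetric] by simp
    finally have "D / N = N powr (-1/4)" .
    moreover have "e = 3 * a * (D / N)" by (simp add: e_def N_def)
    ultimately show ?thesis by (simp only:)
  qed
  \<comment> \<open>Half of the allowance \<delta>/2 in \<open>small\<close> is reserved for
    discarded samples, the other half for imbalance and repeated samples.\<close>
  have "biased n E a T \<delta> D (\<delta> / 4)"
  proof unfold_locales
    show "0 < n" "2 \<le> n" using N6 by (auto simp: N_def)
    show "1 \<le> a" using a1 by simp
    show "1 \<le> T"
    proof -
      have "1/2 * 1 \<le> (1/2 + \<delta>) * a" using \<delta> a1 by (intro mult_mono) auto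
      then have "0 < real T" using T by linarith
      then show ?thesis by simp
    qed
    show "0 < binomial_tail a T" using \<rho>0 by (simp add: \<rho>_def)
    show "real a \<le> n * binomial_tail a T"
    proof -
      have "real a \<le> N powr (63/64)" using al F4 by linarith
      also have "\<dots> = N powr (1 + -1/64)" by simp
      also have "\<dots> = N * N powr (-1/64)" unfolding powr_add using N6 by simp
      also have "\<dots> \<le> N * \<rho>" using \<rho>_ge N6 by (intro mult_left_mono) auto
      finally show ?thesis by (simp add: N_def \<rho>_def)
    qed
    show "1 + 2 * \<delta> \<le> 2 * real T / real a" using T a1 by (simp add: field_simps)
    show "(3 * real a * D / n + a / n) / (binomial_tail a T)\<^sup>2 + \<delta> / 4 \<le> \<delta> / 2"
    proof -
      have "1 / N = N powr (-1)" using N6 by (simp add: powr_minus_divide)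
      also have "\<dots> \<le> N powr (-1/4)" using N6 by (intro powr_mono) auto
      finally have "a * (1 / N) \<le> a * N powr (-1/4)" by (rule mult_left_mono) simp
      then have "e + a / n \<le> 4 * a * N powr (-1/4)" by (simp add: e N_def)
      also have "\<dots> \<le> 4 * l\<^sup>2 * N powr (-1/4)" using al by (intro mult_right_mono mult_left_mono) auto
      finally have "(e + a / n) * (1 / \<rho>\<^sup>2) \<le> (4 * l\<^sup>2 * N powr (-1/4)) * R"
        using R by (intro mult_mono) auto
      also have "\<dots> = 4 * l\<^sup>2 * N powr (-7/32)" by (simp add: R_def powr_add[symmetric])
      also have "\<dots> \<le> 1 / l / 4" using F3 l by (simp add: field_simps power2_eq_square power3_eq_cube)
      also have "\<dots> \<le> \<delta> / 4" using \<delta>l by (intro divide_right_mono) auto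
      finally have "(e + a / n) / \<rho>\<^sup>2 \<le> \<delta> / 4" by simp
      then have "(e + a / n) / \<rho>\<^sup>2 + \<delta> / 4 \<le> \<delta> / 2" by linarith
      then show ?thesis by (simp only: e_def \<rho>_def)
    qed
  qed (use E \<delta> in \<open>auto simp: D_def\<close>)
  then interpret biased n E a T \<delta> D "\<delta> / 4" .
  define U where "U = real (card (unbalanced_pairs D))"
  have U: "U \<le> N powr (7/4)" using bal by (simp add: many_unbalanced_def U_def D_def N_def)
  define B where "B = U + (3 * e * (real n)\<^sup>2 + U) / (\<rho>\<^sup>2 * (\<delta> / 4))"
  have B: "B \<le> 41 * l ^ 3 * N powr (57/32)"
  proof -
    have "N\<^sup>2 = N powr 2" using N6 by simp
    then have "N powr (-1/4) * N\<^sup>2 = N powr (7/4)" by (simp only: powr_add[symmetric]) simp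
    then have e2: "3 * e * (real n)\<^sup>2 = 9 * a * N powr (7/4)" by (simp add: e N_def)
    have "3 * e * (real n)\<^sup>2 + U \<le> 9 * l\<^sup>2 * N powr (7/4) + l\<^sup>2 * N powr (7/4)"
    proof (intro add_mono)
      show "3 * e * (real n)\<^sup>2 \<le> 9 * l\<^sup>2 * N powr (7/4)" unfolding e2 using al by (intro mult_right_mono) auto
      have "1 * N powr (7/4) \<le> l\<^sup>2 * N powr (7/4)" using l by (intro mult_right_mono) auto
      then show "U \<le> l\<^sup>2 * N powr (7/4)" using U by linarith
    qed
    then have "(3 * e * (real n)\<^sup>2 + U) * (4 * (1 / \<delta>)) * (1 / \<rho>\<^sup>2) \<le> (10 * l\<^sup>2 * N powr (7/4)) * (4 * l) * R"
    proof (intro mult_mono R)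
      show "1 / \<delta> \<le> l" using \<delta>l \<delta> l by (simp add: field_simps)
    qed (use \<delta> l U in \<open>auto simp: e U_def\<close>)
    then have "(3 * e * (real n)\<^sup>2 + U) / (\<rho>\<^sup>2 * (\<delta> / 4)) \<le> 40 * l ^ 3 * (N powr (7/4) * R)"
      by (simp add: mult_ac power2_eq_square power3_eq_cube)
    moreover have "U \<le> l ^ 3 * (N powr (7/4) * R)"
    proof -
      have "1 * (N powr (7/4) * 1) \<le> l ^ 3 * (N powr (7/4) * R)" using l R1 by (intro mult_mono) auto
      then show ?thesis using U by simp
    qed
    moreover have "N powr (7/4) * R = N powr (57/32)" by (simp add: R_def powr_add[symmetric])
    ultimately show ?thesis by (simp add: B_def)
  qed
  have B0: "0 \<le> B" unfolding B_def U_def using \<delta> by (simp add: e)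
  have main: "real (theta k {..<n} E) \<le> 2 * k * N\<^sup>2 / (real a)\<^sup>2 + 1
     + k * (B + N\<^sup>2 * (exp (- (k * \<delta>\<^sup>2 / 32)) * (1 + 60 * a * (k + 1))) + 20 * a * (k + 1) * B / \<rho>\<^sup>2)"
    using theta_le_biased[of k] k64 unfolding B_def U_def e_def \<rho>_def N_def by simp
  \<comment> \<open>8000000 = 2 * (2 * 1000)^2; the inner factor 2 is the loss in rounding
    \<open>A\<close> down to \<open>a\<close>.\<close>
  have t1: "2 * k * N\<^sup>2 / (real a)\<^sup>2 \<le> 8000000 * (L ^ 4 * N\<^sup>2 / (k * l\<^sup>2))"
  proof -
    have "2 * k * N\<^sup>2 / (real a)\<^sup>2 \<le> 2 * k * N\<^sup>2 / (A / 2)\<^sup>2"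
      using aA A64 by (intro divide_left_mono power_mono mult_pos_pos) auto
    also have "\<dots> = 8000000 * (L ^ 4 * N\<^sup>2 / (k * l\<^sup>2))"
      unfolding A_def using l k0 L by (simp add: field_simps power2_eq_square power4_eq_xxxx)
    finally show ?thesis .
  qed
  have ak: "real a * (real k + 1) \<le> 2 * l ^ 3"
  proof -
    have "real k + 1 \<le> 2 * l" using kL l by linarith
    then have "real a * (real k + 1) \<le> l\<^sup>2 * (2 * l)" using al by (intro mult_mono) auto
    then show ?thesis by (simp add: power2_eq_square power3_eq_cube)
  qed
  have t2: "k * (N\<^sup>2 * (exp (- (k * \<delta>\<^sup>2 / 32)) * (1 + 60 * a * (k + 1)))) \<le> N\<^sup>2 / (2 * l ^ 3)"
  proof -
    have "k * (N\<^sup>2 * (exp (- (k * \<delta>\<^sup>2 / 32)) * (1 + 60 * a * (k + 1))))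
       = N\<^sup>2 * (k * (1 + 60 * (real a * (real k + 1))) * exp (- (L\<^sup>2 / 32)))"
      using \<delta>2 by (simp add: mult_ac)
    also have "\<dots> \<le> N\<^sup>2 * (l * (1 + 120 * l ^ 3) * exp (- (L\<^sup>2 / 32)))"
      using kL ak l by (intro mult_left_mono mult_right_mono mult_mono) auto
    also have "\<dots> \<le> N\<^sup>2 * (1 / (2 * l ^ 3))" by (intro mult_left_mono F2) auto
    finally show ?thesis by simp
  qed
  have t3: "1 + k * (B + 20 * a * (k + 1) * B / \<rho>\<^sup>2) \<le> N\<^sup>2 / (2 * l ^ 3)"
  proof -
    have "20 * a * (k + 1) * B / \<rho>\<^sup>2 = 20 * (real a * (real k + 1)) * B * (1 / \<rho>\<^sup>2)" by (simp add: mult_ac)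
    also have "\<dots> \<le> 20 * (2 * l ^ 3) * (41 * l ^ 3 * N powr (57/32)) * R"
      by (rule mult_mono[OF mult_mono[OF mult_left_mono[OF ak] B] R]) (use B0 l in auto)
    also have "\<dots> = 1640 * l ^ 6 * (N powr (57/32) * R)" by (simp add: power3_eq_cube numeral_eq_Suc)
    also have "N powr (57/32) * R = N powr (29/16)" by (simp add: R_def powr_add[symmetric])
    finally have "B + 20 * a * (k + 1) * B / \<rho>\<^sup>2 \<le> 41 * l ^ 3 * N powr (57/32) + 1640 * l ^ 6 * N powr (29/16)"
      using B by linarith
    then have "k * (B + 20 * a * (k + 1) * B / \<rho>\<^sup>2) \<le> l * (41 * l ^ 3 * N powr (57/32) + 1640 * l ^ 6 * N powr (29/16))"
      using kL B0 \<rho>0 by (intro mult_mono) auto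
    then show ?thesis using F1 by linarith
  qed
  have t4: "N\<^sup>2 / l ^ 3 \<le> L ^ 4 * N\<^sup>2 / (k * l\<^sup>2)"
  proof -
    have "N\<^sup>2 / l ^ 3 = 1 * N\<^sup>2 / (l * l\<^sup>2)" by (simp add: power2_eq_square power3_eq_cube)
    also have "\<dots> \<le> L ^ 4 * N\<^sup>2 / (k * l\<^sup>2)"
      using kL L l k0 by (intro frac_le mult_right_mono) auto
    finally show ?thesis .
  qed
  have "k * (B + N\<^sup>2 * (exp (- (k * \<delta>\<^sup>2 / 32)) * (1 + 60 * a * (k + 1))) + 20 * a * (k + 1) * B / \<rho>\<^sup>2)
     = k * (B + 20 * a * (k + 1) * B / \<rho>\<^sup>2) + k * (N\<^sup>2 * (exp (- (k * \<delta>\<^sup>2 / 32)) * (1 + 60 * a * (k + 1))))"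
    by (simp only: distrib_left)
  then have "real (theta k {..<n} E) \<le> 8000000 * (L ^ 4 * N\<^sup>2 / (k * l\<^sup>2)) + N\<^sup>2 / (2 * l ^ 3) + N\<^sup>2 / (2 * l ^ 3)"
    using main t1 t2 t3 by linarith
  moreover have "N\<^sup>2 / (2 * l ^ 3) + N\<^sup>2 / (2 * l ^ 3) = N\<^sup>2 / l ^ 3" by simp
  moreover have "x \<le> 8000000 * w + p + p \<Longrightarrow> p + p = v \<Longrightarrow> v \<le> w \<Longrightarrow> x \<le> 8000001 * w" for x w p v :: real
    by linarith
  ultimately have "real (theta k {..<n} E) \<le> 8000001 * (L ^ 4 * N\<^sup>2 / (k * l\<^sup>2))"
    using t4 by blast
  then show ?thesis by (simp only: l_def L_def N_def)
qed

text \<open>Then 2^t <= exp t <= n^(1/4), so n/2^t, the expected number of common neighbours, stays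
  at least n^(3/4) throughout.\<close>

definition clique_size :: "nat \<Rightarrow> nat" where "clique_size n = nat \<lfloor>ln (real n) / 4\<rfloor>"

lemma clique_size_bounds:
  assumes "large n"
  shows "ln (real n) / 8 + 1 \<le> real (clique_size n)" "real (clique_size n) \<le> ln (real n) / 4"
    "2 \<le> clique_size n" "clique_size n \<le> n"
proof -
  have l: "1000 \<le> ln (real n)" "ln (real n) \<le> real n" using assms by (auto simp: large_def)
  show 1: "ln (real n) / 8 + 1 \<le> real (clique_size n)" "real (clique_size n) \<le> ln (real n) / 4"
    using l unfolding clique_size_def by linarith+
  then have "2 \<le> real (clique_size n)" "real (clique_size n) \<le> real n" using l by linarith+
  then show "2 \<le> clique_size n" "clique_size n \<le> n" by simp_all
qed

lemma theta_le_small_k: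
  assumes n: "large n" and E: "E \<subseteq> vertex_pairs {..<n}" and ext: "extensible n (clique_size n) E"
    and k: "1 \<le> k" "real k \<le> ln (real n)"
  shows "real (theta k {..<n} E) \<le> 65 * ((ln (ln (real n)))\<^sup>2 * (real n)\<^sup>2 / (ln (real n))\<^sup>2)"
proof -
  define l where "l = ln (real n)"
  define L where "L = ln l"
  define N where "N = real n"
  define t where "t = clique_size n"
  have l: "1000 \<le> l" and L: "1 < L" and N6: "6 \<le> N"
    and F6: "1 + N\<^sup>2 * exp (- (L\<^sup>2)) + l \<le> N\<^sup>2 / l\<^sup>2"
    using n by (auto simp: large_def l_def L_def N_def)
  have t: "l / 8 + 1 \<le> t" using clique_size_bounds[OF n] by (simp add: t_def l_def)
  define \<phi> where "\<phi> = real t * (real t - 1) / N\<^sup>2"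
  have tt: "l\<^sup>2 / 64 \<le> real t * (real t - 1)"
  proof -
    have "(l / 8) * (l / 8) \<le> real t * (real t - 1)" using t l by (intro mult_mono) auto
    then show ?thesis by (simp add: power2_eq_square)
  qed
  have "0 < l\<^sup>2 / 64" using l by simp
  then have tpos: "0 < real t * (real t - 1)" using tt by linarith
  then have \<phi>: "0 < \<phi>" unfolding \<phi>_def using N6 by (intro divide_pos_pos) auto
  \<comment> \<open>So many greedy steps leave at most exp (- L^2) N^2 edges, which is below
    N^2/l^2, while \<phi> >= l^2/(64 N^2) keeps \<open>m\<close> at most 64 L^2 N^2/l^2 + 1.\<close>
  define m where "m = nat \<lceil>L\<^sup>2 / \<phi>\<rceil>"
  have m: "L\<^sup>2 / \<phi> \<le> m" "m \<le> L\<^sup>2 / \<phi> + 1"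
  proof -
    have "0 \<le> L\<^sup>2 / \<phi>" using \<phi> by simp
    then show "L\<^sup>2 / \<phi> \<le> m" "m \<le> L\<^sup>2 / \<phi> + 1" unfolding m_def by linarith+
  qed
  have "real (theta k {..<n} E) \<le> m + exp (- \<phi> * m) * N\<^sup>2 + k"
    using theta_le_extensible[OF E ext clique_size_bounds(3,4)[OF n] k(1), of m] by (simp add: \<phi>_def t_def N_def)
  moreover have "exp (- \<phi> * m) * N\<^sup>2 \<le> N\<^sup>2 * exp (- (L\<^sup>2))"
  proof -
    have "L\<^sup>2 \<le> \<phi> * m" using m(1) \<phi> by (simp add: field_simps)
    then have "exp (- \<phi> * m) \<le> exp (- (L\<^sup>2))" by simp
    then show ?thesis by (simp add: mult.commute mult_left_mono)
  qed
  moreover have "m \<le> 64 * (L\<^sup>2 * N\<^sup>2 / l\<^sup>2) + 1"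
  proof -
    have "L\<^sup>2 / \<phi> = L\<^sup>2 * N\<^sup>2 / (real t * (real t - 1))" by (simp add: \<phi>_def)
    also have "\<dots> \<le> L\<^sup>2 * N\<^sup>2 / (l\<^sup>2 / 64)" using tt tpos l by (intro divide_left_mono mult_pos_pos[OF tpos]) auto
    also have "\<dots> = 64 * (L\<^sup>2 * N\<^sup>2 / l\<^sup>2)" by simp
    finally show ?thesis using m(2) by linarith
  qed
  moreover have "N\<^sup>2 / l\<^sup>2 \<le> L\<^sup>2 * N\<^sup>2 / l\<^sup>2"
  proof -
    have "1 * N\<^sup>2 / l\<^sup>2 \<le> L\<^sup>2 * N\<^sup>2 / l\<^sup>2" using L by (intro divide_right_mono mult_right_mono) auto
    then show ?thesis by simp
  qed
  moreover have "real k \<le> l" using k(2) by (simp add: l_def)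
  ultimately have "real (theta k {..<n} E) \<le> 65 * (L\<^sup>2 * N\<^sup>2 / l\<^sup>2)" using F6 by linarith
  then show ?thesis by (simp only: l_def L_def N_def)
qed

section \<open>The two regimes of k combined, and the error probabilities\<close>

lemma theta_upper:
  fixes \<epsilon> :: real
  assumes n: "large n" and E: "E \<subseteq> vertex_pairs {..<n}" and bal: "\<not> many_unbalanced n E"
    and ext: "extensible n (clique_size n) E" and \<epsilon>: "0 < \<epsilon>"
    and k: "ln (ln (real n)) powr (1 / \<epsilon>) \<le> real k" "real k \<le> ln (real n)"
  shows "real (theta k {..<n} E) \<le> 10000000 * (real n)\<^sup>2 / (real k powr (1 - 4 * \<epsilon>) * (ln (real n))\<^sup>2)"
proof -
  define L where "L = ln (ln (real n))"
  define Y where "Y = (real n)\<^sup>2 / (ln (real n))\<^sup>2"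
  have L: "1 < L" using n by (auto simp: large_def L_def)
  have k1: "1 < real k"
  proof -
    have "1 < L powr (1 / \<epsilon>)" using L \<epsilon> by (simp add: gr_one_powr)
    then show ?thesis using k(1) by (simp add: L_def)
  qed
  have kL: "L ^ 4 \<le> real k powr (4 * \<epsilon>)"
  proof -
    have "L ^ 4 = L powr 4" using L by simp
    also have "\<dots> = (L powr (1 / \<epsilon>)) powr (4 * \<epsilon>)" using \<epsilon> by (simp add: powr_powr)
    also have "\<dots> \<le> real k powr (4 * \<epsilon>)" using k(1) \<epsilon> by (intro powr_mono2) (auto simp: L_def)
    finally show ?thesis .
  qed
  have rhs: "10000000 * (real n)\<^sup>2 / (real k powr (1 - 4 * \<epsilon>) * (ln (real n))\<^sup>2)
      = 10000000 * (real k powr (4 * \<epsilon>) / k) * Y"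
    using k1 by (simp add: Y_def powr_diff field_simps)
  have Y0: "0 \<le> Y" by (simp add: Y_def)
  show ?thesis
  proof (cases "64 * L\<^sup>2 \<le> real k")
    case True
    have "real (theta k {..<n} E) \<le> 8000001 * (L ^ 4 / k * Y)"
      using theta_le_large_k[OF n E bal _ k(2)] True by (simp add: L_def Y_def)
    also have "\<dots> \<le> 10000000 * (real k powr (4 * \<epsilon>) / k * Y)"
      using kL k1 Y0 L by (intro mult_mono divide_right_mono) auto
    finally show ?thesis unfolding rhs by simp
  next
    case False
    have "real (theta k {..<n} E) \<le> 65 * (L\<^sup>2 * Y)"
      using theta_le_small_k[OF n E ext _ k(2)] k1 by (simp add: L_def Y_def)
    also have "\<dots> \<le> 65 * ((64 * (L ^ 4 / k)) * Y)"
    proof (intro mult_left_mono mult_right_mono Y0)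
      have "L\<^sup>2 * k \<le> L\<^sup>2 * (64 * L\<^sup>2)" using False by (intro mult_left_mono) auto
      then show "L\<^sup>2 \<le> 64 * (L ^ 4 / k)" using k1 by (simp add: field_simps power2_eq_square power4_eq_xxxx)
    qed auto
    also have "\<dots> = 4160 * (L ^ 4 / k * Y)" by simp
    also have "\<dots> \<le> 10000000 * (real k powr (4 * \<epsilon>) / k * Y)"
      using kL k1 Y0 L by (intro mult_mono divide_right_mono) auto
    finally show ?thesis unfolding rhs by simp
  qed
qed

text \<open>One error sequence for both halves: the first two terms come from the lower bound, the
  other two from unbalanced and from non-extensible graphs.\<close>

definition failure :: "nat \<Rightarrow> real" where
  "failure n = 2 / real n + exp (- real n) + 13 * real n powr (-1/4)
     + 2 * exp (ln n * ln (real n + 1) + ln n - real n powr (3/4) / (2 * ln n ^ 3))"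

lemma failure_tendsto: "failure \<longlonglongrightarrow> 0"
  unfolding failure_def by real_asymp

text \<open>As t <= ln n/4, n/2^t is at least n^(3/4) and 128 t^3 at most 2 (ln n)^3. The resulting
  power of n outweighs the exponent of order (ln n)^2 from the union bound.\<close>

lemma not_extensible_prob:
  assumes "large n"
  shows "2 * (real n + 1) ^ clique_size n * exp (real (clique_size n) - (real n / 2 ^ clique_size n) / (128 * real (clique_size n) ^ 3))
     \<le> 2 * exp (ln n * ln (real n + 1) + ln n - real n powr (3/4) / (2 * ln n ^ 3))"
proof -
  define t where "t = clique_size n"
  define l where "l = ln (real n)"
  have l: "1000 \<le> l" and n: "6 \<le> n" using assms by (auto simp: large_def l_def)
  have t: "2 \<le> real t" "real t \<le> l / 4" using clique_size_bounds[OF assms] by (auto simp: t_def l_def)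
  have "(real n + 1) ^ t = exp (real t * ln (real n + 1))" by (simp add: exp_of_nat_mult)
  also have "\<dots> \<le> exp (l * ln (real n + 1))" using t l by (auto intro!: mult_right_mono)
  finally have 1: "(real n + 1) ^ t \<le> exp (l * ln (real n + 1))" .
  have 2: "real n powr (3/4) / (2 * l ^ 3) \<le> (real n / 2 ^ t) / (128 * real t ^ 3)"
  proof (intro frac_le)
    have "(2::real) ^ t \<le> exp 1 ^ t" using exp_ge_add_one_self[of 1] by (intro power_mono) auto
    also have "\<dots> = exp (real t)" by (simp flip: exp_of_nat_mult)
    also have "\<dots> \<le> exp (l / 4)" using t by simp
    also have "\<dots> = real n powr (1/4)" using n by (simp add: l_def powr_def)
    finally have "real n / real n powr (1/4) \<le> real n / 2 ^ t" using n by (intro divide_left_mono) auto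
    moreover have "real n powr (3/4) = real n powr 1 / real n powr (1/4)" unfolding powr_diff[symmetric] by simp
    ultimately show "real n powr (3/4) \<le> real n / 2 ^ t" using n by simp
    have "real t ^ 3 \<le> (l / 4) ^ 3" using t by (intro power_mono) auto
    then show "128 * real t ^ 3 \<le> 2 * l ^ 3" by (simp add: power_divide)
  qed (use t in auto)
  have "2 * (real n + 1) ^ t * exp (real t - (real n / 2 ^ t) / (128 * real t ^ 3))
      \<le> 2 * exp (l * ln (real n + 1)) * exp (l - real n powr (3/4) / (2 * l ^ 3))"
    using 1 2 t l by (intro mult_mono mult_left_mono) auto
  also have "\<dots> = 2 * exp (l * ln (real n + 1) + l - real n powr (3/4) / (2 * l ^ 3))"
    by (simp add: exp_add[symmetric] algebra_simps)
  finally show ?thesis by (simp add: t_def l_def)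
qed

lemma theta_upper_bound:
  fixes \<epsilon> :: real and k :: nat
  assumes n: "large n" and \<epsilon>: "0 < \<epsilon>"
    and k: "ln (ln (real n)) powr (1 / \<epsilon>) \<le> real k" "real k \<le> ln (real n)"
  shows "1 - failure n \<le> measure_pmf.prob (random_graph n (1 / 2))
            {E. real (theta k {..<n} E) \<le> 10000000 * (real n)\<^sup>2 / (real k powr (1 - 4 * \<epsilon>) * (ln (real n))\<^sup>2)}"
proof (rule prob_random_graph_ge)
  let ?P = "vertex_pairs {..<n}"
  let ?Y = "{E. many_unbalanced n E} \<union> {E. \<not> extensible n (clique_size n) E}"
  show "E \<in> ?Y" if "E \<subseteq> ?P"
    "E \<notin> {E. real (theta k {..<n} E) \<le> 10000000 * (real n)\<^sup>2 / (real k powr (1 - 4 * \<epsilon>) * (ln (real n))\<^sup>2)}" for E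
    using theta_upper[OF n that(1) _ _ \<epsilon> k] that(2) by auto
  have n0: "0 < n" using n by (simp add: large_def)
  have "card {E. E \<subseteq> ?P \<and> E \<in> ?Y} \<le> card ({E. E \<subseteq> ?P \<and> many_unbalanced n E} \<union> {E. E \<subseteq> ?P \<and> \<not> extensible n (clique_size n) E})"
    by (intro card_mono) (auto intro: finite_subset[of _ "Pow ?P"])
  also have "\<dots> \<le> card {E. E \<subseteq> ?P \<and> many_unbalanced n E} + card {E. E \<subseteq> ?P \<and> \<not> extensible n (clique_size n) E}"
    by (rule card_Un_le)
  finally have "real (card {E. E \<subseteq> ?P \<and> E \<in> ?Y})
      \<le> real (card {E. E \<subseteq> ?P \<and> many_unbalanced n E}) + real (card {E. E \<subseteq> ?P \<and> \<not> extensible n (clique_size n) E})"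
    by linarith
  also have "\<dots> \<le> 13 * real n powr (-1/4) * 2 ^ card ?P
      + 2 * exp (ln n * ln (real n + 1) + ln n - real n powr (3/4) / (2 * ln n ^ 3)) * 2 ^ card ?P"
  proof (rule add_mono)
    show "real (card {E. E \<subseteq> ?P \<and> many_unbalanced n E}) \<le> 13 * real n powr (-1/4) * 2 ^ card ?P"
      by (rule many_unbalanced_unlikely[OF n0])
    have "real (card {E. E \<subseteq> ?P \<and> \<not> extensible n (clique_size n) E})
      \<le> 2 * (real n + 1) ^ clique_size n * exp (real (clique_size n) - (real n / 2 ^ clique_size n) / (128 * real (clique_size n) ^ 3)) * 2 ^ card ?P"
      using clique_size_bounds(3)[OF n] by (intro not_extensible_unlikely) auto
    also have "\<dots> \<le> 2 * exp (ln n * ln (real n + 1) + ln n - real n powr (3/4) / (2 * ln n ^ 3)) * 2 ^ card ?P"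
      by (intro mult_right_mono not_extensible_prob n) auto
    finally show "real (card {E. E \<subseteq> ?P \<and> \<not> extensible n (clique_size n) E})
      \<le> 2 * exp (ln n * ln (real n + 1) + ln n - real n powr (3/4) / (2 * ln n ^ 3)) * 2 ^ card ?P" .
  qed
  also have "\<dots> = (13 * real n powr (-1/4) + 2 * exp (ln n * ln (real n + 1) + ln n - real n powr (3/4) / (2 * ln n ^ 3))) * 2 ^ card ?P"
    by (simp only: distrib_right)
  also have "\<dots> \<le> failure n * 2 ^ card ?P"
    unfolding failure_def by (intro mult_right_mono) auto
  finally show "real (card {E. E \<subseteq> ?P \<and> E \<in> ?Y}) \<le> failure n * 2 ^ card ?P" .
qed

theorem theorem1p1:
  shows "\<exists>c1 c2 :: real. 0 < c1 \<and> 0 < c2 \<and>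
    (\<forall>\<epsilon>::real. 0 < \<epsilon> \<longrightarrow>
      (\<exists>(n1 :: nat) (\<delta> :: nat \<Rightarrow> real). \<delta> \<longlonglongrightarrow> 0 \<and>
        (\<forall>n k :: nat. n1 \<le> n \<and> 1 < k \<and> real k < real n powr (1 / 2 - \<epsilon>) \<longrightarrow>
          1 - \<delta> n \<le> measure_pmf.prob (random_graph n (1 / 2))
            {E. c1 * (real n)\<^sup>2 / (real k ^ 3 * (ln (real n))\<^sup>2) \<le> real (theta k {..<n} E)}) \<and>
        (\<forall>n k :: nat. n1 \<le> n \<and> ln (ln (real n)) powr (1 / \<epsilon>) \<le> real k \<and> real k \<le> ln (real n) \<longrightarrow>
          1 - \<delta> n \<le> measure_pmf.prob (random_graph n (1 / 2))
            {E. real (theta k {..<n} E)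
                  \<le> c2 * (real n)\<^sup>2 / (real k powr (1 - 4 * \<epsilon>) * (ln (real n))\<^sup>2)})))"
proof -
  \<comment> \<open>Neither \<open>n1\<close> nor \<open>failure\<close> depends on
    \<epsilon>.\<close>
  obtain n1 where n1: "\<And>n. n1 \<le> n \<Longrightarrow> large n"
    using eventually_large by (auto simp: eventually_sequentially)
  have lower: "1 - failure n \<le> measure_pmf.prob (random_graph n (1 / 2))
      {E. 1/1000000 * (real n)\<^sup>2 / (real k ^ 3 * (ln (real n))\<^sup>2) \<le> real (theta k {..<n} E)}"
    if "n1 \<le> n" "1 < k" for n k
  proof -
    have "6 \<le> n" using n1[OF that(1)] by (simp add: large_def)
    moreover have "2 / real n + exp (- real n) \<le> failure n" by (simp add: failure_def)
    ultimately show ?thesis using theta_lower_bound[of n k] that(2) by linarith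
  qed
  show ?thesis
    using lower theta_upper_bound[OF n1] failure_tendsto
    by (intro exI[of _ "1/1000000 :: real"] exI[of _ "10000000 :: real"] conjI allI impI exI[of _ n1] exI[of _ failure]) auto
qed

end
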